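(* There exists a bounded, doubly connected domain $\Omega\subset\mathbb R^2$ with Lipschitz boundary, and an eigenfunction $u_1$ associated with the first positive Steklov eigenvalue $\sigma_1$ of $\Omega$, such that $u_1$ has a closed nodal line homotopic to the boundary components of $\Omega$; that is, there is a simple closed curve contained in the open set $\Omega$, on which $u_1$ vanishes, and which is (freely, up to orientation) homotopic in $\overline\Omega$ to each of the two connected components of $\partial\Omega$.
   Context: A bounded domain is a bounded connected open set. A doubly connected planar domain is a planar domain diffeomorphic to an annulus. Let $\Omega\subset\mathbb R^n$ be a bounded domain with Lipschitz boundary. A Steklov eigenfunction with eigenvalue $\sigma\in\mathbb R$ is a nonzero $u\in H^1(\Omega)$ such that $$\int_\Omega\nabla u\cdot\nabla\phi=\sigma\int_{\partial\Omega}u\phi\qquad\text{for all }\phi\in H^1(\Omega),$$ which is the weak form of $\Delta u=0$ in $\Omega$, $\partial_\nu u=\sigma u$ on $\partial\Omega$, where $\nu$ is the unit outer normal. The eigenvalues form a sequence $0=\sigma_0<\sigma_1\le\sigma_2\le\cdots\nearrow+\infty$ (repeated according to multiplicity), where $\sigma_0=0$ is simple with constant eigenfunctions. The first positive eigenvalue is $$\sigma_1=\min\left\{\frac{\int_\Omega|\nabla u|^2}{\int_{\partial\Omega}u^2}: u\in H^1(\Omega),\ u\neq0,\ \int_{\partial\Omega}u=0\right\}$$ (with $u$ having nonzero trace on $\partial\Omega$). The nodal set of an eigenfunction $u$ is $\{x\in\Omega:u(x)=0\}$; its nodal lines are the curves composing this set. *)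

theory Defs
  imports "HOL-Analysis.Analysis"
begin

text \<open>Intended for open \<open>S\<close>: \<open>C_on k S f\<close> says that all iterated partial derivatives of \<open>f\<close> of
  order at most \<open>k\<close> exist and are continuous on \<open>S\<close>.\<close>

primrec C_on :: "nat \<Rightarrow> 'a::euclidean_space set \<Rightarrow> ('a \<Rightarrow> 'b::real_normed_vector) \<Rightarrow> bool" where
  "C_on 0 S f \<longleftrightarrow> continuous_on S f"
| "C_on (Suc k) S f \<longleftrightarrow>
     (\<forall>x\<in>S. f differentiable (at x)) \<and>
     (\<forall>b\<in>Basis. C_on k S (\<lambda>x. frechet_derivative f (at x) b))"

definition smooth_on :: "'a::euclidean_space set \<Rightarrow> ('a \<Rightarrow> 'b::real_normed_vector) \<Rightarrow> bool" where
  "smooth_on S f \<longleftrightarrow> (\<forall>k. C_on k S f)"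

definition diffeomorphic :: "'a::euclidean_space set \<Rightarrow> 'b::euclidean_space set \<Rightarrow> bool" where
  "diffeomorphic S T \<longleftrightarrow>
     (\<exists>f g. smooth_on S f \<and> smooth_on T g \<and> f ` S = T \<and> g ` T = S \<and>
            (\<forall>x\<in>S. g (f x) = x) \<and> (\<forall>y\<in>T. f (g y) = y))"

definition bounded_domain :: "'a::euclidean_space set \<Rightarrow> bool" where
  "bounded_domain \<Omega> \<longleftrightarrow> bounded \<Omega> \<and> open \<Omega> \<and> connected \<Omega> \<and> \<Omega> \<noteq> {}"

definition doubly_connected :: "(real^2) set \<Rightarrow> bool" where
  "doubly_connected \<Omega> \<longleftrightarrow> diffeomorphic \<Omega> {x::real^2. 1 < norm x \<and> norm x < 2}"

text \<open>Near each boundary point, \<open>\<Omega>\<close> is the part of a ball lying above a Lipschitz graph over the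
  hyperplane orthogonal to some unit vector \<open>e\<close>.\<close>

definition lipschitz_boundary :: "'a::euclidean_space set \<Rightarrow> bool" where
  "lipschitz_boundary \<Omega> \<longleftrightarrow>
     (\<forall>p\<in>frontier \<Omega>. \<exists>r>0. \<exists>e g L. norm e = 1 \<and> L-lipschitz_on {z. z \<bullet> e = 0} g \<and>
        \<Omega> \<inter> ball p r = {x \<in> ball p r. x \<bullet> e > g (x - (x \<bullet> e) *\<^sub>R e)})"

text \<open>The \<open>d\<close>-dimensional Hausdorff measure, normalised to agree with Lebesgue measure in
  dimension \<open>d\<close>; for \<open>d = 1\<close> the weight of a set is its diameter. Covering sets are required to be
  bounded since \<^const>\<open>diameter\<close> is unspecified on unbounded sets.\<close>

definition hausdorff_weight :: "nat \<Rightarrow> 'a::metric_space set \<Rightarrow> real" where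
  "hausdorff_weight d C = (if C = {} then 0 else unit_ball_vol (real d) * (diameter C / 2) ^ d)"

definition hausdorff_pre :: "nat \<Rightarrow> real \<Rightarrow> 'a::metric_space set \<Rightarrow> ennreal" where
  "hausdorff_pre d \<delta> A =
     Inf {(\<Sum>n. ennreal (hausdorff_weight d (C n))) | C :: nat \<Rightarrow> 'a set.
            (\<forall>n. bounded (C n) \<and> diameter (C n) \<le> \<delta>) \<and> A \<subseteq> (\<Union>n. C n)}"

definition hausdorff_outer :: "nat \<Rightarrow> 'a::metric_space set \<Rightarrow> ennreal" where
  "hausdorff_outer d A = (SUP \<delta>\<in>{0<..}. hausdorff_pre d \<delta> A)"

text \<open>\<^const>\<open>hausdorff_outer\<close> is a metric outer measure, hence countably additive on Borel sets (so
  \<^const>\<open>measure_of\<close> does not collapse to the null measure).\<close>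

definition hausdorff_measure :: "nat \<Rightarrow> 'a::metric_space measure" where
  "hausdorff_measure d = measure_of UNIV (sets borel) (hausdorff_outer d)"

definition boundary_measure :: "'a::euclidean_space set \<Rightarrow> 'a measure" where
  "boundary_measure \<Omega> = restrict_space (hausdorff_measure (DIM('a) - 1)) (frontier \<Omega>)"

definition L2 :: "'a measure \<Rightarrow> ('a \<Rightarrow> 'b::euclidean_space) set" where
  "L2 M = {f \<in> borel_measurable M. integrable M (\<lambda>x. (norm (f x))\<^sup>2)}"

definition L2_tendsto :: "'a measure \<Rightarrow> (nat \<Rightarrow> 'a \<Rightarrow> 'b::euclidean_space) \<Rightarrow> ('a \<Rightarrow> 'b) \<Rightarrow> bool" where
  "L2_tendsto M F f \<longleftrightarrow> (\<forall>n. F n \<in> L2 M) \<and> f \<in> L2 M \<and>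
     (\<lambda>n. LINT x|M. (norm (F n x - f x))\<^sup>2) \<longlonglongrightarrow> 0"

definition grad :: "('a::euclidean_space \<Rightarrow> real) \<Rightarrow> 'a \<Rightarrow> 'a" where
  "grad f x = (\<Sum>b\<in>Basis. frechet_derivative f (at x) b *\<^sub>R b)"

definition test_functions :: "'a::euclidean_space set \<Rightarrow> ('a \<Rightarrow> real) set" where
  "test_functions \<Omega> = {\<phi>. smooth_on UNIV \<phi> \<and> (\<exists>K. compact K \<and> K \<subseteq> \<Omega> \<and> (\<forall>x. x \<notin> K \<longrightarrow> \<phi> x = 0))}"

definition is_weak_grad :: "'a::euclidean_space set \<Rightarrow> ('a \<Rightarrow> real) \<Rightarrow> ('a \<Rightarrow> 'a) \<Rightarrow> bool" where
  "is_weak_grad \<Omega> u w \<longleftrightarrow> w \<in> L2 (lebesgue_on \<Omega>) \<and>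
     (\<forall>\<phi>\<in>test_functions \<Omega>.
        (LINT x|lebesgue_on \<Omega>. u x *\<^sub>R grad \<phi> x) = - (LINT x|lebesgue_on \<Omega>. \<phi> x *\<^sub>R w x))"

definition H1 :: "'a::euclidean_space set \<Rightarrow> ('a \<Rightarrow> real) set" where
  "H1 \<Omega> = {u \<in> L2 (lebesgue_on \<Omega>). \<exists>w. is_weak_grad \<Omega> u w}"

text \<open>Elements of \<^const>\<open>H1\<close> are functions rather than classes modulo null sets; the weak gradient
  is unique up to null sets, so integrals do not depend on the choice made here.\<close>

definition weak_grad :: "'a::euclidean_space set \<Rightarrow> ('a \<Rightarrow> real) \<Rightarrow> 'a \<Rightarrow> 'a" where
  "weak_grad \<Omega> u = (SOME w. is_weak_grad \<Omega> u w)"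

text \<open>The trace operator is the continuous extension to \<open>H\<^sup>1(\<Omega>)\<close> of the restriction to \<open>\<partial>\<Omega>\<close> of
  functions smooth up to the boundary. \<open>has_trace \<Omega> u g\<close> describes its graph: by density and the
  trace theorem, on a bounded Lipschitz domain every \<open>u\<close> in \<open>H\<^sup>1(\<Omega>)\<close> has such a \<open>g\<close>, and \<open>g\<close> is
  unique almost everywhere on \<open>\<partial>\<Omega>\<close>.\<close>

definition has_trace :: "'a::euclidean_space set \<Rightarrow> ('a \<Rightarrow> real) \<Rightarrow> ('a \<Rightarrow> real) \<Rightarrow> bool" where
  "has_trace \<Omega> u g \<longleftrightarrow> u \<in> H1 \<Omega> \<and>
     (\<exists>F. (\<forall>n. \<exists>U. open U \<and> closure \<Omega> \<subseteq> U \<and> smooth_on U (F n)) \<and>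
          L2_tendsto (lebesgue_on \<Omega>) F u \<and>
          L2_tendsto (lebesgue_on \<Omega>) (\<lambda>n. grad (F n)) (weak_grad \<Omega> u) \<and>
          L2_tendsto (boundary_measure \<Omega>) F g)"

definition steklov_eigenfunction :: "'a::euclidean_space set \<Rightarrow> real \<Rightarrow> ('a \<Rightarrow> real) \<Rightarrow> bool" where
  "steklov_eigenfunction \<Omega> \<sigma> u \<longleftrightarrow>
     u \<in> H1 \<Omega> \<and> \<not> (AE x in lebesgue_on \<Omega>. u x = 0) \<and>
     (\<exists>g. has_trace \<Omega> u g \<and>
        (\<forall>\<phi>\<in>H1 \<Omega>. \<forall>h. has_trace \<Omega> \<phi> h \<longrightarrow>
           (LINT x|lebesgue_on \<Omega>. weak_grad \<Omega> u x \<bullet> weak_grad \<Omega> \<phi> x)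
             = \<sigma> * (LINT x|boundary_measure \<Omega>. g x * h x)))"

definition steklov_eigenvalue :: "'a::euclidean_space set \<Rightarrow> real \<Rightarrow> bool" where
  "steklov_eigenvalue \<Omega> \<sigma> \<longleftrightarrow> (\<exists>u. steklov_eigenfunction \<Omega> \<sigma> u)"

definition first_positive_steklov_eigenvalue :: "'a::euclidean_space set \<Rightarrow> real \<Rightarrow> bool" where
  "first_positive_steklov_eigenvalue \<Omega> \<sigma> \<longleftrightarrow>
     steklov_eigenvalue \<Omega> \<sigma> \<and> 0 < \<sigma> \<and> (\<forall>\<tau>. steklov_eigenvalue \<Omega> \<tau> \<and> 0 < \<tau> \<longrightarrow> \<sigma> \<le> \<tau>)"

text \<open>Meaningful for the continuous (harmonic) representative of an eigenfunction only: an arbitrary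
  representative can be altered on curves. Hence eigenfunctions are to be assumed continuous on \<open>\<Omega>\<close>
  whenever the nodal set is used.\<close>

definition nodal_set :: "'a::euclidean_space set \<Rightarrow> ('a \<Rightarrow> real) \<Rightarrow> 'a set" where
  "nodal_set \<Omega> u = {x \<in> \<Omega>. u x = 0}"

definition simple_closed_curve :: "(real \<Rightarrow> 'a::topological_space) \<Rightarrow> bool" where
  "simple_closed_curve \<gamma> \<longleftrightarrow> simple_path \<gamma> \<and> pathfinish \<gamma> = pathstart \<gamma>"

text \<open>The orientation of the parametrisation \<open>c\<close> of a boundary component is left free.\<close>

definition homotopic_to_boundary_components :: "'a::euclidean_space set \<Rightarrow> (real \<Rightarrow> 'a) \<Rightarrow> bool" where
  "homotopic_to_boundary_components \<Omega> \<gamma> \<longleftrightarrow>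
     (\<forall>K\<in>components (frontier \<Omega>).
        \<exists>c. simple_closed_curve c \<and> path_image c = K \<and> homotopic_loops (closure \<Omega>) \<gamma> c)"

end

theory Submission
  imports Defs
begin

text \<open>
  The eigenfunction is \<open>u x = ln \<bar>x\<bar>\<close>, whose nodal set is the unit circle; the domain is chosen so
  that \<open>u\<close> is an exact Steklov eigenfunction. In the coordinates \<open>x = exp s (cos t, sin t)\<close>
  the harmonic function \<open>u\<close> is \<open>s\<close> and its outward flux through a polar graph is \<open>\<plusminus>dt\<close>, so the
  Steklov condition only prescribes the arc length of the boundary: it must be \<open>dt / (\<sigma> \<bar>s\<bar>)\<close>.
  The circle \<open>s = 12\<close> fixes \<open>\<sigma> = exp (-12) / 12\<close>. On the inner side, near \<open>s = -12\<close>, a circle is far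
  too short, and the condition becomes a differential equation for the slope of the graph up to sign.
  A rapidly oscillating zigzag solves it with values in \<open>[-16, -12]\<close>.

  To see that \<open>\<sigma>\<close> is the lowest positive eigenvalue, write both sides of the variational inequality in
  the coordinates \<open>s, t\<close>. The boundary terms become \<open>f\<^sup>2 / \<bar>s\<bar> dt\<close>, and for each \<open>t\<close> a one-dimensional
  inequality bounds them by the integral of the squared radial derivative, up to a multiple of
  the square of a radial mean. After subtracting a constant this radial mean is controlled by the
  angular derivative, and the constant only contributes the square of the boundary mean.
  Since every function in \<open>H\<^sup>1\<close> with a trace is by definition a limit of smooth functions, the inequality
  extends to all eigenfunctions.
\<close>

subsection \<open>Smooth functions\<close>

text \<open>A round annulus cannot serve. With boundary circles \<open>s = -a\<close> and
  \<open>s = b\<close>, the function \<open>s\<close> is an eigenfunction only if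
  \<open>a * exp (-a) = b * exp b\<close>, so \<open>b < 1\<close>; but then the coordinate function
  \<open>x $ 1\<close>, whose boundary mean is 0, has a Rayleigh quotient below \<open>b\<close>
  times that of \<open>s\<close>. Angular oscillation becomes expensive when \<open>b\<close> is
  large, and then the inner boundary has to be much longer than a circle of its size: the teeth have
  slopes from about \<open>exp 24\<close> to about \<open>exp 28\<close>. Such slopes are harmless,
  because in the coordinates \<open>s, t\<close> the energy sees the zigzag only through the lengths
  of the fibers, which stay between 24 and 28, and the boundary form only through
  \<open>1 / \<bar>s\<bar>\<close>. The numbers 12 and 16 leave room for crude constants: the depth
  4 of the teeth enters as \<open>(l - 12) / 4 \<le> 1\<close>, and replacing the radial mean at
  each angle by the one at angle 0 costs a fraction \<open>pi * pi / 18 < 1\<close> of the angular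
  energy.\<close>

lemma C_on_cong:
  assumes "open S" "\<And>x. x \<in> S \<Longrightarrow> f x = g x"
  shows "C_on k S f \<longleftrightarrow> C_on k S g"
  using assms(2)
proof (induction k arbitrary: f g)
  case 0
  then show ?case by (auto intro!: continuous_on_cong)
next
  case (Suc k)
  have hd: "(f has_derivative D) (at x) \<longleftrightarrow> (g has_derivative D) (at x)" if "x \<in> S" for x D
    using has_derivative_transform_within_open[OF _ assms(1) that, of f D UNIV g]
      has_derivative_transform_within_open[OF _ assms(1) that, of g D UNIV f] Suc.prems by auto
  have d: "f differentiable (at x) \<longleftrightarrow> g differentiable (at x)" if "x \<in> S" for x
    using hd[OF that] by (auto simp: differentiable_def)
  \<comment> \<open>This equality also covers points where neither function is differentiable:
    \<open>frechet_derivative\<close> is a choice from the predicate \<open>has_derivative\<close>,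
    and by \<open>hd\<close> the two predicates coincide.\<close>
  have fd: "frechet_derivative f (at x) = frechet_derivative g (at x)" if "x \<in> S" for x
    using hd[OF that] by (simp add: frechet_derivative_def)
  have "C_on k S (\<lambda>x. frechet_derivative f (at x) b) \<longleftrightarrow> C_on k S (\<lambda>x. frechet_derivative g (at x) b)" for b
    by (rule Suc.IH) (simp add: fd)
  then show ?case using d by auto
qed

text \<open>Lets an induction run on an explicit derivative \<open>f'\<close>; unfolding the
  definition would leave a Hilbert choice under \<open>C_on k\<close>.\<close>

lemma C_on_SucI:
  assumes "open S" and d: "\<And>x. x \<in> S \<Longrightarrow> (f has_derivative f' x) (at x)"
    and "\<And>b. b \<in> Basis \<Longrightarrow> C_on k S (\<lambda>x. f' x b)"
  shows "C_on (Suc k) S f"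
proof -
  have "C_on k S (\<lambda>x. frechet_derivative f (at x) b)" if "b \<in> Basis" for b
    using C_on_cong[OF assms(1), of "\<lambda>x. frechet_derivative f (at x) b" "\<lambda>x. f' x b" k]
      frechet_derivative_at[OF d] assms(3)[OF that] by auto
  then show ?thesis using d by (auto simp: differentiable_def)
qed

lemma C_on_SucD:
  assumes "C_on (Suc k) S f"
  shows "\<And>x. x \<in> S \<Longrightarrow> (f has_derivative frechet_derivative f (at x)) (at x)"
    and "\<And>b. b \<in> Basis \<Longrightarrow> C_on k S (\<lambda>x. frechet_derivative f (at x) b)"
  using assms by (auto simp: frechet_derivative_works)

lemma C_on_Suc_imp: "C_on (Suc k) S f \<Longrightarrow> C_on k S f"
proof (induction k arbitrary: f)
  case 0
  then show ?case
    using differentiable_imp_continuous_on[of f S] differentiable_at_withinI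
    by (fastforce simp: differentiable_on_def)
qed auto

lemma C_on_imp_continuous: "C_on k S f \<Longrightarrow> continuous_on S f"
  by (induction k) (use C_on_Suc_imp in \<open>auto simp del: C_on.simps(2)\<close>)

lemma C_on_subset: "C_on k S f \<Longrightarrow> T \<subseteq> S \<Longrightarrow> C_on k T f"
  by (induction k arbitrary: f) (auto intro: continuous_on_subset)

lemma C_on_const: "open S \<Longrightarrow> C_on k S (\<lambda>x. c)"
proof (induction k arbitrary: c)
  case (Suc k)
  show ?case
    by (rule C_on_SucI[where f' = "\<lambda>x h. 0"]) (use Suc in auto)
qed auto

lemma C_on_bounded_linear:
  assumes "open S" "bounded_linear h" "C_on k S f"
  shows "C_on k S (\<lambda>x. h (f x))"
  using assms(3)
proof (induction k arbitrary: f)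
  case 0
  then show ?case using assms(2) by (auto intro: bounded_linear.continuous_on)
next
  case (Suc k)
  show ?case
    by (rule C_on_SucI[OF assms(1), where f' = "\<lambda>x b. h (frechet_derivative f (at x) b)"])
      (use C_on_SucD[OF Suc.prems] Suc.IH assms(2) in
        \<open>auto intro!: bounded_linear.has_derivative[OF assms(2)]\<close>)
qed

lemma C_on_add:
  assumes "open S" "C_on k S f" "C_on k S g"
  shows "C_on k S (\<lambda>x. f x + g x)"
  using assms(2,3)
proof (induction k arbitrary: f g)
  case 0
  then show ?case by (auto intro: continuous_on_add)
next
  case (Suc k)
  show ?case
    by (rule C_on_SucI[OF assms(1), where
          f' = "\<lambda>x b. frechet_derivative f (at x) b + frechet_derivative g (at x) b"])
      (use C_on_SucD[OF Suc.prems(1)] C_on_SucD[OF Suc.prems(2)] Suc.IH in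
        \<open>auto intro!: has_derivative_add\<close>)
qed

lemma C_on_sum:
  assumes "open S" "\<And>i. i \<in> I \<Longrightarrow> C_on k S (f i)"
  shows "C_on k S (\<lambda>x. \<Sum>i\<in>I. f i x)"
  using assms(2)
  by (induction I rule: infinite_finite_induct) (auto intro!: C_on_const C_on_add assms(1))

text \<open>A single product rule that serves scaling, multiplication and inner products
  alike.\<close>

lemma C_on_bounded_bilinear:
  assumes "open S" "bounded_bilinear p" "C_on k S f" "C_on k S g"
  shows "C_on k S (\<lambda>x. p (f x) (g x))"
  using assms(3,4)
proof (induction k arbitrary: f g)
  case 0
  then show ?case using assms(2) by (auto intro: bounded_bilinear.continuous_on)
next
  case (Suc k)
  show ?case
    by (rule C_on_SucI[OF assms(1), where
          f' = "\<lambda>x b. p (f x) (frechet_derivative g (at x) b) + p (frechet_derivative f (at x) b) (g x)"])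
      (use C_on_SucD[OF Suc.prems(1)] C_on_SucD[OF Suc.prems(2)] Suc.IH
          C_on_Suc_imp[OF Suc.prems(1)] C_on_Suc_imp[OF Suc.prems(2)] in
        \<open>auto intro!: bounded_bilinear.FDERIV[OF assms(2)] C_on_add assms(1)\<close>)
qed

lemma C_on_compose:
  fixes g :: "'a::euclidean_space \<Rightarrow> 'b::euclidean_space" and F :: "'b \<Rightarrow> 'c::real_normed_vector"
  assumes "open S" "open T" "g ` S \<subseteq> T" "C_on k T F" "C_on k S g"
  shows "C_on k S (\<lambda>x. F (g x))"
  using assms(4,5)
proof (induction k arbitrary: F)
  case 0
  then show ?case using assms(3) by (auto intro: continuous_on_compose2)
next
  case (Suc k)
  show ?case
  proof (rule C_on_SucI[OF assms(1), where f' = "\<lambda>x b. \<Sum>i\<in>Basis.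
          (frechet_derivative g (at x) b \<bullet> i) *\<^sub>R frechet_derivative F (at (g x)) i"])
    fix x assume x: "x \<in> S"
    have D: "((\<lambda>x. F (g x)) has_derivative
       (\<lambda>b. frechet_derivative F (at (g x)) (frechet_derivative g (at x) b))) (at x)"
      by (rule has_derivative_compose[OF C_on_SucD(1)[OF Suc.prems(2) x]
            C_on_SucD(1)[OF Suc.prems(1)]]) (use x assms(3) in auto)
    \<comment> \<open>The outer derivative is expanded in the basis because the induction hypothesis
      controls \<open>frechet_derivative F\<close> in fixed basis directions only, not in the moving
      direction given by the derivative of \<open>g\<close>.\<close>
    have "frechet_derivative F (at (g x)) v =
        (\<Sum>i\<in>Basis. (v \<bullet> i) *\<^sub>R frechet_derivative F (at (g x)) i)" for v
    proof -
      have l: "linear (frechet_derivative F (at (g x)))"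
        using C_on_SucD(1)[OF Suc.prems(1)] x assms(3) has_derivative_linear by blast
      have "frechet_derivative F (at (g x)) v = frechet_derivative F (at (g x)) (\<Sum>i\<in>Basis. (v \<bullet> i) *\<^sub>R i)"
        by (simp add: euclidean_representation)
      then show ?thesis by (simp add: linear_sum[OF l] linear_scale[OF l])
    qed
    then have E: "(\<lambda>b. frechet_derivative F (at (g x)) (frechet_derivative g (at x) b)) = (\<lambda>b. \<Sum>i\<in>Basis.
          (frechet_derivative g (at x) b \<bullet> i) *\<^sub>R frechet_derivative F (at (g x)) i)"
      by (intro ext)
    show "((\<lambda>x. F (g x)) has_derivative (\<lambda>b. \<Sum>i\<in>Basis.
          (frechet_derivative g (at x) b \<bullet> i) *\<^sub>R frechet_derivative F (at (g x)) i)) (at x)"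
      by (rule has_derivative_eq_rhs[OF D E])
  next
    fix b :: 'a assume b: "b \<in> Basis"
    show "C_on k S (\<lambda>x. \<Sum>i\<in>Basis.
          (frechet_derivative g (at x) b \<bullet> i) *\<^sub>R frechet_derivative F (at (g x)) i)"
    proof (rule C_on_sum[OF assms(1)], rule C_on_bounded_bilinear[OF assms(1) bounded_bilinear_scaleR])
      fix i :: 'b assume i: "i \<in> Basis"
      show "C_on k S (\<lambda>x. frechet_derivative g (at x) b \<bullet> i)"
        by (rule C_on_bounded_linear[OF assms(1) bounded_linear_inner_left C_on_SucD(2)[OF Suc.prems(2) b]])
      show "C_on k S (\<lambda>x. frechet_derivative F (at (g x)) i)"
        by (rule Suc.IH[OF C_on_SucD(2)[OF Suc.prems(1) i] C_on_Suc_imp[OF Suc.prems(2)]])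
    qed
  qed
qed

lemma C_on_real_SucI:
  fixes f :: "real \<Rightarrow> real"
  assumes "open S" "\<And>x. x \<in> S \<Longrightarrow> (f has_field_derivative f' x) (at x)" "C_on k S f'"
  shows "C_on (Suc k) S f"
  by (rule C_on_SucI[OF assms(1), where f' = "\<lambda>x h. f' x * h"])
    (use assms in \<open>auto simp: has_field_derivative_def\<close>)

section \<open>Closure properties of smoothness and the elementary functions\<close>

lemma smooth_on_cong:
  "open S \<Longrightarrow> (\<And>x. x \<in> S \<Longrightarrow> f x = g x) \<Longrightarrow> smooth_on S f \<longleftrightarrow> smooth_on S g"
  unfolding smooth_on_def using C_on_cong by metis

lemma smooth_on_subset: "smooth_on S f \<Longrightarrow> T \<subseteq> S \<Longrightarrow> smooth_on T f"
  by (auto simp: smooth_on_def intro: C_on_subset)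

lemma smooth_on_imp_continuous: "smooth_on S f \<Longrightarrow> continuous_on S f"
  by (auto simp: smooth_on_def intro: C_on_imp_continuous)

lemma smooth_on_has_derivative:
  "smooth_on S f \<Longrightarrow> x \<in> S \<Longrightarrow> (f has_derivative frechet_derivative f (at x)) (at x)"
  unfolding smooth_on_def using C_on_SucD(1) by blast

lemma smooth_on_derivative:
  "smooth_on S f \<Longrightarrow> b \<in> Basis \<Longrightarrow> smooth_on S (\<lambda>x. frechet_derivative f (at x) b)"
  unfolding smooth_on_def using C_on_SucD(2) by blast

lemma smooth_on_const: "open S \<Longrightarrow> smooth_on S (\<lambda>x. c)"
  by (simp add: smooth_on_def C_on_const)

lemma smooth_on_bounded_linear:
  "open S \<Longrightarrow> bounded_linear h \<Longrightarrow> smooth_on S f \<Longrightarrow> smooth_on S (\<lambda>x. h (f x))"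
  by (simp add: smooth_on_def C_on_bounded_linear)

lemma smooth_on_add:
  "open S \<Longrightarrow> smooth_on S f \<Longrightarrow> smooth_on S g \<Longrightarrow> smooth_on S (\<lambda>x. f x + g x)"
  by (simp add: smooth_on_def C_on_add)

lemma smooth_on_sum:
  "open S \<Longrightarrow> (\<And>i. i \<in> I \<Longrightarrow> smooth_on S (f i)) \<Longrightarrow> smooth_on S (\<lambda>x. \<Sum>i\<in>I. f i x)"
  by (simp add: smooth_on_def C_on_sum)

lemma smooth_on_bounded_bilinear:
  "open S \<Longrightarrow> bounded_bilinear p \<Longrightarrow> smooth_on S f \<Longrightarrow> smooth_on S g \<Longrightarrow> smooth_on S (\<lambda>x. p (f x) (g x))"
  by (simp add: smooth_on_def C_on_bounded_bilinear)

lemmas smooth_on_scaleR = smooth_on_bounded_bilinear[OF _ bounded_bilinear_scaleR]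
  and smooth_on_mult = smooth_on_bounded_bilinear[OF _ bounded_bilinear_mult]
  and smooth_on_inner = smooth_on_bounded_bilinear[OF _ bounded_bilinear_inner]

lemma smooth_on_minus: "open S \<Longrightarrow> smooth_on S f \<Longrightarrow> smooth_on S (\<lambda>x. - f x)"
  by (rule smooth_on_bounded_linear[OF _ bounded_linear_minus[OF bounded_linear_ident]])

lemma smooth_on_diff:
  "open S \<Longrightarrow> smooth_on S f \<Longrightarrow> smooth_on S g \<Longrightarrow> smooth_on S (\<lambda>x. f x - g x)"
  using smooth_on_add[of S f "\<lambda>x. - g x"] smooth_on_minus[of S g] by simp

lemma smooth_on_compose:
  fixes g :: "'a::euclidean_space \<Rightarrow> 'b::euclidean_space" and F :: "'b \<Rightarrow> 'c::real_normed_vector"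
  assumes "smooth_on T F" "smooth_on S g" "open S" "open T" "\<And>x. x \<in> S \<Longrightarrow> g x \<in> T"
  shows "smooth_on S (\<lambda>x. F (g x))"
  using assms C_on_compose[of S T g _ F] by (auto simp: smooth_on_def image_subset_iff)

lemma smooth_on_ident: "open S \<Longrightarrow> smooth_on S (\<lambda>x. x)"
  unfolding smooth_on_def
proof
  fix k assume S: "open S"
  show "C_on k S (\<lambda>x. x)"
  proof (cases k)
    case (Suc j)
    show ?thesis unfolding Suc
      by (rule C_on_SucI[OF S, where f' = "\<lambda>x h. h"]) (auto intro: C_on_const S)
  qed auto
qed

lemma smooth_on_linear: "open S \<Longrightarrow> bounded_linear h \<Longrightarrow> smooth_on S h"
  using smooth_on_bounded_linear[of S h "\<lambda>x. x"] smooth_on_ident by auto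

lemma smooth_on_power:
  fixes f :: "'a::euclidean_space \<Rightarrow> real"
  shows "open S \<Longrightarrow> smooth_on S f \<Longrightarrow> smooth_on S (\<lambda>x. f x ^ n)"
  by (induction n) (auto intro: smooth_on_const smooth_on_mult)

text \<open>Transfers smoothness from the derivative to the function; \<open>ln\<close> and
  \<open>arccos\<close> then inherit it from reciprocals and square roots.\<close>

lemma smooth_on_real_antiderivative:
  fixes f :: "real \<Rightarrow> real"
  assumes "open S" "\<And>x. x \<in> S \<Longrightarrow> (f has_field_derivative f' x) (at x)" "smooth_on S f'"
  shows "smooth_on S f"
  unfolding smooth_on_def
proof
  fix k
  have "C_on (Suc k) S f"
    by (rule C_on_real_SucI[OF assms(1,2)]) (use assms(3) in \<open>auto simp: smooth_on_def\<close>)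
  then show "C_on k S f" by (rule C_on_Suc_imp)
qed

lemma smooth_on_exp_real: "smooth_on UNIV (exp :: real \<Rightarrow> real)"
  unfolding smooth_on_def
proof
  fix k show "C_on k UNIV (exp :: real \<Rightarrow> real)"
  proof (induction k)
    case (Suc k)
    show ?case by (rule C_on_real_SucI[OF _ _ Suc]) (auto intro: DERIV_exp)
  qed (auto intro: continuous_intros)
qed

text \<open>Up to sign each function is the derivative of the other, so one induction has to carry
  both.\<close>

lemma C_on_sin_cos: "C_on k UNIV (sin :: real \<Rightarrow> real) \<and> C_on k UNIV (cos :: real \<Rightarrow> real)"
proof (induction k)
  case 0
  then show ?case by (auto intro: continuous_intros)
next
  case (Suc k)
  have "C_on k UNIV (\<lambda>x::real. - sin x)"
    by (rule C_on_bounded_linear[OF _ bounded_linear_minus[OF bounded_linear_ident]]) (use Suc in auto)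
  then show ?case
    using C_on_real_SucI[of UNIV sin cos k] C_on_real_SucI[of UNIV cos "\<lambda>x. - sin x" k] Suc
      DERIV_sin DERIV_cos by (auto simp del: C_on.simps)
qed

lemma smooth_on_inverse_real: "smooth_on (- {0}) (inverse :: real \<Rightarrow> real)"
  unfolding smooth_on_def
proof
  fix k show "C_on k (- {0}) (inverse :: real \<Rightarrow> real)"
  proof (induction k)
    case 0
    show ?case by (auto intro!: continuous_intros)
  next
    case (Suc k)
    have op: "open (- {0::real})" by auto
    have "C_on k (- {0}) (\<lambda>x::real. - (inverse x * inverse x))"
      by (intro C_on_bounded_linear[OF op bounded_linear_minus[OF bounded_linear_ident]]
          C_on_bounded_bilinear[OF op bounded_bilinear_mult] Suc)
    then show ?case
      by (intro C_on_real_SucI[OF op, where f' = "\<lambda>x. - (inverse x * inverse x)"])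
        (auto intro!: derivative_eq_intros)
  qed
qed

lemma smooth_on_inverse:
  fixes f :: "'a::euclidean_space \<Rightarrow> real"
  assumes "open S" "smooth_on S f" "\<And>x. x \<in> S \<Longrightarrow> f x \<noteq> 0"
  shows "smooth_on S (\<lambda>x. inverse (f x))"
  by (rule smooth_on_compose[OF smooth_on_inverse_real assms(2,1)]) (use assms in auto)

lemma smooth_on_divide:
  fixes f g :: "'a::euclidean_space \<Rightarrow> real"
  assumes "open S" "smooth_on S f" "smooth_on S g" "\<And>x. x \<in> S \<Longrightarrow> g x \<noteq> 0"
  shows "smooth_on S (\<lambda>x. f x / g x)"
  unfolding divide_inverse by (intro smooth_on_mult smooth_on_inverse assms)

lemma smooth_on_ln_real: "smooth_on {0<..} (ln :: real \<Rightarrow> real)"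
  by (rule smooth_on_real_antiderivative[where f' = inverse])
    (auto intro!: derivative_eq_intros smooth_on_subset[OF smooth_on_inverse_real] simp: field_simps)

lemma smooth_on_exp:
  fixes f :: "'a::euclidean_space \<Rightarrow> real"
  assumes "open S" "smooth_on S f"
  shows "smooth_on S (\<lambda>x. exp (f x))"
  by (rule smooth_on_compose[OF smooth_on_exp_real assms(2,1)]) auto

lemma smooth_on_ln:
  fixes f :: "'a::euclidean_space \<Rightarrow> real"
  assumes "open S" "smooth_on S f" "\<And>x. x \<in> S \<Longrightarrow> f x > 0"
  shows "smooth_on S (\<lambda>x. ln (f x))"
  by (rule smooth_on_compose[OF smooth_on_ln_real assms(2,1)]) (use assms in auto)

lemma smooth_on_sqrt_real: "smooth_on {0<..} (sqrt :: real \<Rightarrow> real)"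
proof -
  have "smooth_on {0<..} (\<lambda>x::real. exp (ln x / 2))"
    by (intro smooth_on_exp smooth_on_divide smooth_on_ln smooth_on_const smooth_on_ident) auto
  moreover have "exp (ln x / 2) = sqrt x" if "x \<in> {0<..}" for x :: real
    using that by (simp flip: ln_sqrt)
  ultimately show ?thesis
    using smooth_on_cong[OF open_greaterThan, of 0 "\<lambda>x. exp (ln x / 2)" sqrt] by blast
qed

lemma smooth_on_sqrt:
  fixes f :: "'a::euclidean_space \<Rightarrow> real"
  assumes "open S" "smooth_on S f" "\<And>x. x \<in> S \<Longrightarrow> f x > 0"
  shows "smooth_on S (\<lambda>x. sqrt (f x))"
  by (rule smooth_on_compose[OF smooth_on_sqrt_real assms(2,1)]) (use assms in auto)

lemma smooth_on_arccos_real: "smooth_on {-1<..<1} (arccos :: real \<Rightarrow> real)"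
proof -
  have pos: "0 < 1 - x\<^sup>2" if "x \<in> {-1<..<1}" for x :: real
    using that by (simp add: abs_square_less_1 abs_less_iff)
  show ?thesis
  proof (rule smooth_on_real_antiderivative[where f' = "\<lambda>x. inverse (- sqrt (1 - x\<^sup>2))"])
    show "smooth_on {-1<..<1} (\<lambda>x::real. inverse (- sqrt (1 - x\<^sup>2)))"
    proof (rule smooth_on_inverse, simp, rule smooth_on_minus, simp, rule smooth_on_sqrt)
      show "smooth_on {-1<..<1} (\<lambda>x::real. 1 - x\<^sup>2)"
        by (intro smooth_on_diff smooth_on_const smooth_on_power smooth_on_ident) auto
      show "- sqrt (1 - x\<^sup>2) \<noteq> 0" if "x \<in> {-1<..<1}" for x :: real
        using pos[OF that] by simp
    qed (use pos in auto)
  next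
    fix x :: real assume "x \<in> {-1<..<1}"
    then show "(arccos has_field_derivative inverse (- sqrt (1 - x\<^sup>2))) (at x)"
      using DERIV_arccos[of x] by auto
  qed auto
qed

lemma smooth_on_arccos:
  fixes f :: "'a::euclidean_space \<Rightarrow> real"
  assumes "open S" "smooth_on S f" "\<And>x. x \<in> S \<Longrightarrow> \<bar>f x\<bar> < 1"
  shows "smooth_on S (\<lambda>x. arccos (f x))"
proof (rule smooth_on_compose[OF smooth_on_arccos_real assms(2,1)])
  show "f x \<in> {-1<..<1}" if "x \<in> S" for x
    using assms(3)[OF that] by (auto simp: abs_less_iff)
qed auto

lemma smooth_on_norm: "open S \<Longrightarrow> 0 \<notin> S \<Longrightarrow> smooth_on S (\<lambda>x::'a::euclidean_space. norm x)"
  unfolding norm_eq_sqrt_inner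
  by (intro smooth_on_sqrt smooth_on_inner smooth_on_ident) auto

text \<open>Bootstrapping: the derivative of \<open>g\<close> at \<open>y\<close> is
  \<open>A (g y)\<close>, so if \<open>g\<close> is of class \<open>k\<close>, then so is its
  derivative, and \<open>g\<close> is of class \<open>Suc k\<close>. Asking for a smooth right
  inverse \<open>A\<close> of the derivative replaces any argument about inverting linear maps
  smoothly.\<close>

lemma smooth_on_inverse_function:
  fixes f :: "'a::euclidean_space \<Rightarrow> 'a"
  assumes "open S" "open T" "f ` S = T"
    and d: "\<And>x. x \<in> S \<Longrightarrow> (f has_derivative f' x) (at x)"
    and inv: "\<And>x. x \<in> S \<Longrightarrow> g (f x) = x"
    and A: "\<And>x. x \<in> S \<Longrightarrow> f' x \<circ> A x = id"
    and sm: "\<And>b. b \<in> Basis \<Longrightarrow> smooth_on S (\<lambda>x. A x b)"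
  shows "smooth_on T g"
proof -
  have dg: "(g has_derivative A (g y)) (at y)" if "y \<in> T" for y
  proof -
    obtain x where x: "x \<in> S" "y = f x" using \<open>y \<in> T\<close> assms(3) by blast
    show ?thesis
      using has_derivative_inverse_on[where g' = A, OF assms(1) d inv A[OF x(1)] x(1)] x inv by simp
  qed
  have im: "g ` T \<subseteq> S" using inv assms(3) by auto
  show ?thesis unfolding smooth_on_def
  proof
    fix k show "C_on k T g"
    proof (induction k)
      case 0
      show ?case
        unfolding C_on.simps
        by (rule has_derivative_continuous_on[where f' = "\<lambda>y. A (g y)"])
          (rule has_derivative_at_withinI[OF dg])
    next
      case (Suc k)
      show ?case
        by (rule C_on_SucI[OF assms(2) dg])
          (use sm in \<open>auto simp: smooth_on_def intro!: C_on_compose[OF assms(2,1) im _ Suc]\<close>)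
    qed
  qed
qed

subsection \<open>Hausdorff measure\<close>

lemma hausdorff_weight_1:
  fixes C :: "'a::metric_space set"
  shows "hausdorff_weight 1 C = diameter C"
  by (simp add: hausdorff_weight_def unit_ball_vol_1)

lemma hausdorff_pre_mono: "A \<subseteq> B \<Longrightarrow> hausdorff_pre d \<delta> A \<le> hausdorff_pre d \<delta> B"
  unfolding hausdorff_pre_def by (rule Inf_superset_mono) blast

lemma hausdorff_pre_antimono: "\<delta> \<le> \<delta>' \<Longrightarrow> hausdorff_pre d \<delta>' A \<le> hausdorff_pre d \<delta> A"
  unfolding hausdorff_pre_def by (rule Inf_superset_mono) (blast intro: order_trans)

lemma hausdorff_pre_le:
  assumes "\<And>n. bounded (C n)" "\<And>n. diameter (C n) \<le> \<delta>" "A \<subseteq> (\<Union>n::nat. C n)"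
  shows "hausdorff_pre d \<delta> A \<le> (\<Sum>n. ennreal (hausdorff_weight d (C n)))"
  unfolding hausdorff_pre_def
  apply (rule Inf_lower)
  apply (rule CollectI)
  apply (rule exI[of _ C])
  using assms apply simp
  done

lemma hausdorff_pre_less:
  assumes "hausdorff_pre d \<delta> A < x"
  shows "\<exists>C. (\<forall>n::nat. bounded (C n) \<and> diameter (C n) \<le> \<delta>) \<and> A \<subseteq> (\<Union>n. C n) \<and>
      (\<Sum>n. ennreal (hausdorff_weight d (C n))) \<le> x"
proof -
  obtain u where "u < x" and u: "\<exists>C. u = (\<Sum>n. ennreal (hausdorff_weight d (C n))) \<and>
      (\<forall>n. bounded (C n) \<and> diameter (C n) \<le> \<delta>) \<and> A \<subseteq> (\<Union>n::nat. C n)"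
    using assms unfolding hausdorff_pre_def Inf_less_iff mem_Collect_eq by (elim bexE CollectE)
  from u obtain C where "u = (\<Sum>n. ennreal (hausdorff_weight d (C n)))"
      "\<forall>n. bounded (C n) \<and> diameter (C n) \<le> \<delta>" "A \<subseteq> (\<Union>n::nat. C n)"
    by (elim exE conjE)
  with \<open>u < x\<close> show ?thesis by (intro exI[of _ C]) (simp add: less_imp_le)
qed

text \<open>Covers of \<open>A n\<close> that are optimal up to \<open>e / 2 ^ (n + 1)\<close> are
  merged into one sequence along \<open>prod_decode\<close>.\<close>

lemma hausdorff_pre_countable_subadditive:
  fixes A :: "nat \<Rightarrow> 'a::metric_space set"
  shows "hausdorff_pre d \<delta> (\<Union>i. A i) \<le> (\<Sum>i. hausdorff_pre d \<delta> (A i))"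
proof (rule ennreal_le_epsilon)
  fix e :: real assume e: "0 < e" and fin: "(\<Sum>i. hausdorff_pre d \<delta> (A i)) < top"
  have "hausdorff_pre d \<delta> (A n) < hausdorff_pre d \<delta> (A n) + e * (1/2)^Suc n" for n
    using e fin by (auto simp add: less_top dest!: ennreal_suminf_lessD)
  then have "\<exists>B. (\<forall>i. bounded (B i) \<and> diameter (B i) \<le> \<delta>) \<and> A n \<subseteq> (\<Union>i. B i) \<and>
      (\<Sum>i. ennreal (hausdorff_weight d (B i))) \<le> hausdorff_pre d \<delta> (A n) + e * (1/2)^Suc n" for n
    by (rule hausdorff_pre_less)
  then obtain B where B: "\<And>n i. bounded (B n i)" "\<And>n i. diameter (B n i) \<le> \<delta>"
      "\<And>n. A n \<subseteq> (\<Union>i. B n i)"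
      "\<And>n. (\<Sum>i. ennreal (hausdorff_weight d (B n i))) \<le> hausdorff_pre d \<delta> (A n) + e * (1/2)^Suc n"
    by metis
  define C where "C = case_prod B \<circ> prod_decode"
  have "(\<Union>i. A i) \<subseteq> (\<Union>i. C i)"
    using B(3) by (auto simp add: C_def subset_eq) (metis prod.case prod_encode_inverse)
  then have "hausdorff_pre d \<delta> (\<Union>i. A i) \<le> (\<Sum>i. ennreal (hausdorff_weight d (C i)))"
    by (intro hausdorff_pre_le) (use B in \<open>auto simp: C_def split_def\<close>)
  also have "\<dots> = (\<Sum>n. \<Sum>i. ennreal (hausdorff_weight d (B n i)))"
    using suminf_ennreal_2dimen[where f = "\<lambda>(n, i). ennreal (hausdorff_weight d (B n i))"]
    unfolding C_def comp_def by (simp add: split_def)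
  also have "\<dots> \<le> (\<Sum>n. hausdorff_pre d \<delta> (A n) + e * (1/2) ^ Suc n)"
    by (intro suminf_le B) auto
  also have "\<dots> = (\<Sum>n. hausdorff_pre d \<delta> (A n)) + (\<Sum>n. ennreal e * ennreal ((1/2) ^ Suc n))"
    using e by (subst suminf_add[symmetric])
      (auto simp del: ennreal_suminf_cmult simp add: ennreal_mult[symmetric])
  also have "\<dots> = (\<Sum>n. hausdorff_pre d \<delta> (A n)) + e"
    unfolding ennreal_suminf_cmult
    by (subst suminf_ennreal_eq[OF zero_le_power power_half_series]) auto
  finally show "hausdorff_pre d \<delta> (\<Union>i. A i) \<le> (\<Sum>i. hausdorff_pre d \<delta> (A i)) + e" .
qed

section \<open>The Hausdorff outer measure as a metric outer measure\<close>

lemma hausdorff_pre_le_outer: "\<delta> > 0 \<Longrightarrow> hausdorff_pre d \<delta> A \<le> hausdorff_outer d A"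
  unfolding hausdorff_outer_def by (rule SUP_upper) simp

lemma hausdorff_outer_mono: "A \<subseteq> B \<Longrightarrow> hausdorff_outer d A \<le> hausdorff_outer d B"
  unfolding hausdorff_outer_def by (intro SUP_mono) (use hausdorff_pre_mono in blast)

lemma hausdorff_outer_empty: "hausdorff_outer d ({} :: 'a::metric_space set) = 0"
proof -
  have "hausdorff_pre d \<delta> ({} :: 'a set) \<le> 0" if "\<delta> > 0" for \<delta>
    using hausdorff_pre_le[of "\<lambda>_. {}" \<delta> "{}" d] that by (simp add: hausdorff_weight_def)
  then have "hausdorff_outer d ({} :: 'a set) \<le> 0"
    unfolding hausdorff_outer_def by (intro SUP_least) auto
  then show ?thesis by simp
qed

lemma hausdorff_outer_countable_subadditive:
  fixes A :: "nat \<Rightarrow> 'a::metric_space set"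
  shows "hausdorff_outer d (\<Union>i. A i) \<le> (\<Sum>i. hausdorff_outer d (A i))"
  unfolding hausdorff_outer_def[of d "\<Union>i. A i"]
proof (rule SUP_least)
  fix \<delta> :: real assume "\<delta> \<in> {0<..}"
  then show "hausdorff_pre d \<delta> (\<Union>i. A i) \<le> (\<Sum>i. hausdorff_outer d (A i))"
    by (intro order_trans[OF hausdorff_pre_countable_subadditive] suminf_le hausdorff_pre_le_outer) auto
qed

lemma hausdorff_outer_space:
  "outer_measure_space (Pow UNIV) (hausdorff_outer d :: 'a::metric_space set \<Rightarrow> ennreal)"
  by (auto simp: outer_measure_space_def positive_def increasing_def countably_subadditive_def
      hausdorff_outer_empty hausdorff_outer_mono hausdorff_outer_countable_subadditive)

text \<open>A covering set of diameter at most \<delta> cannot meet both \<open>A\<close> and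
  \<open>B\<close>, so every cover of the union splits into a cover of each.\<close>

lemma hausdorff_pre_separated:
  fixes A B :: "'a::metric_space set"
  assumes sep: "\<And>x y. x \<in> A \<Longrightarrow> y \<in> B \<Longrightarrow> \<delta> < dist x y"
  shows "hausdorff_pre d \<delta> A + hausdorff_pre d \<delta> B \<le> hausdorff_pre d \<delta> (A \<union> B)"
  unfolding hausdorff_pre_def[of d \<delta> "A \<union> B"]
proof (rule Inf_greatest, clarify)
  fix C :: "nat \<Rightarrow> 'a set"
  assume C: "\<forall>n. bounded (C n) \<and> diameter (C n) \<le> \<delta>" and sub: "A \<union> B \<subseteq> (\<Union>n. C n)"
  \<comment> \<open>Discarded sets are replaced by the empty set, which has weight 0 in every
    dimension by the case distinction in \<open>hausdorff_weight\<close>. Hence the weights of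
    \<open>P n\<close> and \<open>Q n\<close> add up to that of \<open>C n\<close>.\<close>
  define P where "P n = (if C n \<inter> A \<noteq> {} then C n else {})" for n
  define Q where "Q n = (if C n \<inter> A \<noteq> {} then {} else C n)" for n
  have \<delta>: "0 \<le> \<delta>" using C diameter_ge_0 order_trans by blast
  have "hausdorff_pre d \<delta> A \<le> (\<Sum>n. ennreal (hausdorff_weight d (P n)))"
    by (rule hausdorff_pre_le) (use C \<delta> sub in \<open>force simp: P_def\<close>)+
  moreover have "y \<in> (\<Union>n. Q n)" if "y \<in> B" for y
  proof -
    obtain n where n: "y \<in> C n" using \<open>y \<in> B\<close> sub by blast
    have "x \<notin> A" if "x \<in> C n" for x
      using sep[OF _ \<open>y \<in> B\<close>, of x] diameter_bounded_bound[OF _ that n] C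
      by (meson leD order_trans)
    then have "C n \<inter> A = {}" by blast
    then show ?thesis using n by (auto simp: Q_def)
  qed
  then have "hausdorff_pre d \<delta> B \<le> (\<Sum>n. ennreal (hausdorff_weight d (Q n)))"
    by (intro hausdorff_pre_le) (use C \<delta> in \<open>auto simp: Q_def\<close>)
  ultimately have "hausdorff_pre d \<delta> A + hausdorff_pre d \<delta> B
      \<le> (\<Sum>n. ennreal (hausdorff_weight d (P n))) + (\<Sum>n. ennreal (hausdorff_weight d (Q n)))"
    by (rule add_mono)
  also have "\<dots> = (\<Sum>n. ennreal (hausdorff_weight d (P n)) + ennreal (hausdorff_weight d (Q n)))"
    by (rule suminf_add) auto
  also have "\<dots> = (\<Sum>n. ennreal (hausdorff_weight d (C n)))"
    by (rule suminf_cong) (auto simp: P_def Q_def hausdorff_weight_def)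
  finally show "hausdorff_pre d \<delta> A + hausdorff_pre d \<delta> B \<le> (\<Sum>n. ennreal (hausdorff_weight d (C n)))" .
qed

lemma hausdorff_outer_separated:
  fixes A B :: "'a::metric_space set"
  assumes sep: "\<And>x y. x \<in> A \<Longrightarrow> y \<in> B \<Longrightarrow> \<epsilon> \<le> dist x y" and "\<epsilon> > 0"
  shows "hausdorff_outer d A + hausdorff_outer d B \<le> hausdorff_outer d (A \<union> B)"
proof -
  have "hausdorff_outer d A + hausdorff_outer d B
      = (SUP \<delta>\<in>{0<..}. hausdorff_pre d \<delta> A + hausdorff_pre d \<delta> B)"
    unfolding hausdorff_outer_def
  proof (rule SUP_add_directed_ennreal[symmetric])
    fix i j :: real assume "i \<in> {0<..}" "j \<in> {0<..}"
    then show "\<exists>k\<in>{0<..}. hausdorff_pre d i A + hausdorff_pre d j B \<le> hausdorff_pre d k A + hausdorff_pre d k B"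
      by (intro bexI[of _ "min i j"] add_mono hausdorff_pre_antimono) auto
  qed
  also have "\<dots> \<le> hausdorff_outer d (A \<union> B)"
  proof (rule SUP_least)
    fix \<delta> :: real assume \<delta>: "\<delta> \<in> {0<..}"
    define k where "k = min \<delta> (\<epsilon> / 2)"
    have k: "0 < k" "k \<le> \<delta>" "k < \<epsilon>" using \<delta> assms(2) by (auto simp: k_def)
    have "hausdorff_pre d \<delta> A + hausdorff_pre d \<delta> B \<le> hausdorff_pre d k A + hausdorff_pre d k B"
      by (intro add_mono hausdorff_pre_antimono k)
    also have "\<dots> \<le> hausdorff_pre d k (A \<union> B)"
      by (rule hausdorff_pre_separated) (use sep k in force)
    also have "\<dots> \<le> hausdorff_outer d (A \<union> B)"
      by (rule hausdorff_pre_le_outer) (rule k)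
    finally show "hausdorff_pre d \<delta> A + hausdorff_pre d \<delta> B \<le> hausdorff_outer d (A \<union> B)" .
  qed
  finally show ?thesis .
qed

text \<open>Caratheodory's criterion. The shells \<open>D k\<close> around \<open>F\<close> with indices of the same parity
  are pairwise separated, so their outer measures are summable.\<close>

lemma closed_in_hausdorff_lambda_system:
  fixes F :: "'a::metric_space set"
  assumes "closed F"
  shows "F \<in> lambda_system UNIV (Pow UNIV) (hausdorff_outer d)"
proof (cases "F = {}")
  case True
  then show ?thesis by (simp add: lambda_system_def hausdorff_outer_empty)
next
  case False
  let ?\<mu> = "hausdorff_outer d :: 'a set \<Rightarrow> ennreal"
  have "?\<mu> (X \<inter> F) + ?\<mu> (X - F) \<le> ?\<mu> X" if fin: "?\<mu> X < top" for X
  proof -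
    define f where "f x = infdist x F" for x
    define Y where "Y n = {x\<in>X. 1 / Suc n \<le> f x}" for n :: nat
    define D where "D k = {x\<in>X. 1 / Suc (Suc k) \<le> f x \<and> f x < 1 / Suc k}" for k :: nat
    have fl: "f x - f y \<le> dist x y" for x y
      using infdist_triangle[of x F y] by (simp add: f_def)
    have f0: "f x = 0" if "x \<in> F" for x using that by (simp add: f_def)
    have fpos: "f x > 0" if "x \<notin> F" for x
      using that assms False infdist_pos_not_in_closed by (force simp: f_def)
    \<comment> \<open>Between two shells of the same parity lies a whole shell of the other parity,
      across which the distance to \<open>F\<close> varies by a fixed amount.\<close>
    have parity: "(\<Sum>i<n. ?\<mu> (D (2 * i + p))) \<le> ?\<mu> (\<Union>i<n. D (2 * i + p))" for n p
    proof (induction n)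
      case (Suc n)
      define q where "q = 2 * n + p"
      have "?\<mu> (D q) + ?\<mu> (\<Union>i<n. D (2 * i + p)) \<le> ?\<mu> (D q \<union> (\<Union>i<n. D (2 * i + p)))"
      proof (rule hausdorff_outer_separated[where \<epsilon> = "1 / q - 1 / Suc q" for q])
        fix x y assume x: "x \<in> D q" and y: "y \<in> (\<Union>i<n. D (2 * i + p))"
        then obtain i where i: "i < n" "y \<in> D (2 * i + p)" by blast
        \<comment> \<open>The maximum with 1 only avoids a division by zero: \<open>q = 0\<close>
          forces \<open>n = 0\<close>, and then there is no earlier shell to separate from.\<close>
        have "1 / real (max 1 q) \<le> 1 / Suc (Suc (2 * i + p))"
          using i(1) by (intro divide_left_mono) (auto simp: q_def)
        then have "1 / real (max 1 q) \<le> f y" using i(2) by (auto simp: D_def)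
        moreover have "f x < 1 / Suc q" using x by (auto simp: D_def)
        ultimately show "1 / real (max 1 q) - 1 / Suc (max 1 q) \<le> dist x y"
          using fl[of y x] i(1) by (auto simp: dist_commute q_def max_def split: if_splits)
      next
        show "0 < 1 / real (max 1 q) - 1 / Suc (max 1 q)" by (simp add: divide_strict_left_mono)
      qed
      also have "D q \<union> (\<Union>i<n. D (2 * i + p)) = (\<Union>i<Suc n. D (2 * i + p))"
        by (auto simp: q_def less_Suc_eq)
      finally show ?case using Suc by (simp add: q_def add.commute) (meson add_mono order_refl order_trans)
    qed (simp add: hausdorff_outer_empty)
    have DX: "?\<mu> (\<Union>i<n. D (2 * i + p)) \<le> ?\<mu> X" for n p
      by (rule hausdorff_outer_mono) (auto simp: D_def)
    have sum2: "(\<Sum>k<2*n. ?\<mu> (D k)) = (\<Sum>i<n. ?\<mu> (D (2 * i + 0))) + (\<Sum>i<n. ?\<mu> (D (2 * i + 1)))" for n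
      by (induction n) (auto simp: algebra_simps)
    have "(\<Sum>k. ?\<mu> (D k)) \<le> ?\<mu> X + ?\<mu> X"
    proof (rule suminf_le_const)
      fix n
      have "(\<Sum>k<n. ?\<mu> (D k)) \<le> (\<Sum>k<2*n. ?\<mu> (D k))"
        by (rule sum_mono2) auto
      also have "\<dots> \<le> ?\<mu> X + ?\<mu> X"
        unfolding sum2 by (intro add_mono order_trans[OF parity DX])
      finally show "(\<Sum>k<n. ?\<mu> (D k)) \<le> ?\<mu> X + ?\<mu> X" .
    qed auto
    \<comment> \<open>Finiteness of this sum allows it to be cancelled in the final
      inequality.\<close>
    then have Sfin: "(\<Sum>k. ?\<mu> (D k)) \<noteq> \<infinity>"
      using fin by (metis ennreal_add_eq_top infinity_ennreal_def less_irrefl neq_top_trans)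
    have cover: "?\<mu> (X - F) \<le> ?\<mu> (Y n) + (\<Sum>k. ?\<mu> (D (k + n)))" for n
    proof -
      have "X - F \<subseteq> Y n \<union> (\<Union>k. D (k + n))"
      proof
        fix x assume x: "x \<in> X - F"
        show "x \<in> Y n \<union> (\<Union>k. D (k + n))"
        proof (cases "1 / Suc n \<le> f x")
          case False
          obtain m where m: "1 / Suc m < f x"
            using fpos[of x] x reals_Archimedean by (auto simp: inverse_eq_divide)
          define k where "k = (LEAST m. 1 / Suc m \<le> f x)"
          have k: "1 / Suc k \<le> f x" unfolding k_def by (rule LeastI[of _ m]) (use m in simp)
          have nk: "n < k"
          proof (rule ccontr)
            assume "\<not> n < k"
            then have "1 / real (Suc n) \<le> 1 / Suc k" by (intro divide_left_mono) auto
            then show False using k False by simp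
          qed
          then obtain j where j: "k = Suc j" "n \<le> j" by (cases k) auto
          have "\<not> 1 / Suc j \<le> f x"
            using not_less_Least[of j "\<lambda>m. 1 / Suc m \<le> f x"] j by (simp add: k_def)
          then have "x \<in> D (j - n + n)" using x j k by (auto simp: D_def)
          then show ?thesis by blast
        qed (use x in \<open>auto simp: Y_def\<close>)
      qed
      moreover define E where "E = case_nat (Y n) (\<lambda>k. D (k + n))"
      have "Y n = E 0" "\<And>k. D (k + n) = E (Suc k)" by (auto simp: E_def)
      then have "Y n \<union> (\<Union>k. D (k + n)) \<subseteq> (\<Union>i. E i)" by auto
      ultimately have "?\<mu> (X - F) \<le> ?\<mu> (\<Union>i. E i)"
        by (meson hausdorff_outer_mono order_trans)
      also have "\<dots> \<le> (\<Sum>i. ?\<mu> (E i))"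
        by (rule hausdorff_outer_countable_subadditive)
      also have "\<dots> = (\<Sum>i. ?\<mu> (E (i + 1))) + (\<Sum>i<1. ?\<mu> (E i))"
        by (rule suminf_offset) auto
      also have "\<dots> = ?\<mu> (Y n) + (\<Sum>k. ?\<mu> (D (k + n)))"
        by (simp add: E_def add.commute)
      finally show ?thesis .
    qed
    \<comment> \<open>The tails of the series are never shown to vanish. Instead the partial sum is
      added on the left, where it completes the tail to the full series, and then its supremum over
      \<open>n\<close> is taken.\<close>
    have "?\<mu> (X \<inter> F) + ?\<mu> (X - F) + (\<Sum>k<n. ?\<mu> (D k)) \<le> ?\<mu> X + (\<Sum>k. ?\<mu> (D k))" for n
    proof -
      have "?\<mu> (X \<inter> F) + ?\<mu> (Y n) \<le> ?\<mu> ((X \<inter> F) \<union> Y n)"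
      proof (rule hausdorff_outer_separated)
        fix x y assume "x \<in> X \<inter> F" "y \<in> Y n"
        then show "1 / Suc n \<le> dist x y"
          using fl[of y x] f0[of x] by (auto simp: Y_def dist_commute)
      qed auto
      also have "\<dots> \<le> ?\<mu> X" by (rule hausdorff_outer_mono) (auto simp: Y_def)
      finally have 1: "?\<mu> (X \<inter> F) + ?\<mu> (Y n) \<le> ?\<mu> X" .
      have 2: "(\<Sum>k. ?\<mu> (D k)) = (\<Sum>k. ?\<mu> (D (k + n))) + (\<Sum>k<n. ?\<mu> (D k))"
        by (rule suminf_offset) auto
      have "?\<mu> (X \<inter> F) + ?\<mu> (X - F) + (\<Sum>k<n. ?\<mu> (D k))
          \<le> ?\<mu> (X \<inter> F) + (?\<mu> (Y n) + (\<Sum>k. ?\<mu> (D (k + n)))) + (\<Sum>k<n. ?\<mu> (D k))"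
        by (intro add_mono cover order_refl)
      also have "\<dots> = (?\<mu> (X \<inter> F) + ?\<mu> (Y n)) + (\<Sum>k. ?\<mu> (D k))"
        unfolding 2 by (simp add: add_ac)
      also have "\<dots> \<le> ?\<mu> X + (\<Sum>k. ?\<mu> (D k))" by (intro add_mono 1 order_refl)
      finally show ?thesis .
    qed
    then have "?\<mu> (X \<inter> F) + ?\<mu> (X - F) + (\<Sum>k. ?\<mu> (D k)) \<le> ?\<mu> X + (\<Sum>k. ?\<mu> (D k))"
      unfolding suminf_eq_SUP[of "\<lambda>k. ?\<mu> (D k)"]
      by (subst ennreal_SUP_add_right) (auto intro!: SUP_least simp flip: suminf_eq_SUP)
    then show ?thesis
      using Sfin ennreal_add_left_cancel_le by (metis add.commute)
  qed
  moreover have "?\<mu> X \<le> ?\<mu> (X \<inter> F) + ?\<mu> (X - F)" for X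
  proof -
    define E where "E i = (if i = 0 then X \<inter> F else if i = 1 then X - F else {})" for i :: nat
    have "X \<inter> F = E 0" "X - F = E 1" by (auto simp: E_def)
    then have "X \<subseteq> (\<Union>i. E i)" by blast
    then have "?\<mu> X \<le> ?\<mu> (\<Union>i. E i)"
      by (rule hausdorff_outer_mono)
    also have "\<dots> \<le> (\<Sum>i. ?\<mu> (E i))"
      by (rule hausdorff_outer_countable_subadditive)
    also have "\<dots> = (\<Sum>i\<in>{0,1}. ?\<mu> (E i))"
      by (rule suminf_finite) (auto simp: E_def hausdorff_outer_empty)
    also have "\<dots> = ?\<mu> (X \<inter> F) + ?\<mu> (X - F)" by (simp add: E_def)
    finally show ?thesis .
  qed
  moreover have eq1: "F \<inter> X = X \<inter> F" and eq2: "(UNIV - F) \<inter> X = X - F" for X by blast+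
  ultimately have "?\<mu> (F \<inter> X) + ?\<mu> ((UNIV - F) \<inter> X) = ?\<mu> X" for X
  proof (cases "?\<mu> X < top")
    case True
    then show ?thesis
      using \<open>\<And>X. ?\<mu> X < top \<Longrightarrow> ?\<mu> (X \<inter> F) + ?\<mu> (X - F) \<le> ?\<mu> X\<close>[of X]
        \<open>\<And>X. ?\<mu> X \<le> ?\<mu> (X \<inter> F) + ?\<mu> (X - F)\<close>[of X]
      by (intro antisym) (simp_all add: eq1 eq2)
  next
    case False
    then have "?\<mu> X = top" using top.not_eq_extremum by blast
    with \<open>\<And>X. ?\<mu> X \<le> ?\<mu> (X \<inter> F) + ?\<mu> (X - F)\<close>[of X] show ?thesis
      by (simp add: eq1 eq2 top_unique)
  qed
  then show ?thesis by (simp add: lambda_system_def)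
qed

text \<open>The sets satisfying Caratheodory's criterion form a sigma-algebra that contains the
  closed sets, hence the Borel sets.\<close>

lemma measure_space_hausdorff:
  "measure_space UNIV (sets borel) (hausdorff_outer d :: 'a::metric_space set \<Rightarrow> ennreal)"
proof (rule measure_down)
  let ?L = "lambda_system UNIV (Pow UNIV) (hausdorff_outer d :: 'a set \<Rightarrow> ennreal)"
  show L: "measure_space UNIV ?L (hausdorff_outer d)"
    by (rule sigma_algebra.caratheodory_lemma[OF sigma_algebra_Pow hausdorff_outer_space])
  show "sigma_algebra (UNIV::'a set) (sets borel)"
    using sets.sigma_algebra_axioms[of "borel :: 'a measure"] by simp
  have "sets (borel :: 'a measure) = sigma_sets UNIV {S. closed S}"
    by (simp add: borel_eq_closed)
  also have "\<dots> \<subseteq> ?L"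
  proof (rule sigma_algebra.sigma_sets_subset)
    show "sigma_algebra UNIV ?L" using L by (simp add: measure_space_def)
    show "{S. closed S} \<subseteq> ?L" using closed_in_hausdorff_lambda_system by blast
  qed
  finally show "sets (borel :: 'a measure) \<subseteq> ?L" .
qed

lemma sets_hausdorff_measure [simp, measurable_cong]: "sets (hausdorff_measure d) = sets borel"
  by (simp add: hausdorff_measure_def sets.sigma_sets_eq[of borel, simplified])

lemma space_hausdorff_measure [simp]: "space (hausdorff_measure d) = UNIV"
  by (simp add: hausdorff_measure_def)

lemma emeasure_hausdorff_measure:
  assumes "A \<in> sets borel"
  shows "emeasure (hausdorff_measure d) A = hausdorff_outer d A"
  unfolding hausdorff_measure_def
  by (rule emeasure_measure_of_sigma)
    (use measure_space_hausdorff assms in \<open>auto simp: measure_space_def\<close>)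

section \<open>Length of arcs and integrals along closed curves\<close>

lemma emeasure_hausdorff_arc_le:
  fixes \<gamma> :: "real \<Rightarrow> 'a::euclidean_space"
  assumes ab: "a \<le> b" and C: "0 \<le> C"
    and lip: "\<And>x y. x \<in> {a..b} \<Longrightarrow> y \<in> {a..b} \<Longrightarrow> dist (\<gamma> x) (\<gamma> y) \<le> C * \<bar>x - y\<bar>"
  shows "hausdorff_outer 1 (\<gamma> ` {a..b}) \<le> ennreal (C * (b - a))"
  unfolding hausdorff_outer_def
proof (rule SUP_least)
  fix \<delta> :: real assume "\<delta> \<in> {0<..}"
  then have \<delta>: "0 < \<delta>" by simp
  \<comment> \<open>The number of pieces is chosen so large that a piece, of diameter at most
    \<open>C * h\<close>, is admissible at scale \<delta>.\<close>
  obtain n :: nat where n: "C * (b - a) / \<delta> < n" using reals_Archimedean2 by blast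
  have "0 \<le> C * (b - a) / \<delta>" using \<delta> ab C by simp
  with n have n0: "0 < real n" by linarith
  define h where "h = (b - a) / n"
  have h0: "0 \<le> h" using ab n0 by (simp add: h_def)
  have Ch: "C * h \<le> \<delta>" using n n0 \<delta> by (simp add: h_def field_simps)
  define E where "E i = (if i < n then \<gamma> ` {a + i * h .. a + Suc i * h} else {})" for i
  have sub: "{a + i * h .. a + Suc i * h} \<subseteq> {a..b}" if "i < n" for i
  proof -
    have "real (Suc i) * h \<le> n * h" using that h0 by (intro mult_right_mono) auto
    moreover have "n * h = b - a" using n0 by (simp add: h_def)
    moreover have "0 \<le> i * h" using h0 by simp
    ultimately show ?thesis by auto
  qed
  have diam: "dist u v \<le> C * h" if "u \<in> E i" "v \<in> E i" for u v i
  proof -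
    have i: "i < n" using that by (auto simp: E_def split: if_splits)
    then obtain x y where xy: "u = \<gamma> x" "v = \<gamma> y" "x \<in> {a + i * h .. a + Suc i * h}" "y \<in> {a + i * h .. a + Suc i * h}"
      using \<open>u \<in> E i\<close> \<open>v \<in> E i\<close> unfolding E_def if_P[OF i] by blast
    then have "\<bar>x - y\<bar> \<le> h" by (auto simp: algebra_simps)
    then have "C * \<bar>x - y\<bar> \<le> C * h" using C by (rule mult_left_mono)
    moreover have "dist (\<gamma> x) (\<gamma> y) \<le> C * \<bar>x - y\<bar>" by (rule lip) (use sub[OF i] xy in blast)+
    ultimately show ?thesis using xy by simp
  qed
  have bd: "bounded (E i)" for i
    unfolding bounded_def using diam by (cases "E i = {}") blast+
  have di: "diameter (E i) \<le> C * h" for i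
    by (rule diameter_le) (use diam C h0 in \<open>auto simp: dist_norm\<close>)
  have "hausdorff_pre 1 \<delta> (\<gamma> ` {a..b}) \<le> (\<Sum>i. ennreal (hausdorff_weight 1 (E i)))"
  proof (rule hausdorff_pre_le)
    show "diameter (E i) \<le> \<delta>" for i using di Ch order_trans by blast
    show "\<gamma> ` {a..b} \<subseteq> (\<Union>i. E i)"
    proof clarify
      fix x assume x: "x \<in> {a..b}"
      show "\<gamma> x \<in> (\<Union>i. E i)"
      proof (cases "h = 0")
        case True
        then have "x = a" using x n0 by (auto simp: h_def)
        then show ?thesis using n0 True by (intro UN_I[of 0]) (auto simp: E_def)
      next
        case False
        then have hp: "h > 0" using h0 by simp
        \<comment> \<open>The minimum with \<open>n - 1\<close> puts the right end point
          \<open>b\<close> into the last piece.\<close>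
        define i where "i = min (nat \<lfloor>(x - a) / h\<rfloor>) (n - 1)"
        have 1: "real i \<le> (x - a) / h"
        proof -
          have "real (nat \<lfloor>(x - a) / h\<rfloor>) \<le> (x - a) / h" using x hp by simp
          then show ?thesis unfolding i_def by (meson min.cobounded1 of_nat_le_iff order_trans)
        qed
        have 2: "(x - a) / h \<le> real (Suc i)"
        proof (cases "nat \<lfloor>(x - a) / h\<rfloor> \<le> n - 1")
          case True
          then show ?thesis using x hp unfolding i_def by simp linarith
        next
          case F: False
          have "(x - a) / h \<le> n" using x hp n0 by (simp add: h_def divide_simps)
          then show ?thesis using F n0 by (simp add: i_def)
        qed
        have "i < n" using n0 by (auto simp: i_def)
        moreover have "x \<in> {a + i * h .. a + Suc i * h}"
          using 1 2 hp by (auto simp: field_simps)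
        ultimately show ?thesis by (intro UN_I[of i]) (auto simp: E_def)
      qed
    qed
  qed (rule bd)
  also have "\<dots> = (\<Sum>i<n. ennreal (hausdorff_weight 1 (E i)))"
    by (rule suminf_finite) (auto simp: E_def hausdorff_weight_def)
  also have "\<dots> \<le> (\<Sum>i<n. ennreal (C * h))"
    by (intro sum_mono ennreal_leI) (use di in \<open>simp add: hausdorff_weight_1 del: One_nat_def\<close>)
  also have "\<dots> = ennreal (C * (b - a))"
  proof -
    have "(\<Sum>i<n. ennreal (C * h)) = ennreal (n * (C * h))"
      using C h0 by (simp add: ennreal_of_nat_eq_real_of_nat ennreal_mult)
    moreover have "n * (C * h) = C * (b - a)" using n0 by (simp add: h_def)
    ultimately show ?thesis by simp
  qed
  finally show "hausdorff_pre 1 \<delta> (\<gamma> ` {a..b}) \<le> ennreal (C * (b - a))" .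
qed

text \<open>The parameters mapped into a covering set of diameter \<open>r\<close> lie in an
  interval of length \<open>r / c\<close>. These intervals cover \<open>{a..b}\<close>, so Lebesgue
  measure bounds the total weight from below. The bound is the same at every scale, so scale 1 is
  enough.\<close>

lemma emeasure_hausdorff_arc_ge:
  fixes \<gamma> :: "real \<Rightarrow> 'a::euclidean_space"
  assumes ab: "a \<le> b" and c: "0 < c"
    and low: "\<And>x y. x \<in> {a..b} \<Longrightarrow> y \<in> {a..b} \<Longrightarrow> c * \<bar>x - y\<bar> \<le> dist (\<gamma> x) (\<gamma> y)"
  shows "ennreal (c * (b - a)) \<le> hausdorff_outer 1 (\<gamma> ` {a..b})"
proof (rule order_trans[OF _ hausdorff_pre_le_outer[of 1]])
  show "ennreal (c * (b - a)) \<le> hausdorff_pre 1 1 (\<gamma> ` {a..b})"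
    unfolding hausdorff_pre_def
  proof (rule Inf_greatest, clarify)
    fix C :: "nat \<Rightarrow> 'a set"
    assume C: "\<forall>n. bounded (C n) \<and> diameter (C n) \<le> 1" and sub: "\<gamma> ` {a..b} \<subseteq> (\<Union>n. C n)"
    define P where "P n = {x\<in>{a..b}. \<gamma> x \<in> C n}" for n
    \<comment> \<open>If \<open>P n\<close> is empty, the left end point is an arbitrary default
      value; the inclusion of \<open>P n\<close> in \<open>J n\<close> is then trivial and the
      length of \<open>J n\<close> is still correct.\<close>
    define J where "J n = {Inf (P n) .. Inf (P n) + diameter (C n) / c}" for n
    have PJ: "P n \<subseteq> J n" for n
    proof
      fix x assume x: "x \<in> P n"
      have bdd: "bdd_below (P n)" by (rule bdd_belowI[of _ a]) (auto simp: P_def)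
      have "x - diameter (C n) / c \<le> Inf (P n)"
      proof (rule cInf_greatest)
        fix y assume y: "y \<in> P n"
        have "c * \<bar>x - y\<bar> \<le> dist (\<gamma> x) (\<gamma> y)" using low x y by (simp add: P_def)
        also have "\<dots> \<le> diameter (C n)"
          by (rule diameter_bounded_bound) (use C x y in \<open>auto simp: P_def\<close>)
        finally have "\<bar>x - y\<bar> \<le> diameter (C n) / c" using c by (simp add: field_simps)
        then show "x - diameter (C n) / c \<le> y" by linarith
      qed (use x in auto)
      then show "x \<in> J n" using cInf_lower[OF x bdd] by (simp add: J_def)
    qed
    have dn: "0 \<le> diameter (C n)" for n using C diameter_ge_0 by blast
    have "{a..b} \<subseteq> (\<Union>n. J n)"
    proof
      fix x assume x: "x \<in> {a..b}"
      then obtain n where "\<gamma> x \<in> C n" using sub by blast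
      with x have "x \<in> P n" by (simp add: P_def)
      with PJ show "x \<in> (\<Union>n. J n)" by blast
    qed
    then have "emeasure lborel {a..b} \<le> emeasure lborel (\<Union>n. J n)"
      by (intro emeasure_mono) (auto simp: J_def)
    also have "\<dots> \<le> (\<Sum>n. emeasure lborel (J n))"
      by (rule emeasure_subadditive_countably) (auto simp: J_def)
    finally have "ennreal c * emeasure lborel {a..b} \<le> ennreal c * (\<Sum>n. emeasure lborel (J n))"
      by (intro mult_left_mono) auto
    also have "\<dots> = (\<Sum>n. ennreal c * emeasure lborel (J n))" by simp
    also have "\<dots> = (\<Sum>n. ennreal (hausdorff_weight 1 (C n)))"
      by (rule suminf_cong) (use c dn in \<open>simp add: J_def hausdorff_weight_1 del: One_nat_def flip: ennreal_mult\<close>)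
    finally show "ennreal (c * (b - a)) \<le> (\<Sum>n. ennreal (hausdorff_weight 1 (C n)))"
      using ab c by (simp add: ennreal_mult)
  qed
qed simp

lemma closed_arc_in_borel:
  fixes \<gamma> :: "real \<Rightarrow> 'a::euclidean_space"
  assumes "continuous_on {a..b} \<gamma>" "a \<le> s" "t \<le> b"
  shows "compact (\<gamma> ` {s..t})" "\<gamma> ` {s..t} \<in> sets borel"
proof -
  show "compact (\<gamma> ` {s..t})"
    by (intro compact_continuous_image continuous_on_subset[OF assms(1)]) (use assms in auto)
  then show "\<gamma> ` {s..t} \<in> sets borel" by (simp add: borel_closed compact_imp_closed)
qed

lemma set_integrable_hausdorff_compact:
  fixes F :: "'a::euclidean_space \<Rightarrow> real"
  assumes "compact K" "emeasure (hausdorff_measure d) K < \<infinity>" "continuous_on K F"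
  shows "set_integrable (hausdorff_measure d) K F"
proof -
  have K: "K \<in> sets borel" using assms(1) by (simp add: borel_closed compact_imp_closed)
  obtain B where B: "\<And>x. x \<in> K \<Longrightarrow> norm (F x) \<le> B"
    using compact_imp_bounded[OF compact_continuous_image[OF assms(3,1)]] by (auto simp: bounded_iff)
  show ?thesis unfolding set_integrable_def
  proof (rule integrableI_bounded_set)
    show "(\<lambda>x. indicator K x *\<^sub>R F x) \<in> borel_measurable (hausdorff_measure d)"
      using borel_measurable_continuous_on_indicator[OF K assms(3)]
      by (simp add: measurable_cong_sets[OF sets_hausdorff_measure refl])
    show "AE x in hausdorff_measure d. x \<in> K \<longrightarrow> norm (indicator K x *\<^sub>R F x) \<le> B"
      using B by auto
  qed (use K assms(2) in auto)
qed

lemma set_integral_hausdorff_bound: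
  fixes F :: "'a::euclidean_space \<Rightarrow> real"
  assumes "compact K" "emeasure (hausdorff_measure d) K \<le> ennreal m" "0 \<le> m" "continuous_on K F"
    and "\<And>x. x \<in> K \<Longrightarrow> \<bar>F x\<bar> \<le> B" "0 \<le> B"
  shows "\<bar>LINT x:K|hausdorff_measure d. F x\<bar> \<le> B * m"
proof -
  have K: "K \<in> sets (hausdorff_measure d)" using assms(1) by (simp add: borel_closed compact_imp_closed)
  have fin: "emeasure (hausdorff_measure d) K < \<infinity>"
    using assms(2) by (simp add: le_less_trans)
  have "\<bar>LINT x:K|hausdorff_measure d. F x\<bar> \<le> (LINT x:K|hausdorff_measure d. \<bar>F x\<bar>)"
    using set_integral_norm_bound[OF set_integrable_hausdorff_compact[OF assms(1) fin assms(4)]] by simp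
  also have "\<dots> \<le> (LINT x:K|hausdorff_measure d. B)"
    by (rule set_integral_mono)
      (use assms(5) in \<open>auto intro!: set_integrable_hausdorff_compact assms(1) fin continuous_intros assms(4)\<close>)
  also have "\<dots> = B * measure (hausdorff_measure d) K"
    using K by (simp add: set_lebesgue_integral_def)
  also have "\<dots> \<le> B * m"
    using assms(2,3,6) by (intro mult_left_mono) (auto simp: measure_def intro: enn2real_leI)
  finally show ?thesis .
qed

text \<open>The integral of \<open>F\<close> over the initial arc \<open>\<gamma> ` {a..t}\<close> has derivative \<open>F (\<gamma> t) * v t\<close>
  wherever \<open>\<gamma>\<close> scales distances near \<open>t\<close> by a factor close to \<open>v t\<close>.\<close>

lemma hausdorff_line_integral:
  fixes \<gamma> :: "real \<Rightarrow> 'a::euclidean_space" and F :: "'a \<Rightarrow> real"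
  assumes ab: "a < b" and inj: "inj_on \<gamma> {a..<b}" and closed: "\<gamma> b = \<gamma> a"
    and C: "0 \<le> C"
    and lip: "\<And>x y. x \<in> {a..b} \<Longrightarrow> y \<in> {a..b} \<Longrightarrow> dist (\<gamma> x) (\<gamma> y) \<le> C * \<bar>x - y\<bar>"
    and X: "finite X"
    and v: "\<And>t. t \<in> {a<..<b} - X \<Longrightarrow> 0 < v t"
    and loc: "\<And>t \<epsilon>. t \<in> {a<..<b} - X \<Longrightarrow> 0 < \<epsilon> \<Longrightarrow>
       \<exists>\<delta>>0. \<forall>x\<in>ball t \<delta>. \<forall>y\<in>ball t \<delta>. \<bar>dist (\<gamma> x) (\<gamma> y) - v t * \<bar>x - y\<bar>\<bar> \<le> \<epsilon> * \<bar>x - y\<bar>"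
    and F: "continuous_on (\<gamma> ` {a..b}) F"
  shows "set_integrable (hausdorff_measure 1) (\<gamma> ` {a..b}) F"
    and "((\<lambda>t. F (\<gamma> t) * v t) has_integral (LINT x:\<gamma> ` {a..b}|hausdorff_measure 1. F x)) {a..b}"
    and "emeasure (hausdorff_measure 1) (\<gamma> ` {a..b}) < \<infinity>"
proof -
  let ?H = "hausdorff_measure 1 :: 'a measure"
  have cont: "continuous_on {a..b} \<gamma>"
    by (rule lipschitz_on_continuous_on[of C]) (use lip C in \<open>auto simp: lipschitz_on_def dist_real_def\<close>)
  note arc = closed_arc_in_borel[OF cont]
  have emle: "emeasure ?H (\<gamma> ` {s..t}) \<le> ennreal (C * (t - s))" if "a \<le> s" "s \<le> t" "t \<le> b" for s t
    unfolding emeasure_hausdorff_measure[OF arc(2)[OF that(1,3)]]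
    by (rule emeasure_hausdorff_arc_le) (use that C in \<open>auto intro!: lip\<close>)
  then have fin: "emeasure ?H (\<gamma> ` {s..t}) < \<infinity>" if "a \<le> s" "s \<le> t" "t \<le> b" for s t
    using emle[OF that] by (metis ennreal_less_top infinity_ennreal_def le_less_trans)
  then show "emeasure ?H (\<gamma> ` {a..b}) < \<infinity>" using ab by simp
  have Fsub: "continuous_on (\<gamma> ` {s..t}) F" if "a \<le> s" "t \<le> b" for s t
    by (rule continuous_on_subset[OF F]) (use that in auto)
  have int: "set_integrable ?H (\<gamma> ` {s..t}) F" if "a \<le> s" "s \<le> t" "t \<le> b" for s t
    by (rule set_integrable_hausdorff_compact[OF arc(1)[OF that(1,3)] fin[OF that] Fsub[OF that(1,3)]])
  then show "set_integrable ?H (\<gamma> ` {a..b}) F" using ab by simp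
  have point: "emeasure ?H {\<gamma> s} = 0" if "s \<in> {a..b}" for s
    using emle[of s s] that by simp
  have pointAE: "AE x in ?H. x \<noteq> \<gamma> s" if "s \<in> {a..b}" for s
    by (rule AE_I[where N = "{\<gamma> s}"]) (use point[OF that] in auto)
  define \<Phi> where "\<Phi> t = (LINT x:\<gamma> ` {a..t}|?H. F x)" for t
  \<comment> \<open>Adjacent arcs can share only \<open>\<gamma> s\<close> and, where the curve
    closes up, \<open>\<gamma> a\<close>; single points on the curve are null sets.\<close>
  have inc: "\<Phi> t - \<Phi> s = (LINT x:\<gamma> ` {s..t}|?H. F x)" if "a \<le> s" "s \<le> t" "t \<le> b" for s t
  proof -
    have "AE x in ?H. x \<noteq> \<gamma> s" "AE x in ?H. x \<noteq> \<gamma> a"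
      using that ab by (auto intro!: pointAE)
    then have ae: "AE x in ?H. \<not> (x \<in> \<gamma> ` {a..s} \<and> x \<in> \<gamma> ` {s..t})"
    proof eventually_elim
      case (elim x)
      show ?case
      proof
        assume "x \<in> \<gamma> ` {a..s} \<and> x \<in> \<gamma> ` {s..t}"
        then obtain p q where "x = \<gamma> p" "x = \<gamma> q" "p \<in> {a..s}" "q \<in> {s..t}" by blast
        then have pq: "x = \<gamma> p" "x = \<gamma> q" "a \<le> p" "p \<le> s" "s \<le> q" "q \<le> t" by simp_all
        have "q < b" using elim pq closed that by (metis order_le_less order_trans)
        then have "p = q" using inj_onD[OF inj, of p q] pq by auto
        then show False using pq elim by auto
      qed
    qed
    have un: "\<gamma> ` {a..t} = \<gamma> ` {a..s} \<union> \<gamma> ` {s..t}"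
      using that by (metis image_Un ivl_disj_un_two_touch(4))
    show ?thesis
      unfolding \<Phi>_def un
      using set_integral_Un_AE[OF ae _ _ int[of a s] int[of s t]] that arc(2) by (simp add: arc(2))
  qed
  obtain B0 where B0: "\<And>x. x \<in> \<gamma> ` {a..b} \<Longrightarrow> norm (F x) \<le> B0"
    using compact_imp_bounded[OF compact_continuous_image[OF F arc(1)]] by (auto simp: bounded_iff)
  define B where "B = max B0 0"
  have B: "\<And>x. x \<in> \<gamma> ` {a..b} \<Longrightarrow> \<bar>F x\<bar> \<le> B" "0 \<le> B" using B0 by (force simp: B_def)+
  have \<Phi>lip: "\<bar>\<Phi> t - \<Phi> s\<bar> \<le> B * C * (t - s)" if "a \<le> s" "s \<le> t" "t \<le> b" for s t
    unfolding inc[OF that] mult.assoc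
    by (rule set_integral_hausdorff_bound) (use that C B Fsub arc emle in auto)
  have "continuous_on {a..b} \<Phi>"
  proof (rule lipschitz_on_continuous_on[of "B * C"], rule lipschitz_onI)
    fix x y assume "x \<in> {a..b}" "y \<in> {a..b}"
    then show "dist (\<Phi> x) (\<Phi> y) \<le> B * C * dist x y"
      using \<Phi>lip[of x y] \<Phi>lip[of y x] by (cases "x \<le> y") (auto simp: dist_real_def abs_minus_commute)
  qed (use B C in simp)
  moreover have "(\<Phi> has_vector_derivative F (\<gamma> t) * v t) (at t)" if t: "t \<in> {a<..<b} - X" for t
    unfolding has_vector_derivative_def has_derivative_at_alt
  proof (intro conjI allI impI bounded_linear_scaleR_left)
    fix e :: real assume e: "0 < e"
    \<comment> \<open>The first bound keeps the lower scaling factor \<open>v t - \<epsilon>\<close>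
      positive, as the lower length estimate requires; the last one makes the two errors, from the
      length and from the oscillation of \<open>F\<close>, add up to at most
      \<open>e\<close>.\<close>
    define \<epsilon> where "\<epsilon> = min (v t / 2) (min 1 (e / (v t + 1 + \<bar>F (\<gamma> t)\<bar>)))"
    have vt: "v t > 0" using v t by blast
    have \<epsilon>: "0 < \<epsilon>" "\<epsilon> < v t" "\<epsilon> \<le> 1" "\<epsilon> * (v t + 1 + \<bar>F (\<gamma> t)\<bar>) \<le> e"
    proof -
      have pos: "0 < v t + 1 + \<bar>F (\<gamma> t)\<bar>" using vt by linarith
      then show "0 < \<epsilon>" using vt e by (simp add: \<epsilon>_def)
      have "\<epsilon> \<le> v t / 2" "\<epsilon> \<le> 1" "\<epsilon> \<le> e / (v t + 1 + \<bar>F (\<gamma> t)\<bar>)"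
        unfolding \<epsilon>_def by (meson min.cobounded1 min.cobounded2 order_trans)+
      then show "\<epsilon> < v t" "\<epsilon> \<le> 1" "\<epsilon> * (v t + 1 + \<bar>F (\<gamma> t)\<bar>) \<le> e"
        using vt by (simp_all add: pos_le_divide_eq[OF pos])
    qed
    obtain \<delta>1 where \<delta>1: "\<delta>1 > 0" "\<And>x y. x \<in> ball t \<delta>1 \<Longrightarrow> y \<in> ball t \<delta>1 \<Longrightarrow>
        \<bar>dist (\<gamma> x) (\<gamma> y) - v t * \<bar>x - y\<bar>\<bar> \<le> \<epsilon> * \<bar>x - y\<bar>"
      using loc[OF t \<epsilon>(1)] by blast
    have "continuous_on {a..b} (\<lambda>t. F (\<gamma> t))"
      using continuous_on_compose[OF cont F] by (simp add: o_def)
    then obtain \<delta>2 where \<delta>2: "\<delta>2 > 0" "\<And>x. x \<in> {a..b} \<Longrightarrow> dist x t < \<delta>2 \<Longrightarrow> dist (F (\<gamma> x)) (F (\<gamma> t)) < \<epsilon>"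
      unfolding continuous_on_iff using t \<epsilon>(1) by (metis DiffD1 greaterThanLessThan_subseteq_atLeastAtMost_iff order_refl subsetD)
    define d where "d = min (min \<delta>1 \<delta>2) (min (t - a) (b - t))"
    have d: "d > 0" "d \<le> \<delta>1" "d \<le> \<delta>2" "d \<le> t - a" "d \<le> b - t" using \<delta>1 \<delta>2 t by (auto simp: d_def)
    have key: "\<bar>\<Phi> y - \<Phi> x - F (\<gamma> t) * v t * (y - x)\<bar> \<le> e * (y - x)"
      if xy: "x \<le> y" "\<bar>x - t\<bar> < d" "\<bar>y - t\<bar> < d" for x y
    proof -
      have axy: "a \<le> x" "y \<le> b" using xy d by auto
      have near: "\<bar>z - t\<bar> < d" if "z \<in> {x..y}" for z using that xy by auto
      have st: "\<bar>dist (\<gamma> p) (\<gamma> q) - v t * \<bar>p - q\<bar>\<bar> \<le> \<epsilon> * \<bar>p - q\<bar>" if "p \<in> {x..y}" "q \<in> {x..y}" for p q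
        by (rule \<delta>1(2)) (use near[OF that(1)] near[OF that(2)] d in \<open>auto simp: dist_real_def abs_minus_commute\<close>)
      have "hausdorff_outer 1 (\<gamma> ` {x..y}) \<le> ennreal ((v t + \<epsilon>) * (y - x))"
        by (rule emeasure_hausdorff_arc_le) (use xy vt \<epsilon> st in \<open>auto simp: algebra_simps abs_le_iff\<close>)
      then have up: "emeasure ?H (\<gamma> ` {x..y}) \<le> ennreal ((v t + \<epsilon>) * (y - x))"
        using emeasure_hausdorff_measure[OF arc(2)] axy by metis
      have "ennreal ((v t - \<epsilon>) * (y - x)) \<le> hausdorff_outer 1 (\<gamma> ` {x..y})"
        by (rule emeasure_hausdorff_arc_ge) (use xy vt \<epsilon> st in \<open>auto simp: algebra_simps abs_le_iff\<close>)
      then have low: "ennreal ((v t - \<epsilon>) * (y - x)) \<le> emeasure ?H (\<gamma> ` {x..y})"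
        using emeasure_hausdorff_measure[OF arc(2)] axy by metis
      define m where "m = measure ?H (\<gamma> ` {x..y})"
      have em: "emeasure ?H (\<gamma> ` {x..y}) = ennreal m"
        unfolding m_def by (rule emeasure_eq_ennreal_measure) (use fin axy xy in \<open>auto simp: less_top\<close>)
      have m0: "0 \<le> m" by (simp add: m_def)
      have vxy: "0 \<le> (v t + \<epsilon>) * (y - x)" using vt \<epsilon> xy by simp
      have m: "\<bar>m - v t * (y - x)\<bar> \<le> \<epsilon> * (y - x)"
        using up low m0 vxy unfolding em by (auto simp: algebra_simps abs_le_iff ennreal_le_iff2)
      have mle: "m \<le> (v t + 1) * (y - x)"
      proof -
        have "(v t + \<epsilon>) * (y - x) \<le> (v t + 1) * (y - x)" using \<epsilon> xy by (intro mult_right_mono) auto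
        then show ?thesis using m by (auto simp: algebra_simps abs_le_iff)
      qed
      have I: "set_integrable ?H (\<gamma> ` {x..y}) (\<lambda>z. F (\<gamma> t))"
        by (rule set_integrable_hausdorff_compact) (use arc axy fin xy in auto)
      have "\<Phi> y - \<Phi> x - F (\<gamma> t) * m = (LINT z:\<gamma> ` {x..y}|?H. F z) - (LINT z:\<gamma> ` {x..y}|?H. F (\<gamma> t))"
        using inc[of x y] axy xy arc(2) by (simp add: m_def set_lebesgue_integral_def)
      also have "\<dots> = (LINT z:\<gamma> ` {x..y}|?H. F z - F (\<gamma> t))"
        by (rule set_integral_diff(2)[symmetric]) (use int axy xy I in auto)
      also have "\<bar>\<dots>\<bar> \<le> \<epsilon> * m"
      proof (rule set_integral_hausdorff_bound)
        show "\<bar>F z - F (\<gamma> t)\<bar> \<le> \<epsilon>" if z: "z \<in> \<gamma> ` {x..y}" for z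
        proof -
          obtain p where p: "p \<in> {x..y}" "z = \<gamma> p" using z by blast
          then show ?thesis using \<delta>2(2)[of p] near[OF p(1)] d axy by (auto simp: dist_real_def)
        qed
      qed (use arc axy Fsub m0 \<epsilon> em in \<open>auto intro!: continuous_intros\<close>)
      finally have 1: "\<bar>\<Phi> y - \<Phi> x - F (\<gamma> t) * m\<bar> \<le> \<epsilon> * m" .
      have "\<Phi> y - \<Phi> x - F (\<gamma> t) * v t * (y - x) = (\<Phi> y - \<Phi> x - F (\<gamma> t) * m) + F (\<gamma> t) * (m - v t * (y - x))"
        by (simp add: algebra_simps)
      then have "\<bar>\<Phi> y - \<Phi> x - F (\<gamma> t) * v t * (y - x)\<bar> \<le> \<epsilon> * m + \<bar>F (\<gamma> t)\<bar> * \<bar>m - v t * (y - x)\<bar>"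
        using 1 abs_triangle_ineq[of "\<Phi> y - \<Phi> x - F (\<gamma> t) * m" "F (\<gamma> t) * (m - v t * (y - x))"]
        by (simp add: abs_mult)
      also have "\<dots> \<le> \<epsilon> * ((v t + 1) * (y - x)) + \<bar>F (\<gamma> t)\<bar> * (\<epsilon> * (y - x))"
        using m mle \<epsilon> by (intro add_mono mult_left_mono) auto
      also have "\<dots> = (\<epsilon> * (v t + 1 + \<bar>F (\<gamma> t)\<bar>)) * (y - x)" by (simp add: algebra_simps)
      also have "\<dots> \<le> e * (y - x)" using \<epsilon> xy by (intro mult_right_mono) auto
      finally show ?thesis .
    qed
    show "\<exists>d>0. \<forall>y. norm (y - t) < d \<longrightarrow>
        norm (\<Phi> y - \<Phi> t - (y - t) *\<^sub>R (F (\<gamma> t) * v t)) \<le> e * norm (y - t)"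
    proof (intro exI[of _ d] conjI allI impI)
      fix y assume y: "norm (y - t) < d"
      show "norm (\<Phi> y - \<Phi> t - (y - t) *\<^sub>R (F (\<gamma> t) * v t)) \<le> e * norm (y - t)"
      proof (cases "t \<le> y")
        case True
        then show ?thesis using key[of t y] y d by (auto simp: algebra_simps)
      next
        case False
        have "norm (\<Phi> y - \<Phi> t - (y - t) *\<^sub>R (F (\<gamma> t) * v t)) = \<bar>\<Phi> t - \<Phi> y - F (\<gamma> t) * v t * (t - y)\<bar>"
          unfolding real_norm_def by (subst abs_minus_commute) (simp add: algebra_simps)
        then show ?thesis using key[of y t] y d False by auto
      qed
    qed (rule d)
  qed
  \<comment> \<open>The finitely many corners do no harm: continuity of \<Phi> there suffices for
    the fundamental theorem.\<close>
  ultimately have "((\<lambda>t. F (\<gamma> t) * v t) has_integral (\<Phi> b - \<Phi> a)) {a..b}"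
    using ab by (intro fundamental_theorem_of_calculus_interior_strong[OF X]) auto
  moreover have "\<Phi> a = 0"
  proof -
    have "AE x in ?H. x \<noteq> \<gamma> a"
      using ab by (auto intro!: pointAE)
    then have "AE x in ?H. indicator {\<gamma> a} x *\<^sub>R F x = 0" by eventually_elim auto
    then show ?thesis
      unfolding \<Phi>_def set_lebesgue_integral_def atLeastAtMost_singleton image_insert image_empty
      by (rule integral_eq_zero_AE)
  qed
  ultimately show "((\<lambda>t. F (\<gamma> t) * v t) has_integral (LINT x:\<gamma> ` {a..b}|?H. F x)) {a..b}"
    by (simp add: \<Phi>_def)
qed

text \<open>Subtracting the straight motion with velocity \<open>\<gamma>' t\<close> leaves a curve
  whose derivative is below \<epsilon> near \<open>t\<close>; the mean value inequality then
  compares chords.\<close>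

lemma distance_scaling_of_C1:
  fixes \<gamma> :: "real \<Rightarrow> 'a::euclidean_space"
  assumes "open S" "t \<in> S" and d: "\<And>x. x \<in> S \<Longrightarrow> (\<gamma> has_vector_derivative \<gamma>' x) (at x)"
    and "continuous_on S \<gamma>'" and \<epsilon>: "0 < \<epsilon>"
  shows "\<exists>\<delta>>0. \<forall>x\<in>ball t \<delta>. \<forall>y\<in>ball t \<delta>.
     \<bar>dist (\<gamma> x) (\<gamma> y) - norm (\<gamma>' t) * \<bar>x - y\<bar>\<bar> \<le> \<epsilon> * \<bar>x - y\<bar>"
proof -
  obtain d1 where d1: "d1 > 0" "ball t d1 \<subseteq> S" using assms(1,2) open_contains_ball by blast
  obtain d2 where d2: "d2 > 0" "\<And>x. x \<in> S \<Longrightarrow> dist x t < d2 \<Longrightarrow> dist (\<gamma>' x) (\<gamma>' t) < \<epsilon>"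
    using assms(4) assms(2) \<epsilon> unfolding continuous_on_iff by metis
  define \<delta> where "\<delta> = min d1 d2"
  have \<delta>: "\<delta> > 0" "\<And>x. x \<in> ball t \<delta> \<Longrightarrow> x \<in> S" "\<And>x. x \<in> ball t \<delta> \<Longrightarrow> dist (\<gamma>' x) (\<gamma>' t) < \<epsilon>"
  proof -
    show "\<delta> > 0" using d1 d2 by (simp add: \<delta>_def)
    show S: "x \<in> S" if "x \<in> ball t \<delta>" for x using that d1 by (auto simp: \<delta>_def)
    show "dist (\<gamma>' x) (\<gamma>' t) < \<epsilon>" if "x \<in> ball t \<delta>" for x
      using that d2(2)[OF S[OF that]] by (auto simp: \<delta>_def dist_commute)
  qed
  show ?thesis
  proof (intro exI[of _ \<delta>] conjI ballI \<delta>(1))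
    fix x y assume xy: "x \<in> ball t \<delta>" "y \<in> ball t \<delta>"
    have "norm ((\<gamma> x - x *\<^sub>R \<gamma>' t) - (\<gamma> y - y *\<^sub>R \<gamma>' t)) \<le> \<epsilon> * norm (x - y)"
    proof (rule differentiable_bound[OF convex_ball _ _ xy(1,2), where f' = "\<lambda>z h. h *\<^sub>R (\<gamma>' z - \<gamma>' t)"])
      fix z assume z: "z \<in> ball t \<delta>"
      have "(\<gamma> has_derivative (\<lambda>h. h *\<^sub>R \<gamma>' z)) (at z within ball t \<delta>)"
        using d[OF \<delta>(2)[OF z]] by (auto simp: has_vector_derivative_def intro: has_derivative_at_withinI)
      then show "((\<lambda>x. \<gamma> x - x *\<^sub>R \<gamma>' t) has_derivative (\<lambda>h. h *\<^sub>R (\<gamma>' z - \<gamma>' t))) (at z within ball t \<delta>)"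
        by (auto intro!: derivative_eq_intros simp: algebra_simps)
      show "onorm (\<lambda>h. h *\<^sub>R (\<gamma>' z - \<gamma>' t)) \<le> \<epsilon>"
        by (rule onorm_le) (use \<delta>(3)[OF z] in \<open>simp add: dist_norm mult.commute[of \<epsilon>] mult_left_mono\<close>)
    qed
    then have "norm ((\<gamma> x - \<gamma> y) - (x - y) *\<^sub>R \<gamma>' t) \<le> \<epsilon> * \<bar>x - y\<bar>"
      by (simp add: algebra_simps)
    moreover have "norm ((x - y) *\<^sub>R \<gamma>' t) = norm (\<gamma>' t) * \<bar>x - y\<bar>" by simp
    ultimately show "\<bar>dist (\<gamma> x) (\<gamma> y) - norm (\<gamma>' t) * \<bar>x - y\<bar>\<bar> \<le> \<epsilon> * \<bar>x - y\<bar>"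
      using norm_triangle_ineq3[of "\<gamma> x - \<gamma> y" "(x - y) *\<^sub>R \<gamma>' t"]
      by (simp add: dist_norm mult.commute[of "norm (\<gamma>' t)"])
  qed
qed

subsection \<open>Smooth bump functions\<close>

text \<open>The powers in the denominator make the family closed under differentiation up to linear
  combinations, so that smoothness follows by one induction for all \<open>n\<close> at
  once.\<close>

definition flat :: "nat \<Rightarrow> real \<Rightarrow> real" where
  "flat n t = (if 0 < t then exp (- inverse t) / t ^ n else 0)"

lemma flat_tendsto_0: "(flat n \<longlongrightarrow> 0) (at 0)"
proof -
  have "((\<lambda>t. (inverse t) ^ n / exp (inverse t)) \<longlongrightarrow> 0) (at_right (0::real))"
    by (rule filterlim_compose[OF tendsto_power_div_exp_0 filterlim_inverse_at_top_right])
  then have "(flat n \<longlongrightarrow> 0) (at_right 0)"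
    by (rule Lim_transform_eventually)
      (auto simp: eventually_at_right_less flat_def exp_minus field_simps power_inverse
        intro!: eventually_mono[OF eventually_at_right_less])
  moreover have "(flat n \<longlongrightarrow> 0) (at_left 0)"
    by (rule tendsto_eventually) (auto simp: flat_def eventually_at intro!: exI[of _ 1])
  ultimately show ?thesis by (simp add: filterlim_split_at)
qed

lemma flat_has_field_derivative:
  "(flat n has_field_derivative (flat (n + 2) t - real n * flat (n + 1) t)) (at t)"
proof -
  consider "t < 0" | "t > 0" | "t = 0" by linarith
  then show ?thesis
  proof cases
    case 1
    have "((\<lambda>t. 0) has_field_derivative 0) (at t)" by simp
    then have "(flat n has_field_derivative 0) (at t)"
      by (rule has_field_derivative_transform_within[where d = "-t"]) (use 1 in \<open>auto simp: flat_def dist_real_def\<close>)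
    then show ?thesis using 1 by (simp add: flat_def)
  next
    case 2
    have p: "((\<lambda>t. inverse (t ^ n)) has_field_derivative (- (real n * inverse (t ^ (n + 1))))) (at t)"
      by (rule DERIV_cong[OF DERIV_inverse'[OF DERIV_pow]]) (use 2 in \<open>cases n; simp add: field_simps\<close>)+
    have e: "((\<lambda>t. exp (- inverse t)) has_field_derivative (exp (- inverse t) * inverse (t ^ 2))) (at t)"
      using 2 by (auto intro!: derivative_eq_intros simp: power2_eq_square)
    have "((\<lambda>t. exp (- inverse t) * inverse (t ^ n)) has_field_derivative
        (flat (n + 2) t - real n * flat (n + 1) t)) (at t)"
      by (rule DERIV_cong[OF DERIV_mult[OF e p]])
        (use 2 in \<open>simp add: flat_def field_simps power2_eq_square\<close>)
    then show ?thesis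
      by (rule has_field_derivative_transform_within[where d = t])
        (use 2 in \<open>auto simp: flat_def dist_real_def field_simps power_inverse\<close>)
  next
    case 3
    \<comment> \<open>At 0 the difference quotient of \<open>flat n\<close> is exactly
      \<open>flat (Suc n)\<close>, which tends to 0.\<close>
    have "((\<lambda>h. (flat n (0 + h) - flat n 0) / h) \<longlongrightarrow> 0) (at 0)"
    proof (rule Lim_transform_eventually[OF flat_tendsto_0[of "Suc n"]])
      show "\<forall>\<^sub>F h in at 0. flat (Suc n) h = (flat n (0 + h) - flat n 0) / h"
        by (rule always_eventually) (auto simp: flat_def)
    qed
    then show ?thesis using 3 by (simp add: DERIV_def flat_def)
  qed
qed

lemma smooth_on_flat: "smooth_on UNIV (flat n)"
  unfolding smooth_on_def
proof
  fix k show "C_on k UNIV (flat n)"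
  proof (induction k arbitrary: n)
    case 0
    show ?case unfolding C_on.simps
      by (rule DERIV_continuous_on, rule DERIV_subset[OF flat_has_field_derivative]) auto
  next
    case (Suc k)
    have "C_on k UNIV (\<lambda>t. flat (n + 2) t + (- real n) *\<^sub>R flat (n + 1) t)"
      by (rule C_on_add[OF open_UNIV Suc], rule C_on_bounded_linear[OF open_UNIV bounded_linear_scaleR_right Suc])
    then show ?case
      by (intro C_on_real_SucI[OF open_UNIV flat_has_field_derivative]) simp
  qed
qed

lemma flat0_bounds: "0 \<le> flat 0 t" "flat 0 t \<le> 1"
  by (auto simp: flat_def)

lemma flat0_scaled_tendsto: "(\<lambda>k. flat 0 (real k * y)) \<longlonglongrightarrow> indicator {0<..} y"
proof (cases "y > 0")
  case True
  have "(\<lambda>k. exp (- (inverse (real k) * inverse y))) \<longlonglongrightarrow> exp (- (0 * inverse y))"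
    by (intro tendsto_intros lim_inverse_n)
  then have "(\<lambda>k. flat 0 (real k * y)) \<longlonglongrightarrow> exp (- (0 * inverse y))"
    by (rule Lim_transform_eventually)
      (use True in \<open>auto simp: flat_def intro!: eventually_mono[OF eventually_gt_at_top[of 0]]\<close>)
  then show ?thesis using True by simp
next
  case False
  then have "flat 0 (real k * y) = 0" for k
    by (auto simp: flat_def zero_less_mult_iff)
  then show ?thesis using False by simp
qed

text \<open>Not normalised and not equal to 1 on a smaller box: pointwise convergence to the
  indicator of the open box, with the bound 1, is all that dominated convergence asks for.\<close>

definition box_bump :: "'a::euclidean_space \<Rightarrow> 'a \<Rightarrow> nat \<Rightarrow> 'a \<Rightarrow> real" where
  "box_bump a b k x = (\<Prod>i\<in>Basis. flat 0 (real k * ((x - a) \<bullet> i)) * flat 0 (real k * ((b - x) \<bullet> i)))"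

lemma smooth_on_prod:
  fixes f :: "'i \<Rightarrow> 'a::euclidean_space \<Rightarrow> real"
  assumes "open S" "\<And>i. i \<in> I \<Longrightarrow> smooth_on S (f i)"
  shows "smooth_on S (\<lambda>x. \<Prod>i\<in>I. f i x)"
  using assms(2)
  by (induction I rule: infinite_finite_induct) (auto intro!: smooth_on_const smooth_on_mult assms(1))

lemma smooth_on_box_bump: "smooth_on UNIV (box_bump a b k)"
proof -
  have f: "smooth_on UNIV (\<lambda>x. flat 0 (g x))" if "smooth_on UNIV g" for g :: "'a \<Rightarrow> real"
    by (rule smooth_on_compose[OF smooth_on_flat that]) auto
  have "smooth_on UNIV (\<lambda>x. box_bump a b k x)"
    unfolding box_bump_def
    by (intro smooth_on_prod smooth_on_mult f smooth_on_const smooth_on_inner smooth_on_diff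
        smooth_on_ident open_UNIV)
  then show ?thesis by simp
qed

lemma box_bump_bounds: "\<bar>box_bump a b k x\<bar> \<le> 1"
proof -
  have "0 \<le> box_bump a b k x" unfolding box_bump_def
    by (intro prod_nonneg mult_nonneg_nonneg flat0_bounds ballI)
  moreover have "box_bump a b k x \<le> 1" unfolding box_bump_def
    by (intro prod_le_1 conjI mult_nonneg_nonneg mult_le_one flat0_bounds)
  ultimately show ?thesis by simp
qed

lemma box_bump_support: "x \<notin> cbox a b \<Longrightarrow> box_bump a b k x = 0"
proof -
  assume "x \<notin> cbox a b"
  then obtain i where i: "i \<in> Basis" "x \<bullet> i < a \<bullet> i \<or> b \<bullet> i < x \<bullet> i"
    by (auto simp: mem_box not_le)
  then have "flat 0 (real k * ((x - a) \<bullet> i)) * flat 0 (real k * ((b - x) \<bullet> i)) = 0"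
    by (auto simp: flat_def zero_less_mult_iff inner_diff_left)
  then show ?thesis using i by (auto simp: box_bump_def intro!: prod_zero bexI[of _ i])
qed

lemma box_bump_tendsto: "(\<lambda>k. box_bump a b k x) \<longlonglongrightarrow> indicator (box a b) x"
proof -
  have "(\<lambda>k. box_bump a b k x) \<longlonglongrightarrow>
      (\<Prod>i\<in>Basis. indicator {0<..} ((x - a) \<bullet> i) * indicator {0<..} ((b - x) \<bullet> i) :: real)"
    unfolding box_bump_def by (intro tendsto_prod tendsto_mult flat0_scaled_tendsto)
  also have "(\<Prod>i\<in>Basis. indicator {0<..} ((x - a) \<bullet> i) * indicator {0<..} ((b - x) \<bullet> i) :: real)
      = indicator (box a b) x"
  proof (cases "x \<in> box a b")
    case True
    then show ?thesis by (auto simp: mem_box inner_diff_left intro!: prod.neutral)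
  next
    case False
    then obtain i where "i \<in> Basis" "\<not> (a \<bullet> i < x \<bullet> i \<and> x \<bullet> i < b \<bullet> i)" by (auto simp: mem_box)
    then have "(\<Prod>i\<in>Basis. indicator {0<..} ((x - a) \<bullet> i) * indicator {0<..} ((b - x) \<bullet> i) :: real) = 0"
      by (intro prod_zero bexI[of _ i]) (auto simp: indicator_def inner_diff_left)
    then show ?thesis using False by simp
  qed
  finally show ?thesis .
qed

lemma box_bump_test_function: "cbox a b \<subseteq> \<Omega> \<Longrightarrow> box_bump a b k \<in> test_functions \<Omega>"
  using smooth_on_box_bump[of a b k] box_bump_support[of _ a b k]
  by (auto simp: test_functions_def intro!: exI[of _ "cbox a b"])

section \<open>The fundamental lemma of the calculus of variations\<close>

lemma AE_zero_if_box_integrals_zero: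
  fixes f :: "'a::euclidean_space \<Rightarrow> real"
  assumes f: "integrable lborel f" and supp: "\<And>x. x \<notin> box p q \<Longrightarrow> f x = 0"
    and z: "\<And>a b. (LINT x:box a b|lborel. f x) = 0"
  shows "AE x in lborel. f x = 0"
proof -
  have si: "set_integrable lborel A f" if "A \<in> sets borel" for A
    unfolding set_integrable_def using that f by (intro integrable_mult_indicator) auto
  \<comment> \<open>The sets over which \<open>f\<close> integrates to 0 are stable under
    complements only because the whole integral vanishes, which is where the support in a box
    enters.\<close>
  have tot: "(LINT x|lborel. f x) = 0"
  proof -
    have "(\<lambda>x. indicator (box p q) x *\<^sub>R f x) = f" by (rule ext) (use supp in \<open>auto split: split_indicator\<close>)
    then show ?thesis using z[of p q] by (simp add: set_lebesgue_integral_def)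
  qed
  have "(LINT x:A|lborel. f x) = 0" if A: "A \<in> sets borel" for A
  proof -
    have "Int_stable (range (\<lambda>(a, b). box a b :: 'a set))"
      by (auto simp: Int_stable_def box_Int_box)
    moreover have "range (\<lambda>(a, b). box a b :: 'a set) \<subseteq> Pow UNIV" by simp
    moreover have "A \<in> sigma_sets UNIV (range (\<lambda>(a, b). box a b))"
      using A by (simp add: borel_eq_box)
    ultimately show ?thesis
    proof (induction rule: sigma_sets_induct_disjoint)
      case (basic A)
      then show ?case using z by auto
    next
      case empty
      then show ?case by (simp add: set_lebesgue_integral_def)
    next
      case (compl A)
      have Ab: "A \<in> sets borel" using compl(1) by (simp add: borel_eq_box)
      have "(LINT x|lborel. f x) = (LINT x:A \<union> (UNIV - A)|lborel. f x)"
        by (simp add: set_lebesgue_integral_def)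
      also have "\<dots> = (LINT x:A|lborel. f x) + (LINT x:UNIV - A|lborel. f x)"
        by (rule set_integral_Un) (use Ab in \<open>auto intro!: si\<close>)
      finally show ?case using tot compl by simp
    next
      case (union A)
      have Ab: "A i \<in> sets borel" for i using union(2) by (auto simp: borel_eq_box)
      have "(LINT x:(\<Union>i. A i)|lborel. f x) = (\<Sum>i. (LINT x:A i|lborel. f x))"
        by (rule lebesgue_integral_countable_add)
          (use Ab union(1) in \<open>auto intro!: si simp: disjoint_family_on_def\<close>)
      then show ?case using union by simp
    qed
  qed
  then show ?thesis
    using density_unique_real[OF f, of "\<lambda>_. 0"] by (simp add: set_lebesgue_integral_def)
qed

text \<open>Testing with the bumps of a box and passing to the limit shows that the integral over
  every box with closure in \<Omega> vanishes. Replacing \<open>w\<close> by an almost everywhere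
  equal Borel function \<open>v\<close> brings the question to \<open>lborel\<close>, where boxes
  generate the measurable sets.\<close>

lemma fundamental_lemma_calculus_variations:
  fixes w :: "'a::euclidean_space \<Rightarrow> real"
  assumes \<Omega>: "open \<Omega>" and w: "integrable (lebesgue_on \<Omega>) w"
    and z: "\<And>\<phi>. \<phi> \<in> test_functions \<Omega> \<Longrightarrow> (LINT x|lebesgue_on \<Omega>. \<phi> x * w x) = 0"
  shows "AE x in lebesgue_on \<Omega>. w x = 0"
proof -
  define W where "W x = indicator \<Omega> x * w x" for x
  have \<Omega>m: "\<Omega> \<in> sets lebesgue" using \<Omega> by auto
  have W: "integrable lebesgue W"
    using w \<Omega>m by (simp add: integrable_restrict_space W_def[abs_def])
  then obtain v where v: "v \<in> borel_measurable lborel" and Wv: "AE x in lborel. W x = v x"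
    using completion_ex_borel_measurable_real[of W lborel] by (auto dest: borel_measurable_integrable)
  have Wv': "AE x in lebesgue. W x = v x" using Wv by (rule AE_completion)
  have vi: "integrable lborel v"
  proof -
    have "integrable lebesgue v"
      by (rule integrable_cong_AE_imp[OF W]) (use v Wv' in \<open>auto intro: measurable_completion\<close>)
    then show ?thesis using v by (simp add: integrable_completion)
  qed
  have box0: "(LINT x:box a b|lborel. v x) = 0" if ab: "cbox a b \<subseteq> \<Omega>" for a b
  proof -
    have "(\<lambda>k. LINT x|lborel. box_bump a b k x * v x) \<longlonglongrightarrow> (LINT x|lborel. indicator (box a b) x * v x)"
    proof (rule integral_dominated_convergence[where w = "\<lambda>x. \<bar>v x\<bar>"])
      show "(\<lambda>x. box_bump a b i x * v x) \<in> borel_measurable lborel" for i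
        using v borel_measurable_continuous_onI[OF smooth_on_imp_continuous[OF smooth_on_box_bump[of a b i]]]
        by simp
      show "AE x in lborel. (\<lambda>i. box_bump a b i x * v x) \<longlonglongrightarrow> indicator (box a b) x * v x"
        by (intro AE_I2 tendsto_mult box_bump_tendsto tendsto_const)
      show "AE x in lborel. norm (box_bump a b i x * v x) \<le> \<bar>v x\<bar>" for i
        using box_bump_bounds[of a b i] by (auto simp: abs_mult intro!: mult_left_le_one_le)
    qed (use v vi in auto)
    moreover have "(LINT x|lborel. box_bump a b k x * v x) = 0" for k
    proof -
      have m: "box_bump a b k \<in> borel_measurable borel"
        using smooth_on_imp_continuous[OF smooth_on_box_bump[of a b k]]
        by (rule borel_measurable_continuous_onI)
      then have m': "box_bump a b k \<in> borel_measurable lborel" by simp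
      have "(LINT x|lborel. box_bump a b k x * v x) = (LINT x|lebesgue. box_bump a b k x * v x)"
        using m v by (subst integral_completion) auto
      also have "\<dots> = (LINT x|lebesgue. box_bump a b k x * W x)"
        by (rule integral_cong_AE)
          (use Wv' in \<open>auto intro!: borel_measurable_times measurable_completion[OF m'] measurable_completion[OF v]
              borel_measurable_integrable[OF W]\<close>)
      also have "\<dots> = (LINT x|lebesgue_on \<Omega>. box_bump a b k x * w x)"
        using \<Omega>m by (subst integral_restrict_space) (auto simp: W_def mult_ac)
      also have "\<dots> = 0" by (rule z[OF box_bump_test_function[OF ab]])
      finally show ?thesis .
    qed
    ultimately have "(\<lambda>k. 0) \<longlonglongrightarrow> (LINT x|lborel. indicator (box a b) x * v x)" by simp
    then show ?thesis by (simp add: set_lebesgue_integral_def LIMSEQ_const_iff)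
  qed
  \<comment> \<open>A countable cover by closed boxes localises the problem; a box meets each of
    them in a box that is still contained in \<Omega>.\<close>
  obtain \<D> where \<D>: "countable \<D>" "\<D> \<subseteq> Pow \<Omega>" "\<And>X. X \<in> \<D> \<Longrightarrow> \<exists>a b. X = cbox a b" "\<Union>\<D> = \<Omega>"
    using open_countable_Union_open_cbox[OF \<Omega>] by metis
  have bad: "AE x in lborel. x \<in> X \<longrightarrow> v x = 0" if X: "X \<in> \<D>" for X
  proof -
    obtain p q where pq: "X = cbox p q" using \<D>(3)[OF X] by blast
    have sub: "cbox p q \<subseteq> \<Omega>" using \<D>(2) X pq by blast
    have nb: "AE x in lborel. x \<in> box p q \<longleftrightarrow> x \<in> cbox p q"
    proof -
      have "AE x in lebesgue. x \<notin> cbox p q - box p q"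
        using negligible_frontier_interval[of p q] by (intro AE_not_in) (simp add: negligible_iff_null_sets)
      then have "AE x in lborel. x \<notin> cbox p q - box p q" by (simp add: AE_completion_iff)
      then show ?thesis by eventually_elim (use box_subset_cbox in blast)
    qed
    have "AE x in lborel. indicator (box p q) x * v x = 0"
    proof (rule AE_zero_if_box_integrals_zero[where p = p and q = q])
      show "integrable lborel (\<lambda>x. indicator (box p q) x * v x)"
        using integrable_mult_indicator[OF _ vi, of "box p q"] by simp
      fix a b
      obtain c d where cd: "box a b \<inter> box p q = box c d" "cbox a b \<inter> cbox p q = cbox c d"
        by (auto simp: Int_interval box_Int_box)
      have "(LINT x:box a b|lborel. indicator (box p q) x * v x) = (LINT x:box c d|lborel. v x)"
        unfolding set_lebesgue_integral_def by (auto simp: indicator_inter_arith mult_ac simp flip: cd(1))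
      also have "\<dots> = 0" by (rule box0) (use sub cd(2) in blast)
      finally show "(LINT x:box a b|lborel. indicator (box p q) x * v x) = 0" .
    qed auto
    then show ?thesis using nb by eventually_elim (auto simp: pq indicator_def)
  qed
  have "AE x in lborel. \<forall>X\<in>\<D>. x \<in> X \<longrightarrow> v x = 0"
    unfolding AE_ball_countable[OF \<D>(1)] using bad by blast
  then have "AE x in lborel. x \<in> \<Omega> \<longrightarrow> v x = 0"
    by eventually_elim (use \<D>(4) in blast)
  with Wv have "AE x in lborel. x \<in> \<Omega> \<longrightarrow> w x = 0"
    by eventually_elim (auto simp: W_def)
  then have "AE x in lebesgue. x \<in> \<Omega> \<longrightarrow> w x = 0" by (rule AE_completion)
  then show ?thesis using \<Omega>m by (simp add: AE_restrict_space_iff)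
qed

subsection \<open>Limits in \<open>L\<^sup>2\<close>, weak gradients and traces\<close>

lemma L2_memD:
  assumes "f \<in> L2 M"
  shows "f \<in> borel_measurable M" "integrable M (\<lambda>x. (norm (f x))\<^sup>2)"
  using assms by (auto simp: L2_def)

lemma L2_inner_integrable:
  assumes "f \<in> L2 M" "g \<in> L2 M"
  shows "integrable M (\<lambda>x. f x \<bullet> g x)"
proof (rule Bochner_Integration.integrable_bound)
  show "integrable M (\<lambda>x. (norm (f x))\<^sup>2 + (norm (g x))\<^sup>2)"
    using assms by (intro Bochner_Integration.integrable_add L2_memD)
  show "(\<lambda>x. f x \<bullet> g x) \<in> borel_measurable M"
    using assms by (intro borel_measurable_inner L2_memD)
  have "\<bar>f x \<bullet> g x\<bar> \<le> (norm (f x))\<^sup>2 + (norm (g x))\<^sup>2" for x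
  proof -
    have "2 * norm (f x) * norm (g x) \<le> (norm (f x))\<^sup>2 + (norm (g x))\<^sup>2"
      by (rule sum_squares_bound)
    moreover have "\<bar>f x \<bullet> g x\<bar> \<le> norm (f x) * norm (g x)" by (rule Cauchy_Schwarz_ineq2)
    moreover have "0 \<le> norm (f x) * norm (g x)" by simp
    ultimately show ?thesis by linarith
  qed
  then show "AE x in M. norm (f x \<bullet> g x) \<le> norm ((norm (f x))\<^sup>2 + (norm (g x))\<^sup>2)"
    by (intro AE_I2) simp
qed

lemma norm_diff_scaled_square: "(norm (a - t *\<^sub>R b))\<^sup>2 = (norm a)\<^sup>2 - 2 * t * (a \<bullet> b) + t\<^sup>2 * (norm b)\<^sup>2"
  for a b :: "'a::real_inner"
  by (simp add: power2_norm_eq_inner inner_diff inner_commute algebra_simps power2_eq_square[of t])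

lemma L2_diff_scaled:
  assumes "f \<in> L2 M" "g \<in> L2 M"
  shows "(\<lambda>x. f x - t *\<^sub>R g x) \<in> L2 M"
    and "(LINT x|M. (norm (f x - t *\<^sub>R g x))\<^sup>2) =
      (LINT x|M. (norm (f x))\<^sup>2) - 2 * t * (LINT x|M. f x \<bullet> g x) + t\<^sup>2 * (LINT x|M. (norm (g x))\<^sup>2)"
proof -
  note i = L2_memD(2)[OF assms(1)] L2_memD(2)[OF assms(2)] L2_inner_integrable[OF assms]
  show "(\<lambda>x. f x - t *\<^sub>R g x) \<in> L2 M"
    unfolding L2_def norm_diff_scaled_square mem_Collect_eq
    by (intro conjI borel_measurable_diff borel_measurable_scaleR borel_measurable_const L2_memD(1) assms
        Bochner_Integration.integrable_add Bochner_Integration.integrable_diff integrable_mult_right i)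
  show "(LINT x|M. (norm (f x - t *\<^sub>R g x))\<^sup>2) =
      (LINT x|M. (norm (f x))\<^sup>2) - 2 * t * (LINT x|M. f x \<bullet> g x) + t\<^sup>2 * (LINT x|M. (norm (g x))\<^sup>2)"
    unfolding norm_diff_scaled_square using i by simp
qed

lemma L2_diff: "f \<in> L2 M \<Longrightarrow> g \<in> L2 M \<Longrightarrow> (\<lambda>x. f x - g x) \<in> L2 M"
  using L2_diff_scaled(1)[of f M g 1] by simp

lemma L2_Cauchy_Schwarz:
  assumes "f \<in> L2 M" "g \<in> L2 M"
  shows "(LINT x|M. f x \<bullet> g x)\<^sup>2 \<le> (LINT x|M. (norm (f x))\<^sup>2) * (LINT x|M. (norm (g x))\<^sup>2)"
proof -
  define A B C where "A = (LINT x|M. (norm (f x))\<^sup>2)" and "B = (LINT x|M. f x \<bullet> g x)"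
    and "C = (LINT x|M. (norm (g x))\<^sup>2)"
  have q: "0 \<le> A - 2 * t * B + t\<^sup>2 * C" for t
    unfolding A_def B_def C_def L2_diff_scaled(2)[OF assms, symmetric]
    by (rule Bochner_Integration.integral_nonneg) simp
  have C: "0 \<le> C" unfolding C_def by (rule Bochner_Integration.integral_nonneg) simp
  have "B\<^sup>2 \<le> A * C"
  proof (cases "C = 0")
    case True
    have "B = 0"
    proof (rule ccontr)
      assume "B \<noteq> 0"
      \<comment> \<open>At this value of \<open>t\<close> the nonnegative polynomial would take the
        value -1.\<close>
      then show False using q[of "(A + 1) / (2 * B)"] True by (simp add: field_simps)
    qed
    then show ?thesis using True by simp
  next
    case False
    then have "C > 0" using C by simp
    then show ?thesis using q[of "B / C"] by (simp add: field_simps power2_eq_square)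
  qed
  then show ?thesis by (simp add: A_def B_def C_def)
qed

lemma L2_tendsto_inner:
  assumes "L2_tendsto M F f" "g \<in> L2 M"
  shows "(\<lambda>n. LINT x|M. F n x \<bullet> g x) \<longlonglongrightarrow> (LINT x|M. f x \<bullet> g x)"
proof -
  have F: "\<And>n. F n \<in> L2 M" and f: "f \<in> L2 M"
    and lim: "(\<lambda>n. LINT x|M. (norm (F n x - f x))\<^sup>2) \<longlonglongrightarrow> 0"
    using assms by (auto simp: L2_tendsto_def)
  have "(\<lambda>n. sqrt ((LINT x|M. (norm (F n x - f x))\<^sup>2) * (LINT x|M. (norm (g x))\<^sup>2))) \<longlonglongrightarrow> 0"
    using tendsto_real_sqrt[OF tendsto_mult_left_zero[OF lim]] by simp
  then have "(\<lambda>n. (LINT x|M. F n x \<bullet> g x) - (LINT x|M. f x \<bullet> g x)) \<longlonglongrightarrow> 0"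
  proof (rule Lim_null_comparison[rotated], intro always_eventually allI)
    fix n
    have "(LINT x|M. F n x \<bullet> g x) - (LINT x|M. f x \<bullet> g x) = (LINT x|M. (F n x - f x) \<bullet> g x)"
      unfolding inner_diff_left
      by (rule Bochner_Integration.integral_diff[symmetric]) (intro L2_inner_integrable F f assms(2))+
    also have "norm \<dots> \<le> sqrt ((LINT x|M. (norm (F n x - f x))\<^sup>2) * (LINT x|M. (norm (g x))\<^sup>2))"
      unfolding real_norm_def
      by (rule real_le_rsqrt) (simp add: L2_Cauchy_Schwarz[OF L2_diff[OF F f] assms(2)])
    finally show "norm ((LINT x|M. F n x \<bullet> g x) - (LINT x|M. f x \<bullet> g x))
       \<le> sqrt ((LINT x|M. (norm (F n x - f x))\<^sup>2) * (LINT x|M. (norm (g x))\<^sup>2))" .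
  qed
  then show ?thesis by (simp add: LIM_zero_iff)
qed

text \<open>Expanding the square of \<open>F n - f\<close> expresses the norm of \<open>F n\<close>
  through the norm of the difference and an inner product with \<open>f\<close>, whose limits are
  known.\<close>

lemma L2_tendsto_norm:
  assumes "L2_tendsto M F f"
  shows "(\<lambda>n. LINT x|M. (norm (F n x))\<^sup>2) \<longlonglongrightarrow> (LINT x|M. (norm (f x))\<^sup>2)"
proof -
  have F: "\<And>n. F n \<in> L2 M" and f: "f \<in> L2 M"
    and lim: "(\<lambda>n. LINT x|M. (norm (F n x - f x))\<^sup>2) \<longlonglongrightarrow> 0"
    using assms by (auto simp: L2_tendsto_def)
  have "(\<lambda>n. (LINT x|M. (norm (F n x - f x))\<^sup>2) + 2 * (LINT x|M. F n x \<bullet> f x) - (LINT x|M. (norm (f x))\<^sup>2))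
      \<longlonglongrightarrow> 0 + 2 * (LINT x|M. f x \<bullet> f x) - (LINT x|M. (norm (f x))\<^sup>2)"
    by (intro tendsto_intros lim L2_tendsto_inner[OF assms f])
  then show ?thesis
    using L2_diff_scaled(2)[OF F f, of _ 1] by (simp add: power2_norm_eq_inner)
qed

lemma (in finite_measure) L2_const: "(\<lambda>x. c) \<in> L2 M"
  by (simp add: L2_def)

lemma (in finite_measure) L2_imp_integrable:
  assumes "f \<in> L2 M"
  shows "integrable M f"
proof (rule Bochner_Integration.integrable_bound)
  show "integrable M (\<lambda>x. 1 + (norm (f x))\<^sup>2)"
    by (intro Bochner_Integration.integrable_add L2_memD[OF assms]) simp
  have "norm (f x) \<le> 1 + (norm (f x))\<^sup>2" for x
    using sum_squares_bound[of "norm (f x)" 1] norm_ge_zero[of "f x"] by (simp, linarith)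
  then show "AE x in M. norm (f x) \<le> norm (1 + (norm (f x))\<^sup>2)"
    by (intro AE_I2) simp
qed (rule L2_memD[OF assms])

lemma (in finite_measure) L2_tendsto_integral:
  fixes F :: "nat \<Rightarrow> 'a \<Rightarrow> real"
  assumes "L2_tendsto M F f"
  shows "(\<lambda>n. LINT x|M. F n x) \<longlonglongrightarrow> (LINT x|M. f x)"
  using L2_tendsto_inner[OF assms L2_const[of 1]] by simp

lemma L2_tendsto_const_AE:
  assumes "f \<in> L2 M" "g \<in> L2 M" "AE x in M. f x = g x"
  shows "L2_tendsto M (\<lambda>n. f) g"
proof -
  have "(LINT x|M. (norm (f x - g x))\<^sup>2) = 0"
    by (rule integral_eq_zero_AE) (use assms(3) in auto)
  then show ?thesis using assms by (simp add: L2_tendsto_def)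
qed

section \<open>Gradients, integration by parts and traces of smooth functions\<close>

lemma C_on_Un:
  assumes "open S" "open T" "C_on k S f" "C_on k T f"
  shows "C_on k (S \<union> T) f"
  using assms(3,4)
  by (induction k arbitrary: f) (auto intro: continuous_on_open_Un assms(1,2))

lemma smooth_on_Un: "open S \<Longrightarrow> open T \<Longrightarrow> smooth_on S f \<Longrightarrow> smooth_on T f \<Longrightarrow> smooth_on (S \<union> T) f"
  by (simp add: smooth_on_def C_on_Un)

lemma grad_inner: "b \<in> Basis \<Longrightarrow> grad f x \<bullet> b = frechet_derivative f (at x) b"
  by (simp add: grad_def inner_sum_left inner_Basis if_distrib cong: if_cong)

lemma grad_eqI:
  assumes "(f has_derivative (\<lambda>h. v \<bullet> h)) (at x)"
  shows "grad f x = v"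
  using frechet_derivative_at[OF assms, symmetric] by (simp add: grad_def euclidean_representation)

lemma has_derivative_grad:
  assumes "smooth_on S f" "x \<in> S"
  shows "(f has_derivative (\<lambda>h. grad f x \<bullet> h)) (at x)"
proof -
  note d = smooth_on_has_derivative[OF assms]
  have "frechet_derivative f (at x) h = grad f x \<bullet> h" for h
  proof -
    have l: "linear (frechet_derivative f (at x))" using d by (rule has_derivative_linear)
    have "frechet_derivative f (at x) h = frechet_derivative f (at x) (\<Sum>b\<in>Basis. (h \<bullet> b) *\<^sub>R b)"
      by (simp add: euclidean_representation)
    also have "\<dots> = (\<Sum>b\<in>Basis. (h \<bullet> b) * frechet_derivative f (at x) b)"
      by (simp add: linear_sum[OF l] linear_scale[OF l])
    also have "\<dots> = grad f x \<bullet> h"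
      by (subst euclidean_inner) (simp add: grad_inner mult.commute)
    finally show ?thesis .
  qed
  then have "frechet_derivative f (at x) = (\<lambda>h. grad f x \<bullet> h)" by (rule ext)
  with d show ?thesis by simp
qed

lemma continuous_on_grad: "smooth_on S f \<Longrightarrow> continuous_on S (grad f)"
  unfolding grad_def
  by (intro continuous_on_sum continuous_on_scaleR smooth_on_imp_continuous[OF smooth_on_derivative]
      continuous_on_const)

text \<open>Translation invariance gives every difference quotient of \<open>f\<close> the integral
  0, and these quotients converge boundedly to the derivative on one compact set. This replaces an
  iterated integral along lines.\<close>

lemma integral_directional_derivative_zero:
  fixes f :: "'a::euclidean_space \<Rightarrow> real"
  assumes f: "smooth_on UNIV f" and K: "compact K" "\<And>x. x \<notin> K \<Longrightarrow> f x = 0" and b: "b \<in> Basis"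
  shows "(LINT x|lborel. frechet_derivative f (at x) b) = 0"
proof -
  define D where "D x = frechet_derivative f (at x) b" for x
  have fd: "(f has_derivative frechet_derivative f (at x)) (at x)" for x
    by (rule smooth_on_has_derivative[OF f]) simp
  have line: "((\<lambda>s. f (x + s *\<^sub>R b)) has_field_derivative D (x + s *\<^sub>R b)) (at s)" for x s
  proof -
    have "((\<lambda>s. f (x + s *\<^sub>R b)) has_derivative (\<lambda>h. frechet_derivative f (at (x + s *\<^sub>R b)) (h *\<^sub>R b))) (at s)"
      by (rule has_derivative_compose[OF _ fd]) (auto intro!: derivative_eq_intros)
    then show ?thesis
      by (simp add: has_field_derivative_def D_def linear_scale[OF has_derivative_linear[OF fd]] mult_commute_abs)
  qed
  have Dc: "continuous_on UNIV D"
    unfolding D_def by (rule smooth_on_imp_continuous[OF smooth_on_derivative[OF f b]])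
  have D0: "D x = 0" if "x \<notin> K" for x
  proof -
    have "(f has_derivative (\<lambda>h. 0)) (at x)"
      by (rule has_derivative_transform_within_open[of "\<lambda>x. 0" _ _ _ "- K"])
        (use K that in \<open>auto simp: compact_imp_closed open_Compl\<close>)
    then have "frechet_derivative f (at x) = (\<lambda>h. 0)" using frechet_derivative_at by metis
    then show ?thesis by (simp add: D_def)
  qed
  obtain L0 where L0: "\<And>x. x \<in> K \<Longrightarrow> norm (D x) \<le> L0"
    using compact_imp_bounded[OF compact_continuous_image[OF continuous_on_subset[OF Dc] K(1)]]
    by (auto simp: bounded_iff)
  define L where "L = max L0 0"
  have L: "\<bar>D x\<bar> \<le> L" for x
    using L0[of x] D0[of x] by (cases "x \<in> K") (auto simp: L_def)
  \<comment> \<open>The points from which a shift by \<open>s *\<^sub>R b\<close> with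
    \<open>s\<close> between 0 and 1 leads into \<open>K\<close>; outside this set all difference
    quotients with step at most 1 vanish.\<close>
  define K' where "K' = (\<lambda>(x, s). x - s *\<^sub>R b) ` (K \<times> {0..1::real})"
  have K': "compact K'" unfolding K'_def
    by (intro compact_continuous_image compact_Times K compact_Icc)
      (auto intro!: continuous_intros simp: case_prod_unfold)
  have KK': "x \<in> K \<Longrightarrow> x \<in> K'" for x unfolding K'_def by (rule image_eqI[of _ _ "(x, 0)"]) auto
  have fc: "continuous_on UNIV f" by (rule smooth_on_imp_continuous[OF f])
  have fi: "integrable lborel f"
  proof -
    have "(\<lambda>x. indicator K x *\<^sub>R f x) = f" by (rule ext) (use K(2) in \<open>auto split: split_indicator\<close>)
    then show ?thesis
      using borel_integrable_compact[OF K(1) continuous_on_subset[OF fc]] by auto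
  qed
  define q where "q n x = real (Suc n) * (f (x + (1 / Suc n) *\<^sub>R b) - f x)" for n :: nat and x
  have "(\<lambda>n. LINT x|lborel. q n x) \<longlonglongrightarrow> (LINT x|lborel. D x)"
  proof (rule integral_dominated_convergence[where w = "\<lambda>x. indicator K' x *\<^sub>R L"])
    show "D \<in> borel_measurable lborel" using borel_measurable_continuous_onI[OF Dc] by simp
    show "q n \<in> borel_measurable lborel" for n
    proof -
      have "continuous_on UNIV (q n)" unfolding q_def
        by (intro continuous_intros continuous_on_compose2[OF fc]) auto
      then show ?thesis using borel_measurable_continuous_onI by auto
    qed
    show "integrable lborel (\<lambda>x. indicator K' x *\<^sub>R L)"
      by (rule borel_integrable_compact[OF K']) auto
    show "AE x in lborel. (\<lambda>n. q n x) \<longlonglongrightarrow> D x"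
    proof (rule AE_I2)
      fix x
      have "((\<lambda>h. (f (x + (0 + h) *\<^sub>R b) - f (x + 0 *\<^sub>R b)) / h) \<longlongrightarrow> D (x + 0 *\<^sub>R b)) (at 0)"
        using line[of x 0] by (simp add: DERIV_def)
      moreover have "filterlim (\<lambda>n. 1 / real (Suc n)) (at 0) sequentially"
        by (rule filterlim_atI) (use LIMSEQ_inverse_real_of_nat in \<open>auto simp: inverse_eq_divide\<close>)
      ultimately have "(\<lambda>n. (f (x + (0 + 1 / real (Suc n)) *\<^sub>R b) - f (x + 0 *\<^sub>R b)) / (1 / real (Suc n)))
          \<longlonglongrightarrow> D (x + 0 *\<^sub>R b)"
        by (rule filterlim_compose)
      then show "(\<lambda>n. q n x) \<longlonglongrightarrow> D x" by (simp add: q_def mult.commute)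
    qed
    show "AE x in lborel. norm (q n x) \<le> indicator K' x *\<^sub>R L" for n
    proof (rule AE_I2)
      fix x
      define h where "h = 1 / real (Suc n)"
      have h: "0 < h" "h \<le> 1" by (auto simp: h_def)
      obtain s where s: "0 < s" "s < h" "f (x + h *\<^sub>R b) - f (x + 0 *\<^sub>R b) = (h - 0) * D (x + s *\<^sub>R b)"
        using MVT2[OF h(1), of "\<lambda>s. f (x + s *\<^sub>R b)" "\<lambda>s. D (x + s *\<^sub>R b)"] line by blast
      have q: "q n x = D (x + s *\<^sub>R b)"
        using s(3) by (simp add: q_def h_def)
      show "norm (q n x) \<le> indicator K' x *\<^sub>R L"
      proof (cases "x + s *\<^sub>R b \<in> K")
        case True
        then have "x \<in> K'" unfolding K'_def
          by (intro image_eqI[of _ _ "(x + s *\<^sub>R b, s)"]) (use s h in auto)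
        then show ?thesis using L q by simp
      next
        case False
        then show ?thesis using D0 q by (simp add: L_def indicator_def)
      qed
    qed
  qed
  moreover have "(LINT x|lborel. q n x) = 0" for n
  proof -
    define v where "v = (1 / Suc n) *\<^sub>R b"
    have i: "integrable lborel (\<lambda>x. f (v + x))" "(LINT x|lborel. f (v + x)) = (LINT x|lborel. f x)"
    proof -
      have m: "(+) v \<in> measurable lborel borel" "f \<in> borel_measurable borel"
        using borel_measurable_continuous_onI[OF fc] by auto
      show "integrable lborel (\<lambda>x. f (v + x))"
        using integrable_distr_eq[OF m] fi by (simp add: lborel_distr_plus)
      show "(LINT x|lborel. f (v + x)) = (LINT x|lborel. f x)"
        using integral_distr[OF m] by (simp add: lborel_distr_plus)
    qed
    have "(LINT x|lborel. q n x) = (LINT x|lborel. real (Suc n) * (f (v + x) - f x))"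
      by (simp add: q_def v_def add.commute)
    also have "\<dots> = real (Suc n) * ((LINT x|lborel. f (v + x)) - (LINT x|lborel. f x))"
      using i fi by simp
    finally show ?thesis using i by simp
  qed
  ultimately have "(LINT x|lborel. D x) = 0" by (simp add: LIMSEQ_const_iff)
  then show ?thesis by (simp add: D_def)
qed

lemma finite_measure_lebesgue_on_bounded:
  "bounded \<Omega> \<Longrightarrow> \<Omega> \<in> sets lebesgue \<Longrightarrow> finite_measure (lebesgue_on \<Omega>)"
proof (rule finite_measureI)
  assume "bounded \<Omega>" "\<Omega> \<in> sets lebesgue"
  then show "emeasure (lebesgue_on \<Omega>) (space (lebesgue_on \<Omega>)) \<noteq> \<infinity>"
    using fmeasurableD2[OF bounded_set_imp_lmeasurable]
    by (simp add: emeasure_restrict_space space_restrict_space del: emeasure_completion)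
qed

lemma continuous_on_closure_measurable:
  fixes f :: "'a::euclidean_space \<Rightarrow> 'b::euclidean_space"
  assumes "open \<Omega>" "continuous_on (closure \<Omega>) f"
  shows "f \<in> borel_measurable (lebesgue_on \<Omega>)"
proof -
  have "continuous_on \<Omega> f" using assms(2) closure_subset continuous_on_subset by blast
  then show ?thesis using assms(1)
    by (intro continuous_imp_measurable_on_sets_lebesgue) auto
qed

lemma continuous_on_closure_integrable:
  fixes f :: "'a::euclidean_space \<Rightarrow> 'b::euclidean_space"
  assumes "open \<Omega>" "bounded \<Omega>" "continuous_on (closure \<Omega>) f"
  shows "integrable (lebesgue_on \<Omega>) f"
proof -
  interpret finite_measure "lebesgue_on \<Omega>"
    by (rule finite_measure_lebesgue_on_bounded) (use assms in auto)
  obtain B where "\<And>x. x \<in> closure \<Omega> \<Longrightarrow> norm (f x) \<le> B"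
    using compact_imp_bounded[OF compact_continuous_image[OF assms(3)]] assms(2)
    by (auto simp: bounded_iff compact_closure)
  then have "AE x in lebesgue_on \<Omega>. norm (f x) \<le> B"
    using closure_subset[of \<Omega>] by (intro AE_I2) (auto simp: space_restrict_space)
  then show ?thesis
    by (rule integrable_const_bound) (rule continuous_on_closure_measurable[OF assms(1,3)])
qed

lemma continuous_on_closure_L2:
  fixes f :: "'a::euclidean_space \<Rightarrow> 'b::euclidean_space"
  assumes "open \<Omega>" "bounded \<Omega>" "continuous_on (closure \<Omega>) f"
  shows "f \<in> L2 (lebesgue_on \<Omega>)"
  unfolding L2_def mem_Collect_eq
  by (intro conjI continuous_on_closure_measurable continuous_on_closure_integrable
      continuous_on_power continuous_on_norm assms)

text \<open>\<open>F\<close> is smooth near the closure of \<Omega> only, but its product with the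
  compactly supported \<phi> is smooth on the whole space, since \<open>U\<close> and the complement
  of the support cover it. The integrand is the derivative of this product.\<close>

lemma integral_by_parts_test_function:
  fixes F :: "'a::euclidean_space \<Rightarrow> real"
  assumes \<Omega>: "open \<Omega>" and U: "open U" "closure \<Omega> \<subseteq> U" "smooth_on U F"
    and \<phi>: "\<phi> \<in> test_functions \<Omega>" and b: "b \<in> Basis"
  shows "(LINT x|lebesgue_on \<Omega>. F x * (grad \<phi> x \<bullet> b) + \<phi> x * (grad F x \<bullet> b)) = 0"
proof -
  obtain K where K: "compact K" "K \<subseteq> \<Omega>" "\<And>x. x \<notin> K \<Longrightarrow> \<phi> x = 0" and s\<phi>: "smooth_on UNIV \<phi>"
    using \<phi> by (auto simp: test_functions_def)
  have \<Omega>U: "\<Omega> \<subseteq> U" using U(2) closure_subset by blast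
  define f where "f x = (if x \<in> K then \<phi> x * F x else 0)" for x
  have oK: "open (- K)" using K(1) by (simp add: compact_imp_closed open_Compl)
  have fU: "f x = \<phi> x * F x" for x using K(3) by (auto simp: f_def)
  have "smooth_on U (\<lambda>x. \<phi> x * F x)"
    by (rule smooth_on_mult[OF U(1) smooth_on_subset[OF s\<phi>] U(3)]) simp
  moreover have feq: "f = (\<lambda>x. \<phi> x * F x)" by (rule ext) (rule fU)
  ultimately have "smooth_on U f" by simp
  moreover have "smooth_on (- K) f"
    using smooth_on_cong[OF oK, of f "\<lambda>_. 0"] smooth_on_const[OF oK] by (auto simp: f_def)
  moreover have "U \<union> - K = UNIV" using K(2) \<Omega>U by blast
  ultimately have fs: "smooth_on UNIV f" using smooth_on_Un[OF U(1) oK] by metis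
  define h where "h x = frechet_derivative f (at x) b" for x
  have h: "h x = F x * (grad \<phi> x \<bullet> b) + \<phi> x * (grad F x \<bullet> b)" if "x \<in> \<Omega>" for x
  proof -
    have "((\<lambda>x. \<phi> x * F x) has_derivative (\<lambda>h. \<phi> x * (grad F x \<bullet> h) + (grad \<phi> x \<bullet> h) * F x)) (at x)"
      by (intro has_derivative_mult has_derivative_grad[OF U(3)] has_derivative_grad[OF s\<phi>])
        (use that \<Omega>U in auto)
    then have "(f has_derivative (\<lambda>h. \<phi> x * (grad F x \<bullet> h) + (grad \<phi> x \<bullet> h) * F x)) (at x)"
      by (simp only: feq)
    from frechet_derivative_at[OF this, symmetric] show ?thesis by (simp add: h_def)
  qed
  have h0: "h x = 0" if "x \<notin> \<Omega>" for x
  proof -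
    have "(f has_derivative (\<lambda>h. 0)) (at x)"
      by (rule has_derivative_transform_within_open[of "\<lambda>x. 0" _ _ _ "- K"])
        (use oK that K(2) in \<open>auto simp: f_def\<close>)
    from frechet_derivative_at[OF this, symmetric] show ?thesis by (simp add: h_def)
  qed
  have hm: "h \<in> borel_measurable lborel"
    using borel_measurable_continuous_onI[OF smooth_on_imp_continuous[OF smooth_on_derivative[OF fs b]]]
    by (simp add: h_def[abs_def])
  have "(LINT x|lebesgue_on \<Omega>. F x * (grad \<phi> x \<bullet> b) + \<phi> x * (grad F x \<bullet> b)) = (LINT x|lebesgue_on \<Omega>. h x)"
    by (rule Bochner_Integration.integral_cong) (auto simp: space_restrict_space h)
  also have "\<dots> = (LINT x|lebesgue. indicator \<Omega> x *\<^sub>R h x)"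
    using \<Omega> by (subst integral_restrict_space) auto
  also have "(\<lambda>x. indicator \<Omega> x *\<^sub>R h x) = h"
    by (rule ext) (use h0 in \<open>auto split: split_indicator\<close>)
  also have "(LINT x|lebesgue. h x) = (LINT x|lborel. h x)" by (rule integral_completion[OF hm])
  also have "\<dots> = 0"
    unfolding h_def by (rule integral_directional_derivative_zero[OF fs K(1) _ b]) (simp add: f_def)
  finally show ?thesis .
qed

lemma grad_test_function_continuous:
  "\<phi> \<in> test_functions \<Omega> \<Longrightarrow> continuous_on S (grad \<phi>)" "\<phi> \<in> test_functions \<Omega> \<Longrightarrow> continuous_on S \<phi>"
  using continuous_on_grad[of UNIV \<phi>] smooth_on_imp_continuous[of UNIV \<phi>]
  by (auto simp: test_functions_def intro: continuous_on_subset)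

lemma is_weak_grad_smooth:
  fixes F :: "'a::euclidean_space \<Rightarrow> real"
  assumes \<Omega>: "open \<Omega>" "bounded \<Omega>" and U: "open U" "closure \<Omega> \<subseteq> U" "smooth_on U F"
  shows "is_weak_grad \<Omega> F (grad F)" "F \<in> H1 \<Omega>"
proof -
  have Fc: "continuous_on (closure \<Omega>) F" "continuous_on (closure \<Omega>) (grad F)"
    using smooth_on_imp_continuous[OF U(3)] continuous_on_grad[OF U(3)] U(2) continuous_on_subset by blast+
  have "(LINT x|lebesgue_on \<Omega>. F x *\<^sub>R grad \<phi> x) = - (LINT x|lebesgue_on \<Omega>. \<phi> x *\<^sub>R grad F x)"
    if \<phi>: "\<phi> \<in> test_functions \<Omega>" for \<phi>
  proof (rule euclidean_eqI)
    fix b :: 'a assume b: "b \<in> Basis"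
    note c = grad_test_function_continuous[OF \<phi>, of "closure \<Omega>"]
    have i: "integrable (lebesgue_on \<Omega>) (\<lambda>x. F x *\<^sub>R grad \<phi> x)" "integrable (lebesgue_on \<Omega>) (\<lambda>x. \<phi> x *\<^sub>R grad F x)"
      by (intro continuous_on_closure_integrable \<Omega> continuous_on_scaleR Fc c)+
    have "(LINT x|lebesgue_on \<Omega>. F x *\<^sub>R grad \<phi> x) \<bullet> b + (LINT x|lebesgue_on \<Omega>. \<phi> x *\<^sub>R grad F x) \<bullet> b
      = (LINT x|lebesgue_on \<Omega>. (F x *\<^sub>R grad \<phi> x) \<bullet> b) + (LINT x|lebesgue_on \<Omega>. (\<phi> x *\<^sub>R grad F x) \<bullet> b)"
      using i by (simp only: integral_inner_left)
    also have "\<dots> = (LINT x|lebesgue_on \<Omega>. (F x *\<^sub>R grad \<phi> x) \<bullet> b + (\<phi> x *\<^sub>R grad F x) \<bullet> b)"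
      by (rule Bochner_Integration.integral_add[symmetric]) (intro integrable_inner_left i)+
    also have "\<dots> = 0" using integral_by_parts_test_function[OF \<Omega>(1) U \<phi> b] by simp
    finally show "(LINT x|lebesgue_on \<Omega>. F x *\<^sub>R grad \<phi> x) \<bullet> b
        = (- (LINT x|lebesgue_on \<Omega>. \<phi> x *\<^sub>R grad F x)) \<bullet> b" by simp
  qed
  then show w: "is_weak_grad \<Omega> F (grad F)"
    unfolding is_weak_grad_def using continuous_on_closure_L2[OF \<Omega> Fc(2)] by blast
  show "F \<in> H1 \<Omega>" unfolding H1_def using continuous_on_closure_L2[OF \<Omega> Fc(1)] w by blast
qed

text \<open>Makes the choice inside \<open>weak_grad\<close> harmless: each coordinate of the
  difference is orthogonal to all test functions.\<close>

lemma is_weak_grad_unique: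
  fixes u :: "'a::euclidean_space \<Rightarrow> real"
  assumes \<Omega>: "open \<Omega>" "bounded \<Omega>" and w: "is_weak_grad \<Omega> u w" "is_weak_grad \<Omega> u w'"
  shows "AE x in lebesgue_on \<Omega>. w x = w' x"
proof -
  interpret finite_measure "lebesgue_on \<Omega>"
    by (rule finite_measure_lebesgue_on_bounded) (use \<Omega> in auto)
  have L: "w \<in> L2 (lebesgue_on \<Omega>)" "w' \<in> L2 (lebesgue_on \<Omega>)" using w by (auto simp: is_weak_grad_def)
  note Li = L2_imp_integrable[OF L(1)] L2_imp_integrable[OF L(2)]
  have "AE x in lebesgue_on \<Omega>. (w x - w' x) \<bullet> b = 0" if b: "b \<in> Basis" for b
  proof (rule fundamental_lemma_calculus_variations[OF \<Omega>(1)])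
    show "integrable (lebesgue_on \<Omega>) (\<lambda>x. (w x - w' x) \<bullet> b)"
      by (intro integrable_inner_left Bochner_Integration.integrable_diff Li)
    fix \<phi> assume \<phi>: "\<phi> \<in> test_functions \<Omega>"
    have \<phi>L: "(\<lambda>x. \<phi> x *\<^sub>R b) \<in> L2 (lebesgue_on \<Omega>)"
      by (intro continuous_on_closure_L2 \<Omega> continuous_intros grad_test_function_continuous[OF \<phi>])
    have i: "integrable (lebesgue_on \<Omega>) (\<lambda>x. \<phi> x *\<^sub>R v x)" if v: "v \<in> L2 (lebesgue_on \<Omega>)" for v :: "'a \<Rightarrow> 'a"
    proof -
      obtain B where B: "\<And>x. x \<in> closure \<Omega> \<Longrightarrow> norm (\<phi> x) \<le> B"
      proof -
        have "compact (closure \<Omega>)" using \<Omega>(2) by (simp add: compact_closure)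
        from compact_imp_bounded[OF compact_continuous_image[OF grad_test_function_continuous(2)[OF \<phi>] this]]
        show ?thesis using that unfolding bounded_iff by (metis image_eqI)
      qed
      show ?thesis
      proof (rule Bochner_Integration.integrable_bound)
        show "integrable (lebesgue_on \<Omega>) (\<lambda>x. B *\<^sub>R v x)"
          using L2_imp_integrable[OF v] by simp
        show "(\<lambda>x. \<phi> x *\<^sub>R v x) \<in> borel_measurable (lebesgue_on \<Omega>)"
          by (intro borel_measurable_scaleR L2_memD[OF v] continuous_on_closure_measurable \<Omega>
              grad_test_function_continuous[OF \<phi>])
        have "norm (\<phi> x *\<^sub>R v x) \<le> norm (B *\<^sub>R v x)" if "x \<in> \<Omega>" for x
        proof -
          have "\<bar>\<phi> x\<bar> \<le> \<bar>B\<bar>" using B[of x] that closure_subset[of \<Omega>] by force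
          then show ?thesis by (simp add: mult_right_mono)
        qed
        then show "AE x in lebesgue_on \<Omega>. norm (\<phi> x *\<^sub>R v x) \<le> norm (B *\<^sub>R v x)"
          by (intro AE_I2) (auto simp: space_restrict_space)
      qed
    qed
    have "(LINT x|lebesgue_on \<Omega>. \<phi> x *\<^sub>R w x) = (LINT x|lebesgue_on \<Omega>. \<phi> x *\<^sub>R w' x)"
      using w \<phi> unfolding is_weak_grad_def by (metis neg_equal_iff_equal)
    then have "(LINT x|lebesgue_on \<Omega>. (\<phi> x *\<^sub>R w x) \<bullet> b) - (LINT x|lebesgue_on \<Omega>. (\<phi> x *\<^sub>R w' x) \<bullet> b) = 0"
      using i[OF L(1)] i[OF L(2)] by (simp only: integral_inner_left diff_self)
    moreover have "(LINT x|lebesgue_on \<Omega>. (\<phi> x *\<^sub>R w x) \<bullet> b) - (LINT x|lebesgue_on \<Omega>. (\<phi> x *\<^sub>R w' x) \<bullet> b)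
       = (LINT x|lebesgue_on \<Omega>. (\<phi> x *\<^sub>R w x) \<bullet> b - (\<phi> x *\<^sub>R w' x) \<bullet> b)"
      by (rule Bochner_Integration.integral_diff[symmetric]) (intro integrable_inner_left i L)+
    ultimately show "(LINT x|lebesgue_on \<Omega>. \<phi> x * ((w x - w' x) \<bullet> b)) = 0"
      by (simp add: algebra_simps inner_diff_left)
  qed
  then have "AE x in lebesgue_on \<Omega>. \<forall>b\<in>Basis. (w x - w' x) \<bullet> b = 0"
    by (simp add: AE_ball_countable uncountable_def countable_finite)
  then show ?thesis
    by eventually_elim (simp add: euclidean_all_zero_iff)
qed

lemma is_weak_grad_weak_grad:
  assumes "u \<in> H1 \<Omega>"
  shows "is_weak_grad \<Omega> u (weak_grad \<Omega> u)"
proof -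
  obtain w where "is_weak_grad \<Omega> u w" using assms by (auto simp: H1_def)
  then show ?thesis unfolding weak_grad_def by (rule someI[where P = "is_weak_grad \<Omega> u"])
qed

text \<open>The constant sequence is an admissible approximation. Its gradient agrees with
  \<open>weak_grad\<close> only almost everywhere, because the latter is a chosen
  representative.\<close>

lemma has_trace_smooth:
  fixes F :: "'a::euclidean_space \<Rightarrow> real"
  assumes \<Omega>: "open \<Omega>" "bounded \<Omega>" and U: "open U" "closure \<Omega> \<subseteq> U" "smooth_on U F"
    and L: "F \<in> L2 (boundary_measure \<Omega>)"
  shows "has_trace \<Omega> F F" "AE x in lebesgue_on \<Omega>. grad F x = weak_grad \<Omega> F x"
proof -
  note w = is_weak_grad_smooth[OF \<Omega> U]
  have Fc: "continuous_on (closure \<Omega>) F"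
    using smooth_on_imp_continuous[OF U(3)] U(2) continuous_on_subset by blast
  show ae: "AE x in lebesgue_on \<Omega>. grad F x = weak_grad \<Omega> F x"
    by (rule is_weak_grad_unique[OF \<Omega> w(1) is_weak_grad_weak_grad[OF w(2)]])
  have "L2_tendsto (lebesgue_on \<Omega>) (\<lambda>n. F) F"
    by (rule L2_tendsto_const_AE) (use continuous_on_closure_L2[OF \<Omega> Fc] in auto)
  moreover have "L2_tendsto (lebesgue_on \<Omega>) (\<lambda>n. grad F) (weak_grad \<Omega> F)"
    by (rule L2_tendsto_const_AE[OF _ _ ae])
      (use w is_weak_grad_weak_grad[OF w(2)] in \<open>auto simp: is_weak_grad_def\<close>)
  moreover have "L2_tendsto (boundary_measure \<Omega>) (\<lambda>n. F) F"
    by (rule L2_tendsto_const_AE[OF L L]) simp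
  ultimately show "has_trace \<Omega> F F"
    unfolding has_trace_def using w(2) U by (intro conjI exI[of _ "\<lambda>n. F"] allI exI[of _ U]) auto
qed

subsection \<open>Polar coordinates\<close>

text \<open>The complex exponential of \<open>s + i t\<close>. It is conformal with factor
  \<open>exp s\<close>, which makes the Dirichlet integral in \<open>s, t\<close> the flat
  one.\<close>

definition pol :: "real \<Rightarrow> real \<Rightarrow> real^2" where
  "pol s t = exp s *\<^sub>R vector [cos t, sin t]"

text \<open>The derivative of \<open>pol\<close> in \<open>t\<close>; the derivative in
  \<open>s\<close> is \<open>pol\<close> itself.\<close>

definition pol' :: "real \<Rightarrow> real \<Rightarrow> real^2" where
  "pol' s t = exp s *\<^sub>R vector [- sin t, cos t]"

lemma pol_nth [simp]: "pol s t $ 1 = exp s * cos t" "pol s t $ 2 = exp s * sin t"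
  "pol' s t $ 1 = - (exp s * sin t)" "pol' s t $ 2 = exp s * cos t"
  by (auto simp: pol_def pol'_def)

lemma vec2_eqI: "(x :: real^2) $ 1 = y $ 1 \<Longrightarrow> x $ 2 = y $ 2 \<Longrightarrow> x = y"
  by (simp add: vec_eq_iff forall_2)

lemma inner_vec2: "(x :: real^2) \<bullet> y = x $ 1 * y $ 1 + x $ 2 * y $ 2"
  by (simp add: inner_vec_def sum_2)

lemma norm_vec2: "norm (x :: real^2) = sqrt ((x $ 1)\<^sup>2 + (x $ 2)\<^sup>2)"
  by (simp add: norm_eq_sqrt_inner inner_vec2 power2_eq_square)

lemma norm_pol [simp]: "norm (pol s t) = exp s"
proof -
  have "(exp s * cos t)\<^sup>2 + (exp s * sin t)\<^sup>2 = (exp s)\<^sup>2 * ((sin t)\<^sup>2 + (cos t)\<^sup>2)"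
    by (simp only: power_mult_distrib algebra_simps)
  then show ?thesis by (simp add: norm_vec2)
qed

lemma norm_pol' [simp]: "norm (pol' s t) = exp s"
proof -
  have "(exp s * sin t)\<^sup>2 + (exp s * cos t)\<^sup>2 = (exp s)\<^sup>2 * ((sin t)\<^sup>2 + (cos t)\<^sup>2)"
    by (simp only: power_mult_distrib algebra_simps)
  then show ?thesis by (simp add: norm_vec2)
qed

lemma pol_inner [simp]: "pol s t \<bullet> pol' r t = 0" "pol s t \<bullet> pol r t = exp s * exp r"
proof -
  show "pol s t \<bullet> pol' r t = 0" by (simp add: inner_vec2)
  have "pol s t \<bullet> pol r t = exp s * exp r * ((sin t)\<^sup>2 + (cos t)\<^sup>2)"
    unfolding inner_vec2 pol_nth by algebra
  then show "pol s t \<bullet> pol r t = exp s * exp r" by simp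
qed

lemma pol_nonzero [simp]: "pol s t \<noteq> 0"
  using norm_pol[of s t] by (metis exp_not_eq_zero norm_zero)

lemma pol_add_2pi_int: "pol s (t + 2 * pi * of_int n) = pol s t"
  by (simp add: pol_def cos_add sin_add)

lemma pol_eq_iff: "pol s t = pol s' t' \<longleftrightarrow> s = s' \<and> (\<exists>n::int. t = t' + 2 * pi * of_int n)"
proof
  assume e: "pol s t = pol s' t'"
  then have "exp s = exp s'" using norm_pol by metis
  then have s: "s = s'" by simp
  have "cos t = cos t'" "sin t = sin t'"
    using e s pol_nth(1,2)[of s t] pol_nth(1,2)[of s t'] by (metis exp_not_eq_zero mult_left_cancel)+
  then show "s = s' \<and> (\<exists>n::int. t = t' + 2 * pi * of_int n)"
    using s sin_cos_eq_iff[of t t'] by auto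
qed (use pol_add_2pi_int in auto)

lemma pol_exists:
  assumes "x \<noteq> 0"
  obtains t where "0 \<le> t" "t < 2 * pi" "x = pol (ln (norm x)) t"
proof -
  have n: "norm x > 0" using assms by simp
  have "(x $ 1 / norm x)\<^sup>2 + (x $ 2 / norm x)\<^sup>2 = ((x $ 1)\<^sup>2 + (x $ 2)\<^sup>2) / (norm x)\<^sup>2"
    by (simp add: power_divide add_divide_distrib)
  also have "(x $ 1)\<^sup>2 + (x $ 2)\<^sup>2 = (norm x)\<^sup>2" by (simp add: norm_vec2)
  also have "(norm x)\<^sup>2 / (norm x)\<^sup>2 = 1" using n by simp
  finally obtain t where "0 \<le> t" "t < 2 * pi" "x $ 1 / norm x = cos t" "x $ 2 / norm x = sin t"
    using sincos_total_2pi by metis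
  then show ?thesis
    using n by (intro that[of t]) (auto intro!: vec2_eqI simp: field_simps)
qed

lemma periodic_int:
  fixes g :: "real \<Rightarrow> 'a"
  assumes "\<And>t. g (t + 2 * pi) = g t"
  shows "g (t + 2 * pi * of_int n) = g t"
proof (induction n rule: int_induct[where k = 0])
  case (step1 i)
  then show ?case using assms[of "t + 2 * pi * of_int i"] by (simp add: algebra_simps)
next
  case (step2 i)
  then show ?case using assms[of "t + 2 * pi * of_int (i - 1)"] by (simp add: algebra_simps)
qed auto

lemma exists_rep_0_2pi: "\<exists>n::int. t + 2 * pi * of_int n \<in> {0..<2 * pi}"
proof (rule exI[of _ "- \<lfloor>t / (2 * pi)\<rfloor>"])
  have "of_int \<lfloor>t / (2 * pi)\<rfloor> \<le> t / (2 * pi)" "t / (2 * pi) < of_int \<lfloor>t / (2 * pi)\<rfloor> + 1"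
    by linarith+
  moreover have p: "0 < 2 * pi" by simp
  ultimately have "of_int \<lfloor>t / (2 * pi)\<rfloor> * (2 * pi) \<le> t" "t < (of_int \<lfloor>t / (2 * pi)\<rfloor> + 1) * (2 * pi)"
    by (simp_all only: pos_le_divide_eq[OF p] pos_divide_less_eq[OF p])
  then show "t + 2 * pi * of_int (- \<lfloor>t / (2 * pi)\<rfloor>) \<in> {0..<2 * pi}"
    by (simp add: algebra_simps)
qed

lemma vec2_decomp: "(v :: real^2) = v $ 1 *\<^sub>R axis 1 1 + v $ 2 *\<^sub>R axis 2 1"
  by (rule vec2_eqI) (auto simp: axis_def)

lemma pol_decomp: "pol s t = (exp s * cos t) *\<^sub>R axis 1 1 + (exp s * sin t) *\<^sub>R axis 2 1"
  "pol' s t = - (exp s * sin t) *\<^sub>R axis 1 1 + (exp s * cos t) *\<^sub>R axis 2 1"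
  using vec2_decomp[of "pol s t"] vec2_decomp[of "pol' s t"] by simp_all

lemma vector_2_decomp: "(vector [a, b] :: real^2) = a *\<^sub>R axis 1 1 + b *\<^sub>R axis 2 1"
  using vec2_decomp[of "vector [a, b]"] by simp

lemma continuous_on_pol [continuous_intros]:
  fixes A :: "'a::t2_space set"
  shows "continuous_on A f \<Longrightarrow> continuous_on A h \<Longrightarrow> continuous_on A (\<lambda>x. pol (f x) (h x))"
  "continuous_on A f \<Longrightarrow> continuous_on A h \<Longrightarrow> continuous_on A (\<lambda>x. pol' (f x) (h x))"
  unfolding pol_decomp by (auto intro!: continuous_intros)

lemma Basis_real2: "(Basis :: (real^2) set) = {axis 1 1, axis 2 1}"
  by (auto simp: Basis_vec_def UNIV_2)

lemma has_derivative_pol: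
  "((\<lambda>v. pol (v $ 1) (v $ 2)) has_derivative (\<lambda>h. h $ 1 *\<^sub>R pol (v $ 1) (v $ 2) + h $ 2 *\<^sub>R pol' (v $ 1) (v $ 2)))
    (at (v :: real^2) within S)"
proof -
  have c: "((\<lambda>v::real^2. v $ i) has_derivative (\<lambda>h. h $ i)) (at v within S)" for i
    by (rule bounded_linear_imp_has_derivative) (rule bounded_linear_vec_nth)
  show ?thesis
    unfolding pol_decomp
    by (rule derivative_eq_intros c refl)+ (auto intro!: ext vec2_eqI simp: axis_def algebra_simps)
qed

section \<open>Integration in logarithmic polar coordinates\<close>

lemma lborel_real2: "lborel = distr (lborel \<Otimes>\<^sub>M lborel) borel (\<lambda>(t, s). vector [s, t] :: real^2)"
proof (rule lborel_eqI)
  \<comment> \<open>The pair carries the angle first, so that Fubini's theorem leaves the angle as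
    the outer variable and the fiber in \<open>s\<close> inside.\<close>
  let ?V = "\<lambda>(t, s). vector [s, t] :: real^2"
  have Vc: "continuous_on UNIV ?V"
    unfolding case_prod_unfold vector_2_decomp by (intro continuous_intros)
  have V: "?V \<in> borel_measurable (lborel \<Otimes>\<^sub>M lborel)"
    unfolding lborel_prod using borel_measurable_continuous_onI[OF Vc] by simp
  fix l u :: "real^2" assume le: "\<And>b. b \<in> Basis \<Longrightarrow> l \<bullet> b \<le> u \<bullet> b"
  have lu: "l $ 1 \<le> u $ 1" "l $ 2 \<le> u $ 2"
    using le[of "axis 1 1"] le[of "axis 2 1"] by (auto simp: Basis_real2 inner_axis)
  have pre: "?V -` box l u \<inter> space (lborel \<Otimes>\<^sub>M lborel) = box (l $ 2) (u $ 2) \<times> box (l $ 1) (u $ 1)"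
    by (auto simp: mem_box_cart forall_2 space_pair_measure)
  have "emeasure (distr (lborel \<Otimes>\<^sub>M lborel) borel ?V) (box l u) = emeasure (lborel \<Otimes>\<^sub>M lborel) (box (l $ 2) (u $ 2) \<times> box (l $ 1) (u $ 1))"
    by (subst emeasure_distr[OF V]) (auto simp: pre)
  also have "\<dots> = emeasure lborel (box (l $ 2) (u $ 2)) * emeasure lborel (box (l $ 1) (u $ 1))"
    by (rule lborel.emeasure_pair_measure_Times) auto
  also have "\<dots> = ennreal ((u $ 2 - l $ 2) * (u $ 1 - l $ 1))"
    using lu by (simp add: ennreal_mult)
  also have "(u $ 2 - l $ 2) * (u $ 1 - l $ 1) = (\<Prod>b\<in>Basis. (u - l) \<bullet> b)"
    by (simp add: Basis_real2 axis_eq_axis inner_axis)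
  finally show "emeasure (distr (lborel \<Otimes>\<^sub>M lborel) borel ?V) (box l u) = ennreal (\<Prod>b\<in>Basis. (u - l) \<bullet> b)" .
qed simp

definition polar_region :: "(real \<Rightarrow> real) \<Rightarrow> real \<Rightarrow> (real^2) set" where
  "polar_region g m = {pol s t |s t. g t < s \<and> s < m}"

text \<open>The Jacobian determinant of \<open>pol\<close> is \<open>exp (2 * s)\<close>. The change
  of variables takes place on the half-open strip of angles from 0 to \<open>2 * pi\<close>, where
  \<open>pol\<close> is injective, and Fubini's theorem splits the strip into fibers.\<close>

lemma polar_integral:
  fixes K :: "real^2 \<Rightarrow> real"
  assumes g: "continuous_on UNIV g" and per: "\<And>t. g (t + 2 * pi) = g t" and gm: "\<And>t. g t < m"
    and K: "continuous_on {pol s t |s t. g t \<le> s \<and> s \<le> m} K"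
    and Ki: "integrable (lebesgue_on (polar_region g m)) K"
    and \<Omega>: "polar_region g m \<in> sets lebesgue"
  shows "((\<lambda>t. integral {g t..m} (\<lambda>s. exp (2 * s) * K (pol s t))) has_integral
      (LINT x|lebesgue_on (polar_region g m). K x)) {0..2 * pi}"
proof -
  let ?\<Omega> = "polar_region g m"
  define P where "P v = pol (v $ 1) (v $ 2)" for v :: "real^2"
  define S where "S = {v::real^2. 0 \<le> v $ 2 \<and> v $ 2 < 2 * pi \<and> g (v $ 2) < v $ 1 \<and> v $ 1 < m}"
  have gb: "g \<in> borel_measurable borel" using g by (rule borel_measurable_continuous_onI)
  have nth: "(\<lambda>v::real^2. v $ i) \<in> borel_measurable borel" for i
    by (rule borel_measurable_continuous_onI) (intro continuous_intros)
  have gn: "(\<lambda>v::real^2. g (v $ 2)) \<in> borel_measurable borel"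
    using measurable_compose[OF nth gb] .
  have Sb: "S \<in> sets borel"
  proof -
    have "{v \<in> space borel. 0 \<le> v $ 2 \<and> v $ 2 < 2 * pi \<and> g (v $ 2) < v $ 1 \<and> v $ 1 < m} \<in> sets (borel :: (real^2) measure)"
      using nth gn by measurable
    then show ?thesis by (simp add: S_def)
  qed
  have inj: "inj_on P S"
  proof (rule inj_onI)
    fix x y assume xy: "x \<in> S" "y \<in> S" "P x = P y"
    then obtain n :: int where n: "x $ 1 = y $ 1" "x $ 2 = y $ 2 + 2 * pi * of_int n"
      by (auto simp: P_def pol_eq_iff)
    have "\<bar>2 * pi * of_int n\<bar> < 2 * pi * 1" using xy n by (auto simp: S_def)
    then have "\<bar>of_int n :: real\<bar> < 1" by (simp add: abs_mult)
    then have "n = 0" by linarith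
    then show "x = y" using n by (intro vec2_eqI) auto
  qed
  have img: "P ` S = ?\<Omega>"
  proof (intro equalityI subsetI)
    fix x assume "x \<in> P ` S"
    then show "x \<in> ?\<Omega>" by (auto simp: P_def S_def polar_region_def)
  next
    fix x assume "x \<in> ?\<Omega>"
    then obtain s t where st: "x = pol s t" "g t < s" "s < m" by (auto simp: polar_region_def)
    obtain n :: int where n: "t + 2 * pi * of_int n \<in> {0..<2 * pi}" using exists_rep_0_2pi by blast
    have "vector [s, t + 2 * pi * of_int n] \<in> S"
      using n st periodic_int[where g = g, OF per] by (auto simp: S_def)
    moreover have "P (vector [s, t + 2 * pi * of_int n]) = x"
      by (simp add: P_def pol_add_2pi_int st)
    ultimately show "x \<in> P ` S" by (metis image_eqI)
  qed
  have det: "det (matrix (\<lambda>h::real^2. h $ 1 *\<^sub>R pol s t + h $ 2 *\<^sub>R pol' s t)) = exp (2 * s)" for s t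
  proof -
    have "det (matrix (\<lambda>h::real^2. h $ 1 *\<^sub>R pol s t + h $ 2 *\<^sub>R pol' s t))
      = exp s * exp s * ((sin t)\<^sup>2 + (cos t)\<^sup>2)"
      by (simp add: det_2 matrix_def axis_def power2_eq_square algebra_simps
          del: sin_cos_squared_add sin_cos_squared_add2 sin_cos_squared_add3)
    then show ?thesis by (simp add: mult_exp_exp)
  qed
  define G where "G v = indicator S v * (exp (2 * (v $ 1)) * K (P v))" for v
  \<comment> \<open>The integrand is lifted to \<open>real^1\<close>, the form in which the change
    of variables is applied.\<close>
  have vecK: "(\<lambda>x. vec (K x) :: real^1) absolutely_integrable_on ?\<Omega>"
    unfolding absolutely_integrable_on_iff_component[OF \<Omega>]
    using Ki \<Omega> by (simp add: integrable_restrict_space set_integrable_def)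
  have cov: "(\<lambda>v. \<bar>det (matrix (\<lambda>h::real^2. h $ 1 *\<^sub>R pol (v $ 1) (v $ 2) + h $ 2 *\<^sub>R pol' (v $ 1) (v $ 2)))\<bar> *\<^sub>R (vec (K (P v)) :: real^1))
        absolutely_integrable_on S \<and>
      integral S (\<lambda>v. \<bar>det (matrix (\<lambda>h::real^2. h $ 1 *\<^sub>R pol (v $ 1) (v $ 2) + h $ 2 *\<^sub>R pol' (v $ 1) (v $ 2)))\<bar> *\<^sub>R (vec (K (P v)) :: real^1))
        = integral ?\<Omega> (\<lambda>x. vec (K x) :: real^1)"
  proof (subst has_absolute_integral_change_of_variables)
    show "S \<in> sets lebesgue" using Sb by simp
    show "(P has_derivative (\<lambda>h. h $ 1 *\<^sub>R pol (x $ 1) (x $ 2) + h $ 2 *\<^sub>R pol' (x $ 1) (x $ 2))) (at x within S)" for x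
      unfolding P_def by (rule has_derivative_pol)
    show "(\<lambda>x. vec (K x) :: real^1) absolutely_integrable_on P ` S \<and>
        integral (P ` S) (\<lambda>x. vec (K x) :: real^1) = integral ?\<Omega> (\<lambda>x. vec (K x))"
      using vecK by (simp add: img)
  qed (rule inj)
  then have 1: "(\<lambda>v. exp (2 * (v $ 1)) *\<^sub>R (vec (K (P v)) :: real^1)) absolutely_integrable_on S"
    and 2: "integral S (\<lambda>v. exp (2 * (v $ 1)) *\<^sub>R (vec (K (P v)) :: real^1)) = integral ?\<Omega> (\<lambda>x. vec (K x) :: real^1)"
    by (simp_all add: det)
  have HS: "(\<lambda>v. exp (2 * (v $ 1)) * K (P v)) absolutely_integrable_on S"
    using 1 absolutely_integrable_on_iff_component[of S "\<lambda>v. exp (2 * (v $ 1)) *\<^sub>R (vec (K (P v)) :: real^1)"] Sb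
    by simp
  have IS: "integral S (\<lambda>v. exp (2 * (v $ 1)) * K (P v)) = (LINT x|lebesgue_on ?\<Omega>. K x)"
  proof -
    have "integral S (\<lambda>v. exp (2 * (v $ 1)) * K (P v)) = integral S (\<lambda>v. exp (2 * (v $ 1)) *\<^sub>R (vec (K (P v)) :: real^1)) $ 1"
      using integral_component_eq_cart[of "\<lambda>v. exp (2 * (v $ 1)) *\<^sub>R (vec (K (P v)) :: real^1)" S 1]
        set_lebesgue_integral_eq_integral(1)[OF 1] by simp
    also have "\<dots> = integral ?\<Omega> (\<lambda>x. vec (K x) :: real^1) $ 1" by (simp only: 2)
    also have "\<dots> = integral ?\<Omega> K"
      using integral_component_eq_cart[of "\<lambda>x. vec (K x) :: real^1" ?\<Omega> 1]
        set_lebesgue_integral_eq_integral(1)[OF vecK] by simp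
    finally show ?thesis using lebesgue_integral_eq_integral[OF Ki \<Omega>] by simp
  qed
  have Pc: "continuous_on S (\<lambda>v. exp (2 * (v $ 1)) * K (P v))"
  proof (intro continuous_intros continuous_on_compose2[OF K])
    show "continuous_on S P" unfolding P_def by (intro continuous_intros)
    show "P ` S \<subseteq> {pol s t |s t. g t \<le> s \<and> s \<le> m}"
    proof clarify
      fix v assume "v \<in> S"
      then show "\<exists>s t. P v = pol s t \<and> g t \<le> s \<and> s \<le> m"
        by (intro exI[of _ "v $ 1"] exI[of _ "v $ 2"]) (auto simp: P_def S_def)
    qed
  qed
  \<comment> \<open>Borel measurability, rather than Lebesgue measurability, is what lets the
    integral pass to the product measure.\<close>
  have Gb: "G \<in> borel_measurable borel"
    using borel_measurable_continuous_on_indicator[OF Sb Pc] by (simp add: G_def[abs_def])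
  have GL: "integrable lborel G" "(LINT v|lborel. G v) = (LINT x|lebesgue_on ?\<Omega>. K x)"
  proof -
    have "integrable lebesgue G" using HS by (simp add: set_integrable_def G_def[abs_def])
    then show "integrable lborel G" using Gb by (simp add: integrable_completion)
    have "(LINT v|lborel. G v) = (LINT v:S|lebesgue. exp (2 * (v $ 1)) * K (P v))"
      using Gb by (simp add: integral_completion set_lebesgue_integral_def G_def[abs_def])
    also have "\<dots> = integral S (\<lambda>v. exp (2 * (v $ 1)) * K (P v))"
      by (rule set_lebesgue_integral_eq_integral(2)[OF HS])
    finally show "(LINT v|lborel. G v) = (LINT x|lebesgue_on ?\<Omega>. K x)" using IS by simp
  qed
  let ?V = "\<lambda>(t, s). vector [s, t] :: real^2"
  have Vc: "continuous_on UNIV ?V"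
    unfolding case_prod_unfold vector_2_decomp by (intro continuous_intros)
  have V: "?V \<in> borel_measurable (lborel \<Otimes>\<^sub>M lborel)"
    unfolding lborel_prod using borel_measurable_continuous_onI[OF Vc] by simp
  define f where "f p = G (?V p)" for p :: "real \<times> real"
  have fi: "integrable (lborel \<Otimes>\<^sub>M lborel) f"
    using GL(1) integrable_distr_eq[OF V Gb] by (simp add: f_def[abs_def] flip: lborel_real2)
  have fI: "(LINT p|(lborel \<Otimes>\<^sub>M lborel). f p) = (LINT v|lborel. G v)"
    using integral_distr[OF V Gb] by (simp add: f_def[abs_def] flip: lborel_real2)
  define \<phi> where "\<phi> t = (LINT s|lborel. f (t, s))" for t
  have "integrable lborel \<phi>" unfolding \<phi>_def by (rule lborel_pair.integrable_fst'[OF fi])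
  then have "(\<phi> has_integral (LINT t|lborel. \<phi> t)) UNIV" by (rule has_integral_integral_lborel)
  also have "(LINT t|lborel. \<phi> t) = (LINT x|lebesgue_on ?\<Omega>. K x)"
    unfolding \<phi>_def lborel_pair.integral_fst'[OF fi] fI GL(2) ..
  finally have hi: "(\<phi> has_integral (LINT x|lebesgue_on ?\<Omega>. K x)) UNIV" .
  have inner: "\<phi> t = integral {g t..m} (\<lambda>s. exp (2 * s) * K (pol s t))" if t: "t \<in> {0..<2 * pi}" for t
  proof -
    have c: "continuous_on {g t..m} (\<lambda>s. exp (2 * s) * K (pol s t))"
    proof (intro continuous_intros continuous_on_compose2[OF K])
      show "(\<lambda>s. pol s t) ` {g t..m} \<subseteq> {pol s t |s t. g t \<le> s \<and> s \<le> m}"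
      proof clarify
        fix s assume "s \<in> {g t..m}"
        then show "\<exists>s' t'. pol s t = pol s' t' \<and> g t' \<le> s' \<and> s' \<le> m"
          by (intro exI[of _ s] exI[of _ t]) auto
      qed
    qed
    have "set_integrable lborel {g t..m} (\<lambda>s. exp (2 * s) * K (pol s t))"
      by (rule borel_integrable_atLeastAtMost'[OF c])
    then have si: "set_integrable lborel {g t<..<m} (\<lambda>s. exp (2 * s) * K (pol s t))"
      by (rule set_integrable_subset) auto
    have "\<phi> t = (LINT s:{g t<..<m}|lborel. exp (2 * s) * K (pol s t))"
      unfolding \<phi>_def set_lebesgue_integral_def f_def G_def P_def
      by (rule Bochner_Integration.integral_cong) (use t in \<open>auto simp: S_def indicator_def\<close>)
    also have "\<dots> = integral {g t<..<m} (\<lambda>s. exp (2 * s) * K (pol s t))"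
      by (rule set_borel_integral_eq_integral(2)[OF si])
    also have "\<dots> = integral {g t..m} (\<lambda>s. exp (2 * s) * K (pol s t))"
      by (rule integral_open_interval_real[symmetric])
    finally show ?thesis .
  qed
  have outer: "\<phi> t = 0" if "t \<notin> {0..<2 * pi}" for t
    unfolding \<phi>_def f_def G_def using that by (auto simp: S_def indicator_def intro!: integral_eq_zero_AE)
  have "((\<lambda>t. if t \<in> {0..2 * pi} then integral {g t..m} (\<lambda>s. exp (2 * s) * K (pol s t)) else 0) has_integral
      (LINT x|lebesgue_on ?\<Omega>. K x)) UNIV"
    \<comment> \<open>The single angle \<open>2 * pi\<close>, absent from the half-open strip, does
      not affect the outer integral.\<close>
    by (rule has_integral_spike_finite[OF _ _ hi, of "{2 * pi}"]) (use inner outer in auto)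
  then show ?thesis by (simp only: has_integral_restrict_UNIV)
qed

subsection \<open>The zigzag curve\<close>

text \<open>A graph \<open>s(t) < 0\<close> has arc length \<open>exp s * sqrt (1 + s'\<^sup>2) dt\<close>. This equals \<open>dt / (sg * \<bar>s\<bar>)\<close>
  precisely if \<open>1 + s'\<^sup>2 = 1 / (kap s)\<^sup>2\<close>, i.e. \<open>s' = 1 / slp s\<close> up to sign. Hence the angle travelled
  along a tooth, as a function of the height, is an antiderivative \<open>tau\<close> of \<open>slp\<close>.\<close>

definition sg :: real where "sg = exp (- 12) / 12"

definition kap :: "real \<Rightarrow> real" where "kap s = - (sg * s * exp s)"

definition slp :: "real \<Rightarrow> real" where "slp s = kap s / sqrt (1 - (kap s)\<^sup>2)"

lemma sg_bounds: "0 < sg" "sg < 1"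
proof -
  have "exp (- 12 :: real) \<le> 1" by simp
  then have "exp (- 12 :: real) < 12" by linarith
  then show "0 < sg" "sg < 1" by (auto simp: sg_def)
qed

text \<open>\<open>kap s\<close> is the length element \<open>exp s\<close> of the circle divided by
  the prescribed one. Being below 1 it says that every circle inside the unit disc is too short, so
  that a real slope can make up the difference; the bound comes from \<open>- s < exp (- s)\<close>
  and \<open>sg < 1\<close>.\<close>

lemma kap_bounds: "s < 0 \<Longrightarrow> 0 < kap s" "s < 0 \<Longrightarrow> kap s < 1"
proof -
  assume s: "s < 0"
  then show "0 < kap s" using sg_bounds by (simp add: kap_def mult_neg_pos mult_pos_neg)
  have "- s < exp (- s)" using exp_ge_add_one_self[of "- s"] by linarith
  then have "- s * exp s < 1" by (simp add: exp_minus field_simps)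
  moreover have "0 < - s * exp s" using s by (simp add: mult_neg_pos)
  ultimately have "sg * (- s * exp s) < 1" using sg_bounds by (smt (verit) mult_left_le_one_le mult_less_cancel_right2)
  then show "kap s < 1" by (simp add: kap_def)
qed

lemma kap_sq_less: "s < 0 \<Longrightarrow> (kap s)\<^sup>2 < 1"
  using kap_bounds[of s] by (simp add: abs_square_less_1)

lemma slp_pos: "s < 0 \<Longrightarrow> 0 < slp s"
  using kap_bounds[of s] kap_sq_less[of s] by (simp add: slp_def)

lemma one_plus_inverse_slp_sq: "s < 0 \<Longrightarrow> 1 + (1 / slp s)\<^sup>2 = (1 / kap s)\<^sup>2"
  using kap_bounds[of s] kap_sq_less[of s]
  by (simp add: slp_def power_divide field_simps)

lemma smooth_on_slp: "smooth_on {..<0} slp"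
proof -
  have k: "smooth_on {..<0} kap"
    unfolding kap_def
    by (intro smooth_on_minus smooth_on_mult smooth_on_const smooth_on_exp smooth_on_ident open_lessThan)
  have "smooth_on {..<0} (\<lambda>s. sqrt (1 - (kap s)\<^sup>2))"
    by (rule smooth_on_sqrt) (use kap_sq_less in \<open>auto intro!: smooth_on_diff smooth_on_const smooth_on_power k\<close>)
  then have "smooth_on {..<0} (\<lambda>s. kap s / sqrt (1 - (kap s)\<^sup>2))"
    by (intro smooth_on_divide k) (use kap_sq_less in \<open>fastforce+\<close>)
  then show ?thesis by (simp add: slp_def[abs_def])
qed

text \<open>Normalised to vanish at -16. The integration starts at -17 and the function is used up
  to -1, so that the heights -16 and -12 are interior points and the inverse is differentiable there
  too.\<close>

definition tau :: "real \<Rightarrow> real" where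
  "tau s = integral {-17..s} slp - integral {-17..-16} slp"

lemma tau_deriv: "s \<in> {-17<..<-1} \<Longrightarrow> (tau has_field_derivative slp s) (at s)"
proof -
  assume s: "s \<in> {-17<..<-1}"
  have "continuous_on {-17..-1} slp"
    by (rule continuous_on_subset[OF smooth_on_imp_continuous[OF smooth_on_slp]]) auto
  then have "((\<lambda>x. integral {-17..x} slp) has_real_derivative slp s) (at s within {-17..-1})"
    by (rule integral_has_real_derivative) (use s in auto)
  then have "((\<lambda>x. integral {-17..x} slp) has_real_derivative slp s) (at s)"
    using s by (simp add: at_within_Icc_at)
  then have "((\<lambda>x. integral {-17..x} slp - integral {-17..-16} slp) has_real_derivative slp s - 0) (at s)"
    by (intro DERIV_diff DERIV_const)
  then show ?thesis by (simp add: tau_def[abs_def])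
qed

lemma tau_mono:
  assumes "x \<in> {-17<..<-1}" "y \<in> {-17<..<-1}" "x < y"
  shows "tau x < tau y"
proof (rule DERIV_pos_imp_increasing[OF assms(3)])
  fix z assume "x \<le> z" "z \<le> y"
  then have "z \<in> {-17<..<-1}" "z < 0" using assms by auto
  then show "\<exists>D. (tau has_field_derivative D) (at z) \<and> 0 < D" using tau_deriv slp_pos by metis
qed

definition tau_range :: "real set" where "tau_range = tau ` {-17<..<-1}"

definition tau_inv :: "real \<Rightarrow> real" where "tau_inv = the_inv_into {-17<..<-1} tau"

lemma tau_inj: "inj_on tau {-17<..<-1}"
  by (rule linorder_inj_onI) (use tau_mono in force)+

lemma tau_cont: "continuous_on {-17<..<-1} tau"
  by (rule DERIV_continuous_on) (use tau_deriv DERIV_subset in blast)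

lemma tau_inv_tau: "s \<in> {-17<..<-1} \<Longrightarrow> tau_inv (tau s) = s"
  unfolding tau_inv_def by (rule the_inv_into_f_f[OF tau_inj])

lemma tau_inv_mem: "y \<in> tau_range \<Longrightarrow> tau_inv y \<in> {-17<..<-1}"
  and tau_tau_inv: "y \<in> tau_range \<Longrightarrow> tau (tau_inv y) = y"
  using tau_inv_tau by (auto simp: tau_range_def)

lemma open_tau_range: "open tau_range"
  unfolding tau_range_def by (rule invariance_of_domain[OF tau_cont _ tau_inj]) simp

lemma tau_16: "tau (-16) = 0" by (simp add: tau_def)

lemma Icc_tau_range: "{0..tau (-12)} \<subseteq> tau_range"
proof -
  have "connected tau_range" unfolding tau_range_def
    by (intro connected_continuous_image tau_cont) simp
  moreover have "tau (-16) \<in> tau_range" "tau (-12) \<in> tau_range" by (auto simp: tau_range_def)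
  ultimately show ?thesis using connected_contains_Icc tau_16 by metis
qed

lemma tau_12_pos: "0 < tau (-12)"
  using tau_mono[of "-16" "-12"] tau_16 by simp

lemma smooth_on_tau_inv: "smooth_on tau_range tau_inv"
proof (rule smooth_on_inverse_function[where f = tau and S = "{-17<..<-1}" and f' = "\<lambda>s h. slp s * h"
      and A = "\<lambda>s h. h / slp s"])
  show "tau ` {-17<..<-1} = tau_range" by (simp add: tau_range_def)
  fix s :: real assume s: "s \<in> {-17<..<-1}"
  show "(tau has_derivative (\<lambda>h. slp s * h)) (at s)"
    using tau_deriv[OF s] by (simp add: has_field_derivative_def)
  show "tau_inv (tau s) = s" by (rule tau_inv_tau[OF s])
  show "(\<lambda>h. slp s * h) \<circ> (\<lambda>h. h / slp s) = id"
    using slp_pos[of s] s by (auto simp: o_def)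
next
  fix b :: real
  have "slp s \<noteq> 0" if "s \<in> {-17<..<-1}" for s using slp_pos[of s] that by auto
  then show "smooth_on {-17<..<-1} (\<lambda>s. b / slp s)"
    by (intro smooth_on_divide smooth_on_const smooth_on_subset[OF smooth_on_slp]) auto
qed (auto simp: open_tau_range)

lemma tau_inv_deriv:
  assumes y: "y \<in> tau_range"
  shows "(tau_inv has_field_derivative (1 / slp (tau_inv y))) (at y)"
proof -
  have s: "tau_inv y \<in> {-17<..<-1}" by (rule tau_inv_mem[OF y])
  have nz: "slp (tau_inv y) \<noteq> 0" using slp_pos[of "tau_inv y"] s by auto
  have "(tau_inv has_derivative (\<lambda>h. h / slp (tau_inv y))) (at (tau (tau_inv y)))"
  proof (rule has_derivative_inverse_on[where S = "{-17<..<-1}" and f' = "\<lambda>s h. slp s * h"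
        and g' = "\<lambda>s h. h / slp s"])
    show "(tau has_derivative (\<lambda>h. slp x * h)) (at x)" if "x \<in> {-17<..<-1}" for x
      using tau_deriv[OF that] by (simp add: has_field_derivative_def)
  qed (use s nz tau_inv_tau in auto)
  then show ?thesis
    by (simp add: tau_tau_inv[OF y] has_field_derivative_def divide_inverse mult_commute_abs)
qed

lemma tau_inv_bounds:
  assumes y: "y \<in> {0..tau (-12)}"
  shows "tau_inv y \<in> {-16..-12}"
proof -
  have y': "y \<in> tau_range" using y Icc_tau_range by blast
  note s = tau_inv_mem[OF y']
  have "\<not> tau_inv y < -16" using tau_mono[OF s, of "-16"] y tau_tau_inv[OF y'] tau_16 by auto
  moreover have "\<not> -12 < tau_inv y" using tau_mono[OF _ s, of "-12"] y tau_tau_inv[OF y'] by auto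
  ultimately show ?thesis by simp
qed

text \<open>Half a tooth spans the angle \<open>pi / N\<close>, which must not exceed the angle
  \<open>tau (-12)\<close> in which the graph climbs from -16 to -12. The bound on the slopes serves
  twice: as the Lipschitz constant of the zigzag, and to keep the radial coordinate of the
  diffeomorphism increasing.\<close>

lemma exists_teeth:
  "\<exists>N::nat. 0 < N \<and> pi / N \<le> tau (-12) \<and> (\<forall>s\<in>{-16..-12}. 1 / slp s \<le> N)"
proof -
  have c: "continuous_on {-16..-12} (\<lambda>s. 1 / slp s)"
  proof (intro continuous_intros ballI)
    show "continuous_on {-16..-12} slp"
      by (rule continuous_on_subset[OF smooth_on_imp_continuous[OF smooth_on_slp]]) auto
    show "slp s \<noteq> 0" if "s \<in> {-16..-12}" for s using slp_pos[of s] that by auto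
  qed
  obtain B where B: "\<And>s. s \<in> {-16..-12} \<Longrightarrow> norm (1 / slp s) \<le> B"
    using compact_imp_bounded[OF compact_continuous_image[OF c compact_Icc]] unfolding bounded_iff
    by (metis image_eqI)
  obtain N :: nat where N: "max 1 (max B (pi / tau (-12))) < N" using reals_Archimedean2 by blast
  have "pi / tau (-12) < N" using N by simp
  then have "pi / N \<le> tau (-12)" using tau_12_pos N by (simp add: field_simps)
  moreover have "1 / slp s \<le> N" if "s \<in> {-16..-12}" for s
  proof -
    have "1 / slp s \<le> norm (1 / slp s)" by (simp only: real_norm_def abs_ge_self)
    moreover have "B < N" using N by simp
    ultimately show ?thesis using B[OF that] by linarith
  qed
  ultimately show ?thesis using N by (intro exI[of _ N]) auto
qed

definition teeth :: nat where
  "teeth = (SOME N. 0 < N \<and> pi / N \<le> tau (-12) \<and> (\<forall>s\<in>{-16..-12}. 1 / slp s \<le> N))"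

lemma teeth: "0 < teeth" "pi / teeth \<le> tau (-12)" "\<And>s. s \<in> {-16..-12} \<Longrightarrow> 1 / slp s \<le> teeth"
  using someI_ex[OF exists_teeth] unfolding teeth_def[symmetric] by auto

text \<open>The triangle wave with slopes 1 and -1 and range from 0 to \<open>pi / teeth\<close>.
  Composing it with the inverse of \<open>tau\<close> turns these slopes into \<open>1 / slp\<close>
  and \<open>- 1 / slp\<close>.\<close>

definition tri :: "real \<Rightarrow> real" where "tri t = arccos (cos (real teeth * t)) / teeth"

definition zig :: "real \<Rightarrow> real" where "zig t = tau_inv (tri t)"

text \<open>Folding an angle into the interval from 0 to \<open>pi\<close> keeps its cosine and
  replaces its sine by the absolute value. By the addition theorem this can only raise the cosine of
  the difference, hence shrink the difference.\<close>

lemma arccos_cos_Lipschitz: "\<bar>arccos (cos x) - arccos (cos y)\<bar> \<le> \<bar>x - y\<bar>"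
proof (cases "\<bar>x - y\<bar> \<le> pi")
  case True
  define a b where "a = arccos (cos x)" and "b = arccos (cos y)"
  have a: "0 \<le> a" "a \<le> pi" "cos a = cos x" by (auto simp: a_def arccos_lbound arccos_ubound)
  have b: "0 \<le> b" "b \<le> pi" "cos b = cos y" by (auto simp: b_def arccos_lbound arccos_ubound)
  have abs_sin: "sin u = \<bar>sin z\<bar>" if "0 \<le> u" "u \<le> pi" "cos u = cos z" for u z :: real
  proof -
    have "sqrt ((sin u)\<^sup>2) = sqrt ((sin z)\<^sup>2)" using that(3) by (simp add: sin_squared_eq)
    then show ?thesis using sin_ge_zero[OF that(1,2)] by simp
  qed
  have sa: "sin a = \<bar>sin x\<bar>" "sin b = \<bar>sin y\<bar>"
    using abs_sin a b by blast+
  have "cos \<bar>x - y\<bar> = cos x * cos y + sin x * sin y" by (simp add: cos_diff)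
  also have "\<dots> \<le> cos a * cos b + sin a * sin b"
    using abs_ge_self[of "sin x * sin y"] by (simp add: a b sa abs_mult)
  also have "\<dots> = cos \<bar>a - b\<bar>" by (simp add: cos_diff)
  finally have "\<bar>a - b\<bar> \<le> \<bar>x - y\<bar>"
    using cos_mono_le_eq[of "\<bar>x - y\<bar>" "\<bar>a - b\<bar>"] True a b by auto
  then show ?thesis by (simp add: a_def b_def)
next
  case False
  have "0 \<le> arccos (cos x)" "arccos (cos x) \<le> pi" "0 \<le> arccos (cos y)" "arccos (cos y) \<le> pi"
    by (auto simp: arccos_lbound arccos_ubound)
  then show ?thesis using False by linarith
qed

lemma tri_bounds: "tri t \<in> {0..pi / teeth}" "tri t \<in> {0..tau (-12)}"
proof -
  show "tri t \<in> {0..pi / teeth}"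
    using teeth(1) by (auto simp: tri_def arccos_lbound arccos_ubound divide_right_mono)
  then show "tri t \<in> {0..tau (-12)}" using teeth(2) by auto
qed

lemma tri_Lipschitz: "\<bar>tri x - tri y\<bar> \<le> \<bar>x - y\<bar>"
proof -
  have "\<bar>tri x - tri y\<bar> = \<bar>arccos (cos (real teeth * x)) - arccos (cos (real teeth * y))\<bar> / teeth"
    using teeth(1) by (simp add: tri_def abs_divide flip: diff_divide_distrib)
  also have "\<dots> \<le> \<bar>real teeth * x - real teeth * y\<bar> / teeth"
    by (intro divide_right_mono arccos_cos_Lipschitz) simp
  also have "\<dots> = \<bar>x - y\<bar>" using teeth(1) by (simp add: abs_mult flip: right_diff_distrib)
  finally show ?thesis .
qed

lemma tau_inv_Lipschitz:
  assumes "x \<in> {0..tau (-12)}" "y \<in> {0..tau (-12)}"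
  shows "\<bar>tau_inv x - tau_inv y\<bar> \<le> real teeth * \<bar>x - y\<bar>"
proof -
  have "norm (tau_inv x - tau_inv y) \<le> real teeth * norm (x - y)"
  proof (rule field_differentiable_bound[OF _ _ _ assms])
    fix z assume z: "z \<in> {0..tau (-12)}"
    then show "(tau_inv has_field_derivative 1 / slp (tau_inv z)) (at z within {0..tau (-12)})"
      using tau_inv_deriv Icc_tau_range has_field_derivative_at_within by blast
    show "norm (1 / slp (tau_inv z)) \<le> teeth"
      using teeth(3)[OF tau_inv_bounds[OF z]] slp_pos[of "tau_inv z"] tau_inv_bounds[OF z] by auto
  qed auto
  then show ?thesis by simp
qed

lemma zig_bounds: "-16 \<le> zig t" "zig t \<le> -12"
  using tau_inv_bounds[OF tri_bounds(2)[of t]] by (auto simp: zig_def)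

lemma zig_Lipschitz: "\<bar>zig x - zig y\<bar> \<le> real teeth * \<bar>x - y\<bar>"
proof -
  have "\<bar>zig x - zig y\<bar> \<le> real teeth * \<bar>tri x - tri y\<bar>"
    unfolding zig_def by (intro tau_inv_Lipschitz tri_bounds)
  also have "\<dots> \<le> real teeth * \<bar>x - y\<bar>" by (intro mult_left_mono tri_Lipschitz) simp
  finally show ?thesis .
qed

lemma zig_cont: "continuous_on S zig"
  by (rule lipschitz_on_continuous_on[of teeth], rule lipschitz_onI)
    (use zig_Lipschitz in \<open>auto simp: dist_real_def\<close>)

lemma tri_periodic: "tri (t + 2 * pi) = tri t"
proof -
  have "cos (real teeth * (t + 2 * pi)) = cos (real teeth * t + of_nat teeth * (2 * pi))"
    by (simp add: algebra_simps)
  also have "\<dots> = cos (real teeth * t)"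
    using sin_cos_eq_iff[of "real teeth * t + of_nat teeth * (2 * pi)" "real teeth * t"]
    by (metis mult.commute of_int_of_nat_eq)
  finally show ?thesis by (simp add: tri_def)
qed

lemma zig_periodic: "zig (t + 2 * pi) = zig t"
  by (simp add: zig_def tri_periodic)

text \<open>The tips and the valleys of the triangle wave, where \<open>arccos\<close> is taken at 1
  or -1.\<close>

definition corners :: "real set" where "corners = {t. sin (real teeth * t) = 0}"

lemma finite_corners: "finite (corners \<inter> {0..2 * pi})"
proof (rule finite_subset)
  show "corners \<inter> {0..2 * pi} \<subseteq> (\<lambda>i. real_of_int i * pi / teeth) ` {0..2 * int teeth}"
  proof
    fix t assume t: "t \<in> corners \<inter> {0..2 * pi}"
    then obtain i :: int where i: "real teeth * t = of_int i * pi"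
      by (auto simp: corners_def sin_zero_iff_int2)
    then have ti: "t = of_int i * pi / teeth" using teeth(1) by (simp add: field_simps)
    have "0 \<le> of_int i * pi" using t teeth(1) i by (metis Int_iff atLeastAtMost_iff mult_nonneg_nonneg of_nat_0_le_iff)
    then have "0 \<le> i" using pi_gt_zero by (auto simp: zero_le_mult_iff)
    moreover have "of_int i * pi \<le> (2 * teeth) * pi" using t teeth(1) by (simp flip: i)
    then have "i \<le> 2 * int teeth" by (simp add: mult_le_cancel_right)
    ultimately show "t \<in> (\<lambda>i. real_of_int i * pi / teeth) ` {0..2 * int teeth}" using ti by auto
  qed
qed auto

lemma open_noncorners: "open (- corners)"
proof -
  have "closed corners" unfolding corners_def
    by (intro closed_Collect_eq continuous_intros)
  then show ?thesis by (simp add: open_Compl)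
qed

definition zig' :: "real \<Rightarrow> real" where "zig' t = sgn (sin (real teeth * t)) / slp (zig t)"

lemma tri_deriv:
  assumes "t \<notin> corners"
  shows "(tri has_field_derivative sgn (sin (real teeth * t))) (at t)"
proof -
  have s: "sin (real teeth * t) \<noteq> 0" using assms by (simp add: corners_def)
  then have c: "-1 < cos (real teeth * t)" "cos (real teeth * t) < 1"
  proof -
    have "(cos (real teeth * t))\<^sup>2 < 1" using s by (simp add: cos_squared_eq)
    then have "\<bar>cos (real teeth * t)\<bar> < 1" by (simp add: abs_square_less_1)
    then show "-1 < cos (real teeth * t)" "cos (real teeth * t) < 1" by (auto simp: abs_less_iff)
  qed
  have "((\<lambda>t. arccos (cos (real teeth * t)) / teeth) has_field_derivative
      (inverse (- sqrt (1 - (cos (real teeth * t))\<^sup>2)) * (- sin (real teeth * t) * teeth)) / teeth) (at t)"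
    using c by (auto intro!: derivative_eq_intros)
  also have "sqrt (1 - (cos (real teeth * t))\<^sup>2) = \<bar>sin (real teeth * t)\<bar>"
    by (simp flip: sin_squared_eq)
  also have "(inverse (- \<bar>sin (real teeth * t)\<bar>) * (- sin (real teeth * t) * teeth)) / teeth = sgn (sin (real teeth * t))"
    using s teeth(1) by (simp add: sgn_real_def abs_real_def)
  finally show ?thesis by (simp add: tri_def[abs_def])
qed

lemma zig_deriv:
  assumes "t \<notin> corners"
  shows "(zig has_field_derivative zig' t) (at t)"
proof -
  have "tri t \<in> tau_range" using tri_bounds(2) Icc_tau_range by blast
  from DERIV_chain2[OF tau_inv_deriv[OF this] tri_deriv[OF assms]]
  show ?thesis by (simp add: zig_def[abs_def] zig'_def mult.commute)
qed

lemma zig'_cont: "continuous_on (- corners) zig'"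
proof -
  have z: "zig t < 0" for t using zig_bounds(2)[of t] by simp
  have "continuous_on (- corners) (\<lambda>t. slp (zig t))"
    by (rule continuous_on_compose2[OF smooth_on_imp_continuous[OF smooth_on_slp] zig_cont]) (use z in auto)
  moreover have "continuous_on (- corners) (\<lambda>t. sgn (sin (real teeth * t)))"
    by (intro continuous_intros) (auto simp: corners_def)
  ultimately show ?thesis
    unfolding zig'_def using slp_pos[OF z] by (intro continuous_on_divide) (auto simp: less_le)
qed

text \<open>Here the arc length condition becomes exact: \<open>pol\<close> and \<open>pol'\<close>
  are orthogonal vectors of length \<open>exp s\<close>, so the speed is
  \<open>exp s * sqrt (1 + s'\<^sup>2)\<close>, which is \<open>exp s / kap s\<close> for either
  sign of the slope.\<close>

lemma norm_zig_curve_deriv: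
  assumes "t \<notin> corners"
  shows "norm (zig' t *\<^sub>R pol (zig t) t + pol' (zig t) t) = 1 / (sg * (- zig t))"
proof -
  have z: "zig t < 0" using zig_bounds(2)[of t] by simp
  have sq: "(sgn (sin (real teeth * t)))\<^sup>2 = 1" using assms by (auto simp: corners_def sgn_real_def)
  let ?v = "zig' t *\<^sub>R pol (zig t) t + pol' (zig t) t"
  have "(norm ?v)\<^sup>2 = (exp (zig t))\<^sup>2 * (1 + (zig' t)\<^sup>2)"
  proof -
    have i: "pol' (zig t) t \<bullet> pol (zig t) t = 0" "pol' (zig t) t \<bullet> pol' (zig t) t = exp (zig t) * exp (zig t)"
      using pol_inner(1)[of "zig t" t "zig t"] by (simp_all add: inner_commute dot_square_norm power2_eq_square)
    show ?thesis
      unfolding power2_norm_eq_inner inner_add_left inner_add_right inner_scaleR_left inner_scaleR_right pol_inner i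
      by algebra
  qed
  also have "(zig' t)\<^sup>2 = (1 / slp (zig t))\<^sup>2" by (simp add: zig'_def power_divide sq)
  also have "1 + (1 / slp (zig t))\<^sup>2 = (1 / kap (zig t))\<^sup>2" by (rule one_plus_inverse_slp_sq[OF z])
  finally have "(norm ?v)\<^sup>2 = (exp (zig t) / kap (zig t))\<^sup>2" by (simp add: power_divide)
  then have "norm ?v = exp (zig t) / kap (zig t)"
    using kap_bounds(1)[OF z] by (simp add: power2_eq_iff_nonneg)
  then show ?thesis by (simp add: kap_def)
qed

lemma zig_curve_deriv:
  assumes "t \<notin> corners"
  shows "((\<lambda>t. pol (zig t) t) has_vector_derivative (zig' t *\<^sub>R pol (zig t) t + pol' (zig t) t)) (at t)"
proof -
  have z: "(zig has_derivative (\<lambda>h. zig' t * h)) (at t)"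
    using zig_deriv[OF assms] by (simp add: has_field_derivative_def)
  have v: "((\<lambda>t. vector [zig t, t] :: real^2) has_derivative (\<lambda>h. vector [zig' t * h, h])) (at t)"
    unfolding vector_2_decomp
    by (rule derivative_eq_intros z refl)+ simp
  have "((\<lambda>t. pol ((vector [zig t, t] :: real^2) $ 1) ((vector [zig t, t] :: real^2) $ 2)) has_derivative
     (\<lambda>h. (vector [zig' t * h, h] :: real^2) $ 1 *\<^sub>R pol ((vector [zig t, t] :: real^2) $ 1) ((vector [zig t, t] :: real^2) $ 2)
        + (vector [zig' t * h, h] :: real^2) $ 2 *\<^sub>R pol' ((vector [zig t, t] :: real^2) $ 1) ((vector [zig t, t] :: real^2) $ 2))) (at t)"
    by (rule has_derivative_compose[OF v has_derivative_pol])
  then show ?thesis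
    unfolding has_vector_derivative_def by (simp add: algebra_simps scaleR_add_right)
qed

subsection \<open>Topology of polar regions\<close>

definition polar_closure :: "(real \<Rightarrow> real) \<Rightarrow> real \<Rightarrow> (real^2) set" where
  "polar_closure g m = {pol s t |s t. g t \<le> s \<and> s \<le> m}"

definition polar_curve :: "(real \<Rightarrow> real) \<Rightarrow> real \<Rightarrow> real^2" where
  "polar_curve g t = pol (g (2 * pi * t)) (2 * pi * t)"

lemma pol_inj_strip: "inj_on (\<lambda>v::real^2. pol (v $ 1) (v $ 2)) {v. \<bar>v $ 2 - t\<bar> < pi}"
proof (rule inj_onI)
  fix x y assume xy: "x \<in> {v::real^2. \<bar>v $ 2 - t\<bar> < pi}" "y \<in> {v::real^2. \<bar>v $ 2 - t\<bar> < pi}"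
    "pol (x $ 1) (x $ 2) = pol (y $ 1) (y $ 2)"
  then obtain n :: int where n: "x $ 1 = y $ 1" "x $ 2 = y $ 2 + 2 * pi * of_int n"
    by (auto simp: pol_eq_iff)
  have "\<bar>2 * pi * of_int n\<bar> < 2 * pi * 1" using xy(1,2) n(2) by simp
  then have "\<bar>of_int n :: real\<bar> < 1" by (simp add: abs_mult)
  then have "n = 0" by linarith
  then show "x = y" using n by (intro vec2_eqI) auto
qed

text \<open>A connected subset of the union of two disjoint closed sets lies in one of them, so the
  two sets are themselves maximal.\<close>

lemma components_two_closed:
  fixes A B :: "'a::topological_space set"
  assumes "closed A" "closed B" "connected A" "connected B" "A \<noteq> {}" "B \<noteq> {}" "A \<inter> B = {}"
  shows "components (A \<union> B) = {A, B}"
proof -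
  have sub: "C \<subseteq> A \<or> C \<subseteq> B" if C: "connected C" "C \<subseteq> A \<union> B" for C
  proof (rule ccontr)
    assume n: "\<not> (C \<subseteq> A \<or> C \<subseteq> B)"
    have "A \<inter> B \<inter> C = {}" "A \<inter> C \<noteq> {}" "B \<inter> C \<noteq> {}" using assms(7) n C(2) by blast+
    then show False using connected_closedD[OF C(1) _ C(2) assms(1,2)] by blast
  qed
  show ?thesis
  proof (intro equalityI subsetI)
    fix C assume "C \<in> components (A \<union> B)"
    then have C: "C \<noteq> {}" "C \<subseteq> A \<union> B" "connected C"
      "\<And>D. D \<noteq> {} \<Longrightarrow> C \<subseteq> D \<Longrightarrow> D \<subseteq> A \<union> B \<Longrightarrow> connected D \<Longrightarrow> D = C"
      by (auto simp: in_components_maximal)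
    show "C \<in> {A, B}"
      using sub[OF C(3,2)] C(4)[of A] C(4)[of B] assms by auto
  next
    fix C assume "C \<in> {A, B}"
    moreover have "D = A" if "A \<subseteq> D" "D \<subseteq> A \<union> B" "connected D" for D
      using sub[OF that(3,2)] that assms by auto
    moreover have "D = B" if "B \<subseteq> D" "D \<subseteq> A \<union> B" "connected D" for D
      using sub[OF that(3,2)] that assms by auto
    ultimately show "C \<in> components (A \<union> B)"
      unfolding in_components_maximal using assms by auto
  qed
qed

context
  fixes g :: "real \<Rightarrow> real" and m :: real
  assumes g: "continuous_on UNIV g" and per: "\<And>t. g (t + 2 * pi) = g t" and gm: "\<And>t. g t < m"
begin

lemma continuous_on_radius [continuous_intros]: "continuous_on A h \<Longrightarrow> continuous_on A (\<lambda>x. g (h x))"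
  by (rule continuous_on_compose2[OF g]) auto

lemma pol_mem_polar_region: "pol s t \<in> polar_region g m \<longleftrightarrow> g t < s \<and> s < m"
proof
  assume "pol s t \<in> polar_region g m"
  then obtain s' t' where "pol s t = pol s' t'" "g t' < s'" "s' < m" by (auto simp: polar_region_def)
  then show "g t < s \<and> s < m" using periodic_int[where g = g, OF per] by (auto simp: pol_eq_iff)
qed (auto simp: polar_region_def)

lemma pol_mem_polar_closure: "pol s t \<in> polar_closure g m \<longleftrightarrow> g t \<le> s \<and> s \<le> m"
proof
  assume "pol s t \<in> polar_closure g m"
  then obtain s' t' where "pol s t = pol s' t'" "g t' \<le> s'" "s' \<le> m" by (auto simp: polar_closure_def)
  then show "g t \<le> s \<and> s \<le> m" using periodic_int[where g = g, OF per] by (auto simp: pol_eq_iff)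
qed (auto simp: polar_closure_def)

lemma polar_closure_image:
  "polar_closure g m = (\<lambda>(c, t). pol ((1 - c) * g t + c * m) t) ` ({0..1} \<times> {0..2 * pi})"
proof (intro equalityI subsetI)
  fix x assume "x \<in> polar_closure g m"
  then obtain s t where st: "x = pol s t" "g t \<le> s" "s \<le> m" by (auto simp: polar_closure_def)
  obtain n :: int where n: "t + 2 * pi * of_int n \<in> {0..<2 * pi}" using exists_rep_0_2pi by blast
  define t' where "t' = t + 2 * pi * of_int n"
  define c where "c = (s - g t) / (m - g t)"
  have "g t' = g t" unfolding t'_def by (rule periodic_int[where g = g, OF per])
  moreover have "(1 - c) * g t + c * m = s"
  proof -
    have "(1 - c) * g t + c * m = g t + c * (m - g t)" by (simp add: algebra_simps)
    then show ?thesis using gm[of t] by (simp add: c_def)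
  qed
  moreover have "c \<in> {0..1}" using st gm[of t] by (auto simp: c_def)
  moreover have "t' \<in> {0..2 * pi}" using n by (auto simp: t'_def)
  moreover have "x = pol s t'" unfolding t'_def pol_add_2pi_int by (rule st)
  ultimately show "x \<in> (\<lambda>(c, t). pol ((1 - c) * g t + c * m) t) ` ({0..1} \<times> {0..2 * pi})"
    by (intro image_eqI[of _ _ "(c, t')"]) auto
next
  fix x assume "x \<in> (\<lambda>(c, t). pol ((1 - c) * g t + c * m) t) ` ({0..1} \<times> {0..2 * pi})"
  then obtain c t where ct: "c \<in> {0..1}" "x = pol ((1 - c) * g t + c * m) t" by auto
  have "0 \<le> c * (m - g t)" "0 \<le> (1 - c) * (m - g t)"
    using ct gm[of t] by (auto intro!: mult_nonneg_nonneg)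
  then show "x \<in> polar_closure g m" unfolding ct(2) pol_mem_polar_closure by (simp add: algebra_simps)
qed

lemma compact_polar_closure: "compact (polar_closure g m)"
  unfolding polar_closure_image
  by (intro compact_continuous_image compact_Times compact_Icc)
    (auto simp: case_prod_unfold intro!: continuous_intros)

lemma polar_region_subset_closure: "polar_region g m \<subseteq> polar_closure g m"
proof
  fix x assume "x \<in> polar_region g m"
  then obtain s t where "x = pol s t" "g t < s" "s < m" by (auto simp: polar_region_def)
  then show "x \<in> polar_closure g m" by (simp add: pol_mem_polar_closure)
qed

text \<open>Around each of its points the region contains the injective continuous image of an open
  part of a strip of width \<open>2 * pi\<close>, which is open by invariance of domain.\<close>

lemma open_polar_region: "open (polar_region g m)"
proof (subst open_subopen, intro ballI)
  fix x assume "x \<in> polar_region g m"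
  then obtain s t where st: "x = pol s t" "g t < s" "s < m" by (auto simp: polar_region_def)
  define S where "S = {v::real^2. \<bar>v $ 2 - t\<bar> < pi} \<inter> {v. g (v $ 2) < v $ 1} \<inter> {v. v $ 1 < m}"
  have "open S" unfolding S_def
    by (intro open_Int open_Collect_less continuous_intros)
  moreover have "inj_on (\<lambda>v::real^2. pol (v $ 1) (v $ 2)) S"
    by (rule inj_on_subset[OF pol_inj_strip[of t]]) (auto simp: S_def)
  moreover have "continuous_on S (\<lambda>v::real^2. pol (v $ 1) (v $ 2))" by (intro continuous_intros)
  ultimately have "open ((\<lambda>v::real^2. pol (v $ 1) (v $ 2)) ` S)" by (intro invariance_of_domain)
  moreover have "x \<in> (\<lambda>v::real^2. pol (v $ 1) (v $ 2)) ` S"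
    by (rule image_eqI[of _ _ "vector [s, t]"]) (use st in \<open>auto simp: S_def\<close>)
  moreover have "(\<lambda>v::real^2. pol (v $ 1) (v $ 2)) ` S \<subseteq> polar_region g m"
    by (auto simp: S_def polar_region_def)
  ultimately show "\<exists>T. open T \<and> x \<in> T \<and> T \<subseteq> polar_region g m" by blast
qed

lemma closure_polar_region: "closure (polar_region g m) = polar_closure g m"
proof
  show "closure (polar_region g m) \<subseteq> polar_closure g m"
    by (intro closure_minimal polar_region_subset_closure compact_imp_closed compact_polar_closure)
  show "polar_closure g m \<subseteq> closure (polar_region g m)"
  proof
    fix x assume "x \<in> polar_closure g m"
    then obtain s t where st: "x = pol s t" "g t \<le> s" "s \<le> m" by (auto simp: polar_closure_def)
    have "(\<lambda>s. pol s t) ` closure {g t<..<m} \<subseteq> closure (polar_region g m)"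
    proof (rule image_closure_subset)
      show "(\<lambda>s. pol s t) ` {g t<..<m} \<subseteq> closure (polar_region g m)"
      proof clarify
        fix s assume "s \<in> {g t<..<m}"
        then have "pol s t \<in> polar_region g m" by (simp add: pol_mem_polar_region)
        then show "pol s t \<in> closure (polar_region g m)" using closure_subset by blast
      qed
    qed (auto intro!: continuous_intros)
    then show "x \<in> closure (polar_region g m)"
      using gm[of t] st by (auto simp: closure_greaterThanLessThan)
  qed
qed

lemma bounded_polar_region: "bounded (polar_region g m)"
  using compact_polar_closure compact_imp_bounded bounded_subset polar_region_subset_closure by blast

lemma polar_region_nonempty: "polar_region g m \<noteq> {}"
  using pol_mem_polar_region[of "(g 0 + m) / 2" 0] gm[of 0] by (auto simp: field_simps)

lemma connected_polar_region: "connected (polar_region g m)"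
proof -
  have "polar_region g m = (\<lambda>(c, t). pol ((1 - c) * g t + c * m) t) ` ({0<..<1} \<times> UNIV)"
  proof (intro equalityI subsetI)
    fix x assume "x \<in> polar_region g m"
    then obtain s t where st: "x = pol s t" "g t < s" "s < m" by (auto simp: polar_region_def)
    define c where "c = (s - g t) / (m - g t)"
    have "(1 - c) * g t + c * m = g t + c * (m - g t)" by (simp add: algebra_simps)
    then have "(1 - c) * g t + c * m = s" using gm[of t] by (simp add: c_def)
    moreover have "c \<in> {0<..<1}" using st gm[of t] by (auto simp: c_def)
    ultimately show "x \<in> (\<lambda>(c, t). pol ((1 - c) * g t + c * m) t) ` ({0<..<1} \<times> UNIV)"
      using st by (intro image_eqI[of _ _ "(c, t)"]) auto
  next
    fix x assume "x \<in> (\<lambda>(c, t). pol ((1 - c) * g t + c * m) t) ` ({0<..<1} \<times> UNIV)"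
    then obtain c t where ct: "c \<in> {0<..<1}" "x = pol ((1 - c) * g t + c * m) t" by auto
    have "0 < c * (m - g t)" "0 < (1 - c) * (m - g t)"
      using ct gm[of t] by (auto intro!: mult_pos_pos)
    then show "x \<in> polar_region g m" unfolding ct(2) pol_mem_polar_region by (simp add: algebra_simps)
  qed
  then show ?thesis
    by (simp only:) (intro connected_continuous_image connected_Times connected_Ioo connected_UNIV,
      auto simp: case_prod_unfold intro!: continuous_intros)
qed

lemma bounded_domain_polar_region: "bounded_domain (polar_region g m)"
  using bounded_polar_region open_polar_region connected_polar_region polar_region_nonempty
  by (simp add: bounded_domain_def)

lemma polar_curve_image:
  assumes h: "\<And>t. h (t + 2 * pi) = (h t :: real)"
  shows "path_image (polar_curve h) = {pol (h t) t |t. True}"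
    and "(\<lambda>t. pol (h t) t) ` {0..2 * pi} = {pol (h t) t |t. True}"
proof -
  show 1: "(\<lambda>t. pol (h t) t) ` {0..2 * pi} = {pol (h t) t |t. True}"
  proof (intro equalityI subsetI)
    fix x assume "x \<in> {pol (h t) t |t. True}"
    then obtain t where t: "x = pol (h t) t" by auto
    obtain n :: int where n: "t + 2 * pi * of_int n \<in> {0..<2 * pi}" using exists_rep_0_2pi by blast
    have "x = pol (h (t + 2 * pi * of_int n)) (t + 2 * pi * of_int n)"
      unfolding periodic_int[where g = h, OF h] pol_add_2pi_int by (rule t)
    then show "x \<in> (\<lambda>t. pol (h t) t) ` {0..2 * pi}"
      using n by (intro image_eqI[of _ _ "t + 2 * pi * of_int n"]) auto
  qed auto
  have "path_image (polar_curve h) = (\<lambda>t. pol (h t) t) ` ((\<lambda>t. 2 * pi * t) ` {0..1})"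
    unfolding path_image_def polar_curve_def[abs_def] image_image ..
  also have "(\<lambda>t. 2 * pi * t) ` {0..1} = {0..2 * pi}"
    using image_mult_atLeastAtMost[of "2 * pi" 0 1] by simp
  finally show "path_image (polar_curve h) = {pol (h t) t |t. True}" using 1 by simp
qed

lemma inj_on_polar_curve: "inj_on (\<lambda>t. pol (h t) t) {0..<2 * pi}"
proof (rule inj_onI)
  fix x y assume xy: "x \<in> {0..<2 * pi}" "y \<in> {0..<2 * pi}" "pol (h x) x = pol (h y) y"
  then obtain n :: int where n: "x = y + 2 * pi * of_int n" by (auto simp: pol_eq_iff)
  have "\<bar>2 * pi * of_int n\<bar> < 2 * pi * 1" using xy(1,2) n by auto
  then have "\<bar>of_int n :: real\<bar> < 1" by (simp add: abs_mult)
  then have "n = 0" by linarith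
  then show "x = y" using n by simp
qed

lemma simple_closed_polar_curve:
  assumes h: "\<And>t. h (t + 2 * pi) = (h t :: real)" "continuous_on UNIV h"
  shows "simple_closed_curve (polar_curve h)"
proof -
  have hc: "continuous_on A (\<lambda>t. h (f t))" if "continuous_on A f" for A :: "real set" and f
    by (rule continuous_on_compose2[OF h(2) that]) auto
  have fin: "polar_curve h 1 = polar_curve h 0"
    using h(1)[of 0] pol_add_2pi_int[of "h 0" 0 1] by (simp add: polar_curve_def)
  have "path (polar_curve h)"
    unfolding path_def polar_curve_def[abs_def] by (intro continuous_intros hc)
  moreover have "loop_free (polar_curve h)"
    unfolding loop_free_def
  proof (intro ballI impI)
    fix x y :: real assume xy: "x \<in> {0..1}" "y \<in> {0..1}" "polar_curve h x = polar_curve h y"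
    have inj: "p = q" if "p \<in> {0..<1}" "q \<in> {0..<1}" "polar_curve h p = polar_curve h q" for p q :: real
      using inj_onD[OF inj_on_polar_curve, of h "2 * pi * p" "2 * pi * q"] that
      by (auto simp: polar_curve_def)
    show "x = y \<or> x = 0 \<and> y = 1 \<or> x = 1 \<and> y = 0"
    proof (cases "x = 1"; cases "y = 1")
      assume "x = 1" "y \<noteq> 1"
      then show ?thesis using inj[of 0 y] xy fin by auto
    next
      assume "x \<noteq> 1" "y = 1"
      then show ?thesis using inj[of x 0] xy fin by auto
    next
      assume "x \<noteq> 1" "y \<noteq> 1"
      then show ?thesis using inj[of x y] xy by auto
    qed simp
  qed
  ultimately show ?thesis
    using fin by (simp add: simple_closed_curve_def simple_path_def pathfinish_def pathstart_def)
qed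

text \<open>The homotopy moves every point along its ray by interpolating the logarithm of the
  radius; the closed region contains the segment of \<open>s\<close> between two admissible
  values.\<close>

lemma homotopic_polar_curves:
  assumes h: "\<And>t. h (t + 2 * pi) = h t" "continuous_on UNIV h" "\<And>t. g t \<le> h t \<and> h t \<le> m"
    and k: "\<And>t. k (t + 2 * pi) = k t" "continuous_on UNIV k" "\<And>t. g t \<le> k t \<and> k t \<le> m"
  shows "homotopic_loops (closure (polar_region g m)) (polar_curve h) (polar_curve k)"
proof -
  have hc: "continuous_on A (\<lambda>t. h (f t))" if "continuous_on A f" for A :: "(real \<times> real) set" and f
    by (rule continuous_on_compose2[OF h(2) that]) auto
  have kc: "continuous_on A (\<lambda>t. k (f t))" if "continuous_on A f" for A :: "(real \<times> real) set" and f
    by (rule continuous_on_compose2[OF k(2) that]) auto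
  define H where "H p = pol ((1 - fst p) * h (2 * pi * snd p) + fst p * k (2 * pi * snd p)) (2 * pi * snd p)"
    for p :: "real \<times> real"
  show ?thesis unfolding homotopic_loops
  proof (intro exI[of _ H] conjI ballI)
    show "continuous_on ({0..1} \<times> {0..1}) H"
      unfolding H_def by (intro continuous_intros hc kc)
    show "H \<in> ({0..1} \<times> {0..1}) \<rightarrow> closure (polar_region g m)"
    proof (rule Pi_I)
      fix p :: "real \<times> real" assume "p \<in> {0..1} \<times> {0..1}"
      then obtain c t where ct: "c \<in> {0..1}" "p = (c, t)" by auto
      let ?t = "2 * pi * t"
      have "(1 - c) * g ?t + c * g ?t \<le> (1 - c) * h ?t + c * k ?t"
        "(1 - c) * h ?t + c * k ?t \<le> (1 - c) * m + c * m"
        using ct(1) h(3)[of ?t] k(3)[of ?t] by (intro add_mono mult_left_mono; simp)+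
      then show "H p \<in> closure (polar_region g m)"
        unfolding closure_polar_region ct(2) H_def fst_conv snd_conv pol_mem_polar_closure
        by (simp add: algebra_simps)
    qed
    fix c :: real assume "c \<in> {0..1}"
    show "pathfinish (H \<circ> Pair c) = pathstart (H \<circ> Pair c)"
      using h(1)[of 0] k(1)[of 0] pol_add_2pi_int[of _ 0 1]
      by (simp add: pathfinish_def pathstart_def H_def)
  qed (auto simp: H_def polar_curve_def)
qed

lemma frontier_polar_region:
  "frontier (polar_region g m) = (\<lambda>t. pol (g t) t) ` {0..2 * pi} \<union> (\<lambda>t. pol m t) ` {0..2 * pi}"
proof -
  have "frontier (polar_region g m) = polar_closure g m - polar_region g m"
    by (simp add: frontier_def closure_polar_region interior_open open_polar_region)
  also have "\<dots> = {pol (g t) t |t. True} \<union> {pol m t |t. True}"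
  proof (intro equalityI subsetI)
    fix x assume "x \<in> polar_closure g m - polar_region g m"
    then obtain s t where st: "x = pol s t" "pol s t \<in> polar_closure g m" "pol s t \<notin> polar_region g m"
      by (auto simp: polar_closure_def)
    then have "g t \<le> s" "s \<le> m" "\<not> (g t < s \<and> s < m)"
      by (simp_all add: pol_mem_polar_closure pol_mem_polar_region)
    with st(1) show "x \<in> {pol (g t) t |t. True} \<union> {pol m t |t. True}" by force
  next
    fix x assume "x \<in> {pol (g t) t |t. True} \<union> {pol m t |t. True}"
    then show "x \<in> polar_closure g m - polar_region g m"
      using gm by (auto simp: pol_mem_polar_closure pol_mem_polar_region less_imp_le)
  qed
  finally show ?thesis
    using polar_curve_image(2)[of g, OF per] polar_curve_image(2)[of "\<lambda>_. m"] by simp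
qed

lemma disjoint_boundary_curves:
  "(\<lambda>t. pol (g t) t) ` {0..2 * pi} \<inter> (\<lambda>t. pol m t) ` {0..2 * pi} = {}"
  using gm by (auto simp: pol_eq_iff less_le)

lemma components_frontier_polar_region:
  "components (frontier (polar_region g m)) = {path_image (polar_curve g), path_image (polar_curve (\<lambda>_. m))}"
  "card (components (frontier (polar_region g m))) = 2"
proof -
  let ?A = "(\<lambda>t. pol (g t) t) ` {0..2 * pi}" and ?B = "(\<lambda>t. pol m t) ` {0..2 * pi}"
  have AB: "path_image (polar_curve g) = ?A" "path_image (polar_curve (\<lambda>_. m)) = ?B"
    using polar_curve_image[of g, OF per] polar_curve_image[of "\<lambda>_. m"] by simp_all
  have "compact ?A" "compact ?B" "connected ?A" "connected ?B"
    by (auto intro!: compact_continuous_image connected_continuous_image continuous_intros)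
  then have c: "components (?A \<union> ?B) = {?A, ?B}"
    by (intro components_two_closed disjoint_boundary_curves) (auto intro: compact_imp_closed)
  then show "components (frontier (polar_region g m)) = {path_image (polar_curve g), path_image (polar_curve (\<lambda>_. m))}"
    by (simp only: frontier_polar_region AB)
  have "?A \<noteq> ?B" using disjoint_boundary_curves by auto
  then show "card (components (frontier (polar_region g m))) = 2"
    by (simp only: frontier_polar_region c) simp
qed

lemma homotopic_to_boundary_components_polar_curve:
  assumes h: "\<And>t. h (t + 2 * pi) = h t" "continuous_on UNIV h" "\<And>t. g t \<le> h t \<and> h t \<le> m"
  shows "homotopic_to_boundary_components (polar_region g m) (polar_curve h)"
  unfolding homotopic_to_boundary_components_def components_frontier_polar_region(1)
proof
  have gm': "g t \<le> g t \<and> g t \<le> m" "g t \<le> m \<and> m \<le> m" for t using gm[of t] by auto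
  fix K assume "K \<in> {path_image (polar_curve g), path_image (polar_curve (\<lambda>_. m))}"
  then consider "K = path_image (polar_curve g)" | "K = path_image (polar_curve (\<lambda>_. m))" by blast
  then show "\<exists>c. simple_closed_curve c \<and> path_image c = K \<and>
      homotopic_loops (closure (polar_region g m)) (polar_curve h) c"
  proof cases
    case 1
    then show ?thesis
      using simple_closed_polar_curve[of g, OF per g] homotopic_polar_curves[of h g, OF h per g gm'(1)]
      by (intro exI[of _ "polar_curve g"]) simp
  next
    case 2
    then show ?thesis
      using simple_closed_polar_curve[of "\<lambda>_. m"] homotopic_polar_curves[of h "\<lambda>_. m", OF h _ _ gm'(2)]
      by (intro exI[of _ "polar_curve (\<lambda>_. m)"]) simp
  qed
qed

end

declare continuous_on_radius [continuous_intros del]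

subsection \<open>Lipschitz boundary\<close>

text \<open>The graph function is the lower envelope of the cones with vertices in \<open>S\<close>.\<close>

lemma lipschitz_graph_of_cone_condition:
  fixes S :: "'a::euclidean_space set"
  assumes S: "open S" and ne: "S \<inter> ball p r \<noteq> {}" and e: "norm e = 1" and L: "0 \<le> L"
    and cone: "\<And>x y. x \<in> ball p r \<Longrightarrow> y \<in> S \<Longrightarrow> y \<in> ball p r \<Longrightarrow>
        L * norm ((x - y) - ((x - y) \<bullet> e) *\<^sub>R e) < (x - y) \<bullet> e \<Longrightarrow> x \<in> S"
  shows "\<exists>g. L-lipschitz_on {z. z \<bullet> e = 0} g \<and>
      S \<inter> ball p r = {x \<in> ball p r. x \<bullet> e > g (x - (x \<bullet> e) *\<^sub>R e)}"
proof -
  define Y where "Y = S \<inter> ball p r"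
  define \<pi> where "\<pi> x = x - (x \<bullet> e) *\<^sub>R e" for x
  define v where "v z y = y \<bullet> e + L * norm (z - \<pi> y)" for z y
  define g where "g z = (INF y\<in>Y. v z y)" for z
  have Y: "Y \<noteq> {}" using ne by (simp add: Y_def)
  have bdd: "bdd_below (v z ` Y)" for z
  proof (rule bdd_belowI2[of _ "p \<bullet> e - r"])
    fix y assume "y \<in> Y"
    then have "norm (p - y) < r" by (simp add: Y_def dist_norm)
    moreover have "(p - y) \<bullet> e \<le> norm (p - y)" using Cauchy_Schwarz_ineq2[of "p - y" e] e by simp
    moreover have "0 \<le> L * norm (z - \<pi> y)" using L by simp
    ultimately show "p \<bullet> e - r \<le> v z y" by (simp add: v_def inner_diff_left)
  qed
  have gle: "g z \<le> g w + L * norm (z - w)" for z w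
  proof -
    have "g z - L * norm (z - w) \<le> g w"
      unfolding g_def[of w]
    proof (rule cINF_greatest[OF Y])
      fix y assume y: "y \<in> Y"
      have "g z \<le> v z y" unfolding g_def by (rule cINF_lower[OF bdd y])
      also have "\<dots> \<le> v w y + L * norm (z - w)"
        using mult_left_mono[OF norm_triangle_ineq[of "z - w" "w - \<pi> y"] L]
        by (simp add: v_def algebra_simps)
      finally show "g z - L * norm (z - w) \<le> v w y" by simp
    qed
    then show ?thesis by simp
  qed
  have "L-lipschitz_on {z. z \<bullet> e = 0} g"
  proof (rule lipschitz_onI)
    fix z w
    show "dist (g z) (g w) \<le> L * dist z w"
      using gle[of z w] gle[of w z] by (simp add: dist_real_def dist_norm norm_minus_commute abs_le_iff)
  qed (rule L)
  moreover have "x \<bullet> e > g (\<pi> x)" if x: "x \<in> Y" for x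
  proof -
    \<comment> \<open>Going down a little along \<open>e\<close> stays in the open set and keeps the
      projection, which turns the weak inequality with the infimum into a strict one.\<close>
    obtain d where d: "d > 0" "ball x d \<subseteq> Y"
      using x S open_Int[OF S open_ball] by (metis Y_def open_contains_ball)
    have y: "x - (d/2) *\<^sub>R e \<in> Y" using d e by (intro subsetD[OF d(2)]) (simp add: dist_norm)
    have "\<pi> (x - (d/2) *\<^sub>R e) = \<pi> x"
      using e by (simp add: \<pi>_def inner_diff_left algebra_simps dot_square_norm)
    then have "v (\<pi> x) (x - (d/2) *\<^sub>R e) = x \<bullet> e - d/2"
      using e by (simp add: v_def inner_diff_left dot_square_norm)
    moreover have "g (\<pi> x) \<le> v (\<pi> x) (x - (d/2) *\<^sub>R e)" unfolding g_def by (rule cINF_lower[OF bdd y])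
    ultimately show ?thesis using d(1) by simp
  qed
  moreover have "x \<in> Y" if x: "x \<in> ball p r" "x \<bullet> e > g (\<pi> x)" for x
  proof -
    obtain y where y: "y \<in> Y" "v (\<pi> x) y < x \<bullet> e"
      using x(2) cINF_less_iff[OF Y bdd] by (auto simp: g_def)
    have "\<pi> x - \<pi> y = (x - y) - ((x - y) \<bullet> e) *\<^sub>R e" by (simp add: \<pi>_def inner_diff_left algebra_simps)
    then have "L * norm ((x - y) - ((x - y) \<bullet> e) *\<^sub>R e) < (x - y) \<bullet> e"
      using y(2) by (simp add: v_def inner_diff_left)
    then have "x \<in> S" using cone[OF x(1), of y] y(1) by (simp add: Y_def)
    then show ?thesis using x(1) by (simp add: Y_def)
  qed
  ultimately show ?thesis unfolding Y_def \<pi>_def by (intro exI[of _ g]) blast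
qed

text \<open>Here \<open>a\<close> and \<open>b\<close> are the components of a point along and
  across a fixed direction. Close to that direction, a step inside the narrow cone with constant
  \<open>L\<close> raises the logarithm of the radius by more than \<Lambda> times the change of the
  angle. This is what carries a Lipschitz graph in \<open>s, t\<close> over to a cone condition in
  the plane.\<close>

lemma ln_arctan_increment:
  assumes \<Lambda>: "0 \<le> \<Lambda>" and L: "L = 4 * (\<Lambda> + 1)"
    and x: "0 < a" "\<bar>b\<bar> \<le> a / L" and y: "0 < a'" "\<bar>b'\<bar> \<le> a' / L" and v: "L * \<bar>b - b'\<bar> < a - a'"
  shows "\<Lambda> * \<bar>arctan (b / a) - arctan (b' / a')\<bar> < ln (a\<^sup>2 + b\<^sup>2) / 2 - ln (a'\<^sup>2 + b'\<^sup>2) / 2"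
proof -
  have L4: "4 \<le> L" using \<Lambda> L by simp
  define v1 v2 where "v1 = a - a'" and "v2 = b - b'"
  have v2: "\<bar>v2\<bar> \<le> v1 / L" using v L4 by (simp add: v1_def v2_def field_simps)
  have v1: "0 < v1" using v L4 by (smt (verit) v1_def abs_ge_zero mult_nonneg_nonneg)
  \<comment> \<open>The sign \<eta> yields both halves of the absolute value at once; the function
    \<open>f\<close> below increases along the segment between the two points.\<close>
  have key: "\<eta> * \<Lambda> * (arctan (b / a) - arctan (b' / a')) < ln (a\<^sup>2 + b\<^sup>2) / 2 - ln (a'\<^sup>2 + b'\<^sup>2) / 2"
    if \<eta>: "\<eta> = 1 \<or> \<eta> = -1" for \<eta> :: real
  proof -
    define \<alpha> \<beta> where "\<alpha> u = a' + u * v1" and "\<beta> u = b' + u * v2" for u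
    define f where "f u = ln ((\<alpha> u)\<^sup>2 + (\<beta> u)\<^sup>2) / 2 - \<eta> * \<Lambda> * arctan (\<beta> u / \<alpha> u)" for u
    have "f 0 < f 1"
    proof (rule DERIV_pos_imp_increasing[where f = f and a = 0 and b = 1])
      fix u :: real assume u: "0 \<le> u" "u \<le> 1"
      have \<alpha>: "0 < \<alpha> u" using u v1 y(1) by (simp add: \<alpha>_def add_pos_nonneg)
      have \<beta>: "\<bar>\<beta> u\<bar> \<le> \<alpha> u / L"
      proof -
        have "\<bar>\<beta> u\<bar> \<le> \<bar>b'\<bar> + u * \<bar>v2\<bar>" using u abs_triangle_ineq[of b' "u * v2"] by (simp add: \<beta>_def abs_mult)
        also have "\<dots> \<le> a' / L + u * (v1 / L)" using y(2) v2 u by (intro add_mono mult_left_mono) auto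
        finally show ?thesis by (simp add: \<alpha>_def add_divide_distrib)
      qed
      let ?q = "(\<alpha> u)\<^sup>2 + (\<beta> u)\<^sup>2"
      have q: "0 < ?q" using \<alpha> by (simp add: add_pos_nonneg)
      have "(f has_field_derivative ((\<alpha> u * v1 + \<beta> u * v2) - \<eta> * \<Lambda> * (\<alpha> u * v2 - \<beta> u * v1)) / ?q) (at u)"
      proof -
        have da: "(\<alpha> has_field_derivative v1) (at u)" and db: "(\<beta> has_field_derivative v2) (at u)"
          unfolding \<alpha>_def \<beta>_def by (auto intro!: derivative_eq_intros)
        have "((\<lambda>u. (\<alpha> u)\<^sup>2 + (\<beta> u)\<^sup>2) has_field_derivative 2 * (\<alpha> u * v1 + \<beta> u * v2)) (at u)"
          by (rule DERIV_cong[OF DERIV_add[OF DERIV_power[OF da] DERIV_power[OF db]]]) (simp add: algebra_simps)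
        from DERIV_cdivide[OF DERIV_chain2[OF DERIV_ln[OF q] this], of 2]
        have 1: "((\<lambda>u. ln ((\<alpha> u)\<^sup>2 + (\<beta> u)\<^sup>2) / 2) has_field_derivative (\<alpha> u * v1 + \<beta> u * v2) / ?q) (at u)"
        proof (rule DERIV_cong)
          have "inverse Q * (2 * X) / 2 = X / Q" for X Q :: real
            by (cases "Q = 0") (simp_all add: field_simps)
          then show "inverse ?q * (2 * (\<alpha> u * v1 + \<beta> u * v2)) / 2 = (\<alpha> u * v1 + \<beta> u * v2) / ?q" .
        qed
        have "((\<lambda>u. \<beta> u / \<alpha> u) has_field_derivative (v2 * \<alpha> u - \<beta> u * v1) / (\<alpha> u * \<alpha> u)) (at u)"
          using DERIV_divide[OF db da] \<alpha> by simp
        from DERIV_chain2[OF DERIV_arctan this]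
        have "((\<lambda>u. arctan (\<beta> u / \<alpha> u)) has_field_derivative
            inverse (1 + (\<beta> u / \<alpha> u)\<^sup>2) * ((v2 * \<alpha> u - \<beta> u * v1) / (\<alpha> u * \<alpha> u))) (at u)" .
        moreover have "1 + (\<beta> u / \<alpha> u)\<^sup>2 = ?q / (\<alpha> u * \<alpha> u)"
          using \<alpha> by (simp add: power_divide add_divide_distrib power2_eq_square)
        moreover have "inverse (?q / (\<alpha> u * \<alpha> u)) * ((v2 * \<alpha> u - \<beta> u * v1) / (\<alpha> u * \<alpha> u)) = (\<alpha> u * v2 - \<beta> u * v1) / ?q"
          using \<alpha> by (simp add: mult.commute)
        ultimately have 2: "((\<lambda>u. arctan (\<beta> u / \<alpha> u)) has_field_derivative (\<alpha> u * v2 - \<beta> u * v1) / ?q) (at u)"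
          by simp
        show ?thesis
          unfolding f_def diff_divide_distrib
          by (rule DERIV_cong[OF DERIV_diff[OF 1 DERIV_cmult[OF 2, of "\<eta> * \<Lambda>"]]])
            (simp add: diff_divide_distrib right_diff_distrib)
      qed
      \<comment> \<open>The choice \<open>L = 4 * (\<Lambda> + 1)\<close> limits the three error
        terms to 1/16, 1/4 and 1/4 of the main term \<open>\<alpha> u * v1\<close>.\<close>
      moreover have "0 < (\<alpha> u * v1 + \<beta> u * v2) - \<eta> * \<Lambda> * (\<alpha> u * v2 - \<beta> u * v1)"
      proof -
        have av: "0 < \<alpha> u * v1" using \<alpha> v1 by simp
        have b1: "\<bar>\<beta> u * v2\<bar> \<le> (\<alpha> u / L) * (v1 / L)" unfolding abs_mult using \<beta> v2 \<alpha> L4 by (intro mult_mono) auto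
        also have "\<dots> \<le> (\<alpha> u * v1) / 16"
        proof -
          have "16 \<le> L * L" using L4 mult_mono[of 4 L 4 L] by simp
          then have "(\<alpha> u * v1) / (L * L) \<le> (\<alpha> u * v1) / 16" using av by (intro divide_left_mono) auto
          then show ?thesis by simp
        qed
        finally have b1: "\<bar>\<beta> u * v2\<bar> \<le> (\<alpha> u * v1) / 16" .
        have L\<Lambda>: "\<Lambda> / L \<le> 1/4" using \<Lambda> L by (simp add: field_simps)
        have "\<alpha> u * \<bar>v2\<bar> \<le> \<alpha> u * (v1 / L)" using v2 \<alpha> by (intro mult_left_mono) auto
        from mult_left_mono[OF this \<Lambda>]
        have "\<Lambda> * \<bar>\<alpha> u * v2\<bar> \<le> \<Lambda> * (\<alpha> u * (v1 / L))" using \<alpha> by (simp only: abs_mult abs_of_pos)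
        also have "\<dots> = (\<Lambda> / L) * (\<alpha> u * v1)" by simp
        also have "\<dots> \<le> (1/4) * (\<alpha> u * v1)" using L\<Lambda> av by (intro mult_right_mono) auto
        finally have b2: "\<Lambda> * \<bar>\<alpha> u * v2\<bar> \<le> (1/4) * (\<alpha> u * v1)" .
        have "\<Lambda> * \<bar>\<beta> u * v1\<bar> \<le> \<Lambda> * ((\<alpha> u / L) * v1)" unfolding abs_mult using \<beta> v1 \<Lambda> by (intro mult_left_mono mult_mono) auto
        also have "\<dots> = (\<Lambda> / L) * (\<alpha> u * v1)" by simp
        also have "\<dots> \<le> (1/4) * (\<alpha> u * v1)" using L\<Lambda> av by (intro mult_right_mono) auto
        finally have b3: "\<Lambda> * \<bar>\<beta> u * v1\<bar> \<le> (1/4) * (\<alpha> u * v1)" .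
        have b2': "\<bar>\<Lambda> * (\<alpha> u * v2)\<bar> \<le> (1/4) * (\<alpha> u * v1)" and b3': "\<bar>\<Lambda> * (\<beta> u * v1)\<bar> \<le> (1/4) * (\<alpha> u * v1)"
          using b2 b3 \<Lambda> by (simp_all add: abs_mult)
        have "(\<alpha> u * v1 + \<beta> u * v2) - \<eta> * \<Lambda> * (\<alpha> u * v2 - \<beta> u * v1)
           = \<alpha> u * v1 + \<beta> u * v2 - \<eta> * (\<Lambda> * (\<alpha> u * v2)) + \<eta> * (\<Lambda> * (\<beta> u * v1))"
          by (simp add: algebra_simps)
        then show ?thesis using \<eta> b1 b2' b3' av by (auto simp: abs_le_iff)
      qed
      ultimately show "\<exists>D. (f has_field_derivative D) (at u) \<and> 0 < D" using q by (meson divide_pos_pos)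
    qed simp
    then show ?thesis by (simp add: f_def \<alpha>_def \<beta>_def v1_def v2_def algebra_simps)
  qed
  have "\<bar>\<Lambda> * (arctan (b / a) - arctan (b' / a'))\<bar> < ln (a\<^sup>2 + b\<^sup>2) / 2 - ln (a'\<^sup>2 + b'\<^sup>2) / 2"
    using key[of 1] key[of "-1"] by (simp only: abs_less_iff) simp
  then show ?thesis using \<Lambda> by (simp only: abs_mult abs_of_nonneg)
qed

lemma frame_decomp:
  "(x :: real^2) = (x \<bullet> pol 0 t) *\<^sub>R pol 0 t + (x \<bullet> pol' 0 t) *\<^sub>R pol' 0 t"
proof (rule vec2_eqI)
  have 1: "sin t * sin t = 1 - cos t * cos t" using sin_cos_squared_add[of t] by (simp add: power2_eq_square)
  show "x $ 1 = ((x \<bullet> pol 0 t) *\<^sub>R pol 0 t + (x \<bullet> pol' 0 t) *\<^sub>R pol' 0 t) $ 1"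
    using 1 unfolding inner_vec2 vector_add_component vector_scaleR_component pol_nth real_scaleR_def by simp algebra
  show "x $ 2 = ((x \<bullet> pol 0 t) *\<^sub>R pol 0 t + (x \<bullet> pol' 0 t) *\<^sub>R pol' 0 t) $ 2"
    using 1 unfolding inner_vec2 vector_add_component vector_scaleR_component pol_nth real_scaleR_def by simp algebra
qed

lemma norm_frame: "(norm (x :: real^2))\<^sup>2 = (x \<bullet> pol 0 t)\<^sup>2 + (x \<bullet> pol' 0 t)\<^sup>2"
proof -
  have "x \<bullet> x = x \<bullet> ((x \<bullet> pol 0 t) *\<^sub>R pol 0 t + (x \<bullet> pol' 0 t) *\<^sub>R pol' 0 t)"
    using frame_decomp[of x t] by simp
  also have "\<dots> = (x \<bullet> pol 0 t) * (x \<bullet> pol 0 t) + (x \<bullet> pol' 0 t) * (x \<bullet> pol' 0 t)"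
    by (simp only: inner_add_right inner_scaleR_right)
  finally show ?thesis
    by (simp only: power2_norm_eq_inner power2_eq_square[of "x \<bullet> pol 0 t"] power2_eq_square[of "x \<bullet> pol' 0 t"])
qed

text \<open>The axis is the direction with angle \<open>t\<close> itself, so in the half plane
  around it \<open>arctan\<close> gives the angle without any choice of branch.\<close>

lemma pol_frame:
  assumes a: "0 < x \<bullet> pol 0 t"
  shows "x = pol (ln (norm x)) (t + arctan ((x \<bullet> pol' 0 t) / (x \<bullet> pol 0 t)))"
    and "ln (norm x) = ln ((x \<bullet> pol 0 t)\<^sup>2 + (x \<bullet> pol' 0 t)\<^sup>2) / 2"
proof -
  define a b where "a = x \<bullet> pol 0 t" and "b = x \<bullet> pol' 0 t"
  have a0: "0 < a" using a by (simp add: a_def)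
  have n2: "(norm x)\<^sup>2 = a\<^sup>2 + b\<^sup>2" unfolding a_def b_def by (rule norm_frame)
  have n: "norm x = sqrt (a\<^sup>2 + b\<^sup>2)" using n2 by (metis norm_ge_zero real_sqrt_unique)
  have n0: "0 < norm x" using a by auto
  show "ln (norm x) = ln ((x \<bullet> pol 0 t)\<^sup>2 + (x \<bullet> pol' 0 t)\<^sup>2) / 2"
    unfolding a_def[symmetric] b_def[symmetric] n using a0 by (subst ln_sqrt) (auto simp: add_pos_nonneg)
  have s: "sqrt (1 + (b / a)\<^sup>2) = norm x / a"
  proof -
    have "1 + (b / a)\<^sup>2 = (norm x / a)\<^sup>2" using a0 by (simp add: n2 power_divide field_simps)
    then show ?thesis using a0 by (simp add: real_sqrt_unique)
  qed
  have c: "norm x * cos (arctan (b / a)) = a" "norm x * sin (arctan (b / a)) = b"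
    using a0 n0 by (simp_all add: cos_arctan sin_arctan s)
  have "x = a *\<^sub>R pol 0 t + b *\<^sub>R pol' 0 t" unfolding a_def b_def by (rule frame_decomp)
  also have "\<dots> = pol (ln (norm x)) (t + arctan (b / a))"
  proof (rule vec2_eqI)
    have "norm x * cos (t + arctan (b / a)) = (norm x * cos (arctan (b / a))) * cos t - (norm x * sin (arctan (b / a))) * sin t"
      "norm x * sin (t + arctan (b / a)) = (norm x * cos (arctan (b / a))) * sin t + (norm x * sin (arctan (b / a))) * cos t"
      by (simp_all only: cos_add sin_add) algebra+
    then show "(a *\<^sub>R pol 0 t + b *\<^sub>R pol' 0 t) $ 1 = pol (ln (norm x)) (t + arctan (b / a)) $ 1"
      "(a *\<^sub>R pol 0 t + b *\<^sub>R pol' 0 t) $ 2 = pol (ln (norm x)) (t + arctan (b / a)) $ 2"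
      using n0 unfolding c by simp_all
  qed
  finally show "x = pol (ln (norm x)) (t + arctan ((x \<bullet> pol' 0 t) / (x \<bullet> pol 0 t)))"
    by (simp add: a_def b_def)
qed

text \<open>At a boundary point the radial direction plays the role of the vertical axis: outward at
  the inner curve and inward at the outer circle, since the region has to lie above the
  graph.\<close>

lemma lipschitz_boundary_polar_region:
  fixes g :: "real \<Rightarrow> real"
  assumes g: "continuous_on UNIV g" and per: "\<And>t. g (t + 2 * pi) = g t" and gm: "\<And>t. g t < m"
    and \<Lambda>: "0 \<le> \<Lambda>" and lip: "\<And>x y. \<bar>g x - g y\<bar> \<le> \<Lambda> * \<bar>x - y\<bar>"
  shows "lipschitz_boundary (polar_region g m)"
  unfolding lipschitz_boundary_def
proof
  note mem = pol_mem_polar_region[OF g per gm]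
  note op = open_polar_region[OF g per gm]
  define L where "L = 4 * (\<Lambda> + 1)"
  have L4: "4 \<le> L" using \<Lambda> by (simp add: L_def)
  fix p assume p: "p \<in> frontier (polar_region g m)"
  then obtain s0 t0 where st: "p = pol s0 t0" "s0 = g t0 \<or> s0 = m"
    unfolding frontier_polar_region[OF g per gm] by auto
  define n n' where "n = pol 0 t0" and "n' = pol' 0 t0"
  have nn: "norm n = 1" "norm n' = 1" by (simp_all add: n_def n'_def)
  have pn: "p \<bullet> n = exp s0" "p \<bullet> n' = 0" by (simp_all add: st n_def n'_def)
  \<comment> \<open>This radius keeps the ball inside the cone around the direction of
    \<open>p\<close> in which the increment estimate holds.\<close>
  have near: "0 < x \<bullet> n \<and> \<bar>x \<bullet> n'\<bar> \<le> (x \<bullet> n) / L" if x: "x \<in> ball p r" and r: "r \<le> exp s0 / (L + 1)" for x r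
  proof -
    have d: "norm (x - p) < r" using x by (simp add: dist_norm norm_minus_commute)
    have "\<bar>(x - p) \<bullet> n\<bar> \<le> norm (x - p)" "\<bar>(x - p) \<bullet> n'\<bar> \<le> norm (x - p)"
      using Cauchy_Schwarz_ineq2[of "x - p" n] Cauchy_Schwarz_ineq2[of "x - p" n'] nn by simp_all
    then have 1: "exp s0 - r < x \<bullet> n" "\<bar>x \<bullet> n'\<bar> < r" using d pn by (auto simp: inner_diff_left abs_less_iff)
    have 2: "L * r \<le> exp s0 - r" using r L4 by (simp add: field_simps)
    have "0 < r" using 1(2) by linarith
    then have "0 < x \<bullet> n" using 1(1) 2 L4 by (smt (verit) mult_pos_pos)
    moreover have "L * \<bar>x \<bullet> n'\<bar> \<le> L * r" using 1(2) L4 by (intro mult_left_mono) auto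
    then have "L * \<bar>x \<bullet> n'\<bar> \<le> x \<bullet> n" using 1 2 by linarith
    then have "\<bar>x \<bullet> n'\<bar> \<le> (x \<bullet> n) / L" using L4 by (simp add: field_simps)
    ultimately show ?thesis by simp
  qed
  define \<theta> where "\<theta> x = t0 + arctan ((x \<bullet> n') / (x \<bullet> n))" for x
  have inc: "\<Lambda> * \<bar>\<theta> x - \<theta> y\<bar> < ln (norm x) - ln (norm y) \<and> x = pol (ln (norm x)) (\<theta> x) \<and> y = pol (ln (norm y)) (\<theta> y)"
    if xy: "x \<in> ball p r" "y \<in> ball p r" "r \<le> exp s0 / (L + 1)" "L * \<bar>(x - y) \<bullet> n'\<bar> < (x - y) \<bullet> n" for x y r
  proof -
    note nx = near[OF xy(1,3)] and ny = near[OF xy(2,3)]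
    have "\<Lambda> * \<bar>arctan ((x \<bullet> n') / (x \<bullet> n)) - arctan ((y \<bullet> n') / (y \<bullet> n))\<bar>
        < ln ((x \<bullet> n)\<^sup>2 + (x \<bullet> n')\<^sup>2) / 2 - ln ((y \<bullet> n)\<^sup>2 + (y \<bullet> n')\<^sup>2) / 2"
      by (rule ln_arctan_increment[OF \<Lambda> L_def]) (use nx ny xy(4) in \<open>auto simp: inner_diff_left\<close>)
    moreover have "0 < x \<bullet> pol 0 t0" "0 < y \<bullet> pol 0 t0" using nx ny by (simp_all add: n_def)
    ultimately show ?thesis
      using pol_frame(1)[of x t0] pol_frame(1)[of y t0] pol_frame(2)[of x t0] pol_frame(2)[of y t0]
      unfolding \<theta>_def n_def n'_def by (metis add_diff_cancel_left)
  qed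
  have perp: "norm (z - (z \<bullet> n) *\<^sub>R n) = \<bar>z \<bullet> n'\<bar>" for z
  proof -
    have gen: "a = b + c \<Longrightarrow> norm (a - b) = norm c" for a b c :: "real^2"
      by (simp only: add_diff_cancel_left')
    have "norm (z - (z \<bullet> n) *\<^sub>R n) = norm ((z \<bullet> n') *\<^sub>R n')"
      by (rule gen) (unfold n_def n'_def, rule frame_decomp)
    also have "\<dots> = \<bar>z \<bullet> n'\<bar>" using nn(2) by simp
    finally show ?thesis .
  qed
  have ne: "polar_region g m \<inter> ball p r \<noteq> {}" if "0 < r" for r
  proof -
    have "p \<in> ball p r" "p \<in> closure (polar_region g m)" using p that by (simp_all add: frontier_def)
    then have "ball p r \<inter> closure (polar_region g m) \<noteq> {}" by blast
    then show ?thesis using open_Int_closure_eq_empty[OF open_ball] by (metis Int_commute)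
  qed
  have ex: "\<exists>r>0. \<exists>e g' L'. norm e = 1 \<and> L'-lipschitz_on {z. z \<bullet> e = 0} g' \<and>
      polar_region g m \<inter> ball p r = {x \<in> ball p r. x \<bullet> e > g' (x - (x \<bullet> e) *\<^sub>R e)}"
    if r: "0 < r" and e: "norm e = 1" and cone: "\<And>x y. x \<in> ball p r \<Longrightarrow> y \<in> polar_region g m \<Longrightarrow> y \<in> ball p r \<Longrightarrow>
        L * norm ((x - y) - ((x - y) \<bullet> e) *\<^sub>R e) < (x - y) \<bullet> e \<Longrightarrow> x \<in> polar_region g m" for r e
  proof -
    have L0: "0 \<le> L" using L4 by simp
    have "\<exists>g'. L-lipschitz_on {z. z \<bullet> e = 0} g' \<and>
        polar_region g m \<inter> ball p r = {x \<in> ball p r. x \<bullet> e > g' (x - (x \<bullet> e) *\<^sub>R e)}"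
      by (rule lipschitz_graph_of_cone_condition[OF op ne[OF r] e L0]) (rule cone)
    then obtain g' where "L-lipschitz_on {z. z \<bullet> e = 0} g'"
      "polar_region g m \<inter> ball p r = {x \<in> ball p r. x \<bullet> e > g' (x - (x \<bullet> e) *\<^sub>R e)}" by (elim exE conjE)
    then show ?thesis using r e by (intro exI[of _ r] exI[of _ e] exI[of _ g'] exI[of _ L] conjI)
  qed
  show "\<exists>r>0. \<exists>e g' L'. norm e = 1 \<and> L'-lipschitz_on {z. z \<bullet> e = 0} g' \<and>
      polar_region g m \<inter> ball p r = {x \<in> ball p r. x \<bullet> e > g' (x - (x \<bullet> e) *\<^sub>R e)}"
    using st(2)
  proof
    assume s0: "s0 = g t0"
    have "open {x::real^2. norm x < exp m}" by (intro open_Collect_less continuous_intros)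
    moreover have "p \<in> {x. norm x < exp m}" using gm[of t0] s0 st(1) by simp
    ultimately obtain r1 where r1: "0 < r1" "ball p r1 \<subseteq> {x. norm x < exp m}"
      using open_contains_ball by metis
    define r where "r = min r1 (exp s0 / (L + 1))"
    have r: "0 < r" "r \<le> exp s0 / (L + 1)" "r \<le> r1" using r1 L4 by (auto simp: r_def)
    show ?thesis
    proof (rule ex[OF r(1) nn(1)])
      fix x y assume xy: "x \<in> ball p r" "y \<in> polar_region g m" "y \<in> ball p r"
        "L * norm ((x - y) - ((x - y) \<bullet> n) *\<^sub>R n) < (x - y) \<bullet> n"
      have i: "\<Lambda> * \<bar>\<theta> x - \<theta> y\<bar> < ln (norm x) - ln (norm y)" "x = pol (ln (norm x)) (\<theta> x)" "y = pol (ln (norm y)) (\<theta> y)"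
        using inc[OF xy(1,3) r(2)] xy(4) by (auto simp: perp)
      have "g (\<theta> y) < ln (norm y)" using xy(2) mem i(3) by metis
      then have "g (\<theta> x) < ln (norm x)" using i(1) lip[of "\<theta> x" "\<theta> y"] by linarith
      moreover have "x \<in> ball p r1" using r(3) xy(1) by simp
      then have "norm x < exp m" using r1(2) by blast
      then have "ln (norm x) < m" using i(2) norm_pol by (metis exp_less_cancel_iff)
      ultimately show "x \<in> polar_region g m" using mem i(2) by metis
    qed
  next
    assume s0: "s0 = m"
    \<comment> \<open>The outer circle lies inside the region with outer bound \<open>m + 1\<close>.
      A small ball in that larger region satisfies the inner condition automatically, so only
      \<open>s < m\<close> remains to be propagated along the cone.\<close>
    have gm1: "g t < m + 1" for t using gm[of t] by simp
    note mem1 = pol_mem_polar_region[OF g per gm1]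
    have "p \<in> polar_region g (m + 1)" unfolding st(1) mem1 using s0 gm by simp
    then obtain r1 where r1: "0 < r1" "ball p r1 \<subseteq> polar_region g (m + 1)"
      using open_polar_region[OF g per gm1] open_contains_ball by metis
    define r where "r = min r1 (exp s0 / (L + 1))"
    have r: "0 < r" "r \<le> exp s0 / (L + 1)" "r \<le> r1" using r1 L4 by (auto simp: r_def)
    show ?thesis
    proof (rule ex[OF r(1)])
      show "norm (- n) = 1" using nn by simp
      fix x y assume xy: "x \<in> ball p r" "y \<in> polar_region g m" "y \<in> ball p r"
        "L * norm ((x - y) - ((x - y) \<bullet> - n) *\<^sub>R - n) < (x - y) \<bullet> - n"
      have "L * \<bar>(y - x) \<bullet> n'\<bar> < (y - x) \<bullet> n"
      proof -
        have "(x - y) - ((x - y) \<bullet> - n) *\<^sub>R - n = (x - y) - ((x - y) \<bullet> n) *\<^sub>R n" by simp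
        then have "L * \<bar>(x - y) \<bullet> n'\<bar> < (x - y) \<bullet> - n" using xy(4) by (simp only: perp)
        then show ?thesis by (simp add: inner_diff_left abs_minus_commute)
      qed
      then have i: "\<Lambda> * \<bar>\<theta> y - \<theta> x\<bar> < ln (norm y) - ln (norm x)" "x = pol (ln (norm x)) (\<theta> x)" "y = pol (ln (norm y)) (\<theta> y)"
        using inc[OF xy(3,1) r(2)] by auto
      have "ln (norm y) < m" using xy(2) mem i(3) by metis
      moreover have "0 \<le> \<Lambda> * \<bar>\<theta> y - \<theta> x\<bar>" using \<Lambda> by simp
      ultimately have "ln (norm x) < m" using i(1) by linarith
      moreover have "x \<in> ball p r1" using r(3) xy(1) by simp
      then have "x \<in> polar_region g (m + 1)" using r1(2) by blast
      then have "g (\<theta> x) < ln (norm x)" using mem1 i(2) by metis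
      ultimately show "x \<in> polar_region g m" using mem i(2) by metis
    qed
  qed
qed

subsection \<open>Diffeomorphism from the annulus\<close>

text \<open>The powers of the complex number with real part \<open>x $ 1\<close> and imaginary part
  \<open>x $ 2\<close>, as polynomials in the coordinates.\<close>

primrec cpow :: "nat \<Rightarrow> real^2 \<Rightarrow> real^2" where
  "cpow 0 x = vector [1, 0]"
| "cpow (Suc n) x = vector [x $ 1 * cpow n x $ 1 - x $ 2 * cpow n x $ 2, x $ 1 * cpow n x $ 2 + x $ 2 * cpow n x $ 1]"

lemma cpow_pol: "cpow n (pol s t) = pol (real n * s) (real n * t)"
proof (induction n)
  case 0
  show ?case by (rule vec2_eqI) auto
next
  case (Suc n)
  have e: "exp (real (Suc n) * s) = exp s * exp (real n * s)"
    "cos (real (Suc n) * t) = cos t * cos (real n * t) - sin t * sin (real n * t)"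
    "sin (real (Suc n) * t) = sin t * cos (real n * t) + cos t * sin (real n * t)"
    by (simp_all add: distrib_right exp_add cos_add sin_add)
  show ?case
  proof (rule vec2_eqI)
    show "cpow (Suc n) (pol s t) $ 1 = pol (real (Suc n) * s) (real (Suc n) * t) $ 1"
      unfolding pol_nth e by (simp add: Suc algebra_simps)
    show "cpow (Suc n) (pol s t) $ 2 = pol (real (Suc n) * s) (real (Suc n) * t) $ 2"
      unfolding pol_nth e by (simp add: Suc algebra_simps)
  qed
qed

lemma smooth_on_nth: "open S \<Longrightarrow> smooth_on S (\<lambda>x::real^'n. x $ i)"
  by (rule smooth_on_linear[OF _ bounded_linear_vec_nth])

lemma smooth_on_cpow: "open S \<Longrightarrow> smooth_on S (\<lambda>x. cpow n x $ 1) \<and> smooth_on S (\<lambda>x. cpow n x $ 2)"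
proof (induction n)
  case (Suc n)
  then have IH: "smooth_on S (\<lambda>x. cpow n x $ 1)" "smooth_on S (\<lambda>x. cpow n x $ 2)" by auto
  have "smooth_on S (\<lambda>x. x $ 1 * cpow n x $ 1 - x $ 2 * cpow n x $ 2)"
    by (intro smooth_on_diff smooth_on_mult smooth_on_nth IH Suc.prems)
  moreover have "smooth_on S (\<lambda>x. x $ 1 * cpow n x $ 2 + x $ 2 * cpow n x $ 1)"
    by (intro smooth_on_add smooth_on_mult smooth_on_nth IH Suc.prems)
  ultimately show ?case by simp
qed (auto intro: smooth_on_const)

definition annulus :: "(real^2) set" where "annulus = {x. 1 < norm x \<and> norm x < 2}"

text \<open>For \<open>0 < r - 1 \<le> 1\<close> the factor \<open>cos (r - 1)\<close> rounds off the corners of the zigzag, and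
  \<open>height r t\<close> increases from \<open>zig t\<close> to \<open>12\<close> as \<open>r\<close> runs from 1 to 2.\<close>

definition bend :: "real \<Rightarrow> real \<Rightarrow> real" where
  "bend r t = arccos (cos (r - 1) * cos (real teeth * t)) / teeth"

definition height :: "real \<Rightarrow> real \<Rightarrow> real" where
  "height r t = (2 - r) * tau_inv (bend r t) + (r - 1) * 12"

lemma cos_r_bounds: "1 < (r :: real) \<Longrightarrow> r < 2 \<Longrightarrow> 0 < cos (r - 1) \<and> cos (r - 1) < 1"
  using cos_gt_zero[of "r - 1"] cos_monotone_0_pi[of 0 "r - 1"] pi_gt3 by auto

lemma bend_arg: "\<bar>cos (r - 1) * cos (real teeth * t)\<bar> \<le> 1"
  unfolding abs_mult by (intro mult_le_one) auto

lemma bend_arg_less: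
  assumes "1 < r" "r < 2"
  shows "\<bar>cos (r - 1) * cos (real teeth * t)\<bar> < 1"
proof -
  have "\<bar>cos (r - 1) * cos (real teeth * t)\<bar> \<le> cos (r - 1) * 1"
    unfolding abs_mult using cos_r_bounds[OF assms] by (intro mult_mono) auto
  then show ?thesis using cos_r_bounds[OF assms] by simp
qed

lemma bend_mem: "bend r t \<in> {0..tau (-12)}"
proof -
  have "0 \<le> arccos (cos (r - 1) * cos (real teeth * t))" "arccos (cos (r - 1) * cos (real teeth * t)) \<le> pi"
    using bend_arg[of r t] by (auto intro!: arccos_lbound arccos_ubound simp: abs_le_iff)
  then have "0 \<le> bend r t" "bend r t \<le> pi / teeth"
    by (auto simp: bend_def divide_right_mono)
  then show ?thesis using teeth(2) by auto
qed

lemma height_1: "height 1 t = zig t" and height_2: "height 2 t = 12"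
  by (auto simp: height_def bend_def zig_def tri_def)

lemma tau_inv_cont: "continuous_on {0..tau (-12)} tau_inv"
  by (rule continuous_on_subset[OF smooth_on_imp_continuous[OF smooth_on_tau_inv] Icc_tau_range])

lemma height_cont: "continuous_on A (\<lambda>r. height r t)"
proof -
  have "continuous_on A (\<lambda>r. bend r t)"
  proof -
    have "-1 \<le> cos (r - 1) * cos (real teeth * t) \<and> cos (r - 1) * cos (real teeth * t) \<le> 1" for r
      using bend_arg[of r t] by linarith
    moreover have "continuous_on A (\<lambda>r. cos (r - 1) * cos (real teeth * t))"
      by (intro continuous_intros)
    ultimately have "continuous_on A (\<lambda>r. arccos (cos (r - 1) * cos (real teeth * t)))"
      by (intro continuous_on_arccos ballI)
    then show ?thesis
      unfolding bend_def by (rule continuous_on_divide[OF _ continuous_on_const]) (use teeth(1) in auto)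
  qed
  then have "continuous_on A (\<lambda>r. tau_inv (bend r t))"
    by (rule continuous_on_compose2[OF tau_inv_cont]) (use bend_mem in auto)
  then show ?thesis
    unfolding height_def
    by (intro continuous_on_add continuous_on_mult continuous_on_diff continuous_on_const continuous_on_id)
qed

text \<open>The interpolation contributes \<open>12 - tau_inv b\<close>, which is at least 24. The
  moving graph contributes at most 1 in absolute value, because the bend has derivative at most
  \<open>1 / teeth\<close> and \<open>tau_inv\<close> has slope at most
  \<open>teeth\<close>.\<close>

lemma height_deriv:
  assumes r: "1 < r" "r < 2"
  shows "\<exists>D>0. ((\<lambda>r. height r t) has_field_derivative D) (at r)"
proof -
  define C where "C = cos (real teeth * t)"
  define x where "x = cos (r - 1) * C"
  have x1: "\<bar>x\<bar> < 1" unfolding x_def C_def by (rule bend_arg_less[OF r])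
  define d where "d = (sin (r - 1) * C / sqrt (1 - x\<^sup>2)) / teeth"
  have s0: "0 < sin (r - 1)" using r pi_gt3 by (intro sin_gt_zero) auto
  have x2: "x\<^sup>2 < 1" using x1 by (simp add: abs_square_less_1)
  have "((\<lambda>r. arccos (cos (r - 1) * C)) has_field_derivative inverse (- sqrt (1 - x\<^sup>2)) * (- sin (r - 1) * C)) (at r)"
  proof (rule DERIV_chain2[where f = arccos])
    show "(arccos has_field_derivative inverse (- sqrt (1 - x\<^sup>2))) (at (cos (r - 1) * C))"
      using x1 DERIV_arccos[of x] by (simp add: x_def abs_less_iff)
    show "((\<lambda>r. cos (r - 1) * C) has_field_derivative - sin (r - 1) * C) (at r)"
      by (auto intro!: derivative_eq_intros)
  qed
  from DERIV_cdivide[OF this, of "real teeth"]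
  have bd: "((\<lambda>r. bend r t) has_field_derivative d) (at r)"
    by (simp add: bend_def C_def d_def divide_inverse mult_ac)
  have C1: "C\<^sup>2 \<le> 1" unfolding C_def by (simp add: abs_square_le_1)
  \<comment> \<open>Both squares share the factor \<open>C\<^sup>2 \<le> 1\<close>; hence the
    derivative of the inner \<open>arccos\<close> is bounded by 1 although its denominator may
    become small.\<close>
  have "(sin (r - 1))\<^sup>2 * C\<^sup>2 \<le> 1 - x\<^sup>2"
  proof -
    have "(sin (r - 1))\<^sup>2 * C\<^sup>2 + x\<^sup>2 = C\<^sup>2 * ((sin (r - 1))\<^sup>2 + (cos (r - 1))\<^sup>2)"
      by (simp only: x_def power_mult_distrib distrib_left mult.commute)
    then show ?thesis using C1 by simp
  qed
  then have "\<bar>sin (r - 1) * C\<bar> \<le> sqrt (1 - x\<^sup>2)"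
    by (intro real_le_rsqrt) (simp add: power_mult_distrib)
  moreover have "0 < sqrt (1 - x\<^sup>2)" using x2 by simp
  ultimately have "\<bar>sin (r - 1) * C / sqrt (1 - x\<^sup>2)\<bar> \<le> 1" by (simp add: abs_divide)
  then have "\<bar>sin (r - 1) * C / sqrt (1 - x\<^sup>2)\<bar> / teeth \<le> 1 / teeth" by (rule divide_right_mono) simp
  moreover have "\<bar>d\<bar> = \<bar>sin (r - 1) * C / sqrt (1 - x\<^sup>2)\<bar> / teeth"
    unfolding d_def by (subst abs_divide) simp
  ultimately have dle: "\<bar>d\<bar> \<le> 1 / teeth" by simp
  define b where "b = bend r t"
  have b: "b \<in> {0..tau (-12)}" unfolding b_def by (rule bend_mem)
  have bt: "tau_inv b \<in> {-16..-12}" by (rule tau_inv_bounds[OF b])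
  have br: "b \<in> tau_range" using b Icc_tau_range by blast
  have "((\<lambda>r. tau_inv (bend r t)) has_field_derivative (1 / slp (tau_inv b)) * d) (at r)"
    by (rule DERIV_chain2[OF _ bd]) (use tau_inv_deriv[OF br] in \<open>simp add: b_def\<close>)
  then have hd: "((\<lambda>r. height r t) has_field_derivative
      (2 - r) * ((1 / slp (tau_inv b)) * d) - tau_inv b + 12) (at r)"
    unfolding height_def by (auto intro!: derivative_eq_intros simp: b_def)
  have sl: "0 < 1 / slp (tau_inv b)" "1 / slp (tau_inv b) \<le> teeth"
    using slp_pos[of "tau_inv b"] teeth(3)[OF bt] bt by auto
  have "\<bar>(1 / slp (tau_inv b)) * d\<bar> \<le> teeth * (1 / teeth)"
    unfolding abs_mult using sl dle by (intro mult_mono) auto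
  then have "\<bar>(1 / slp (tau_inv b)) * d\<bar> \<le> 1" using teeth(1) by simp
  then have "\<bar>(2 - r) * ((1 / slp (tau_inv b)) * d)\<bar> \<le> 1 * 1"
    unfolding abs_mult[of "2 - r"] using r by (intro mult_mono) auto
  then have "0 < (2 - r) * ((1 / slp (tau_inv b)) * d) - tau_inv b + 12"
    using bt unfolding atLeastAtMost_iff by linarith
  then show ?thesis using hd by blast
qed

lemma height_strict_mono:
  assumes "1 \<le> r" "r < r'" "r' \<le> 2"
  shows "height r t < height r' t"
proof (rule DERIV_pos_imp_increasing_open[OF assms(2) _ height_cont])
  fix x assume "r < x" "x < r'"
  then show "\<exists>y. ((\<lambda>r. height r t) has_field_derivative y) (at x) \<and> y > 0"
    using height_deriv[of x t] assms by auto
qed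

text \<open>In the image of a point \<open>y\<close> of the annulus, \<open>cos (teeth * t)\<close> is written through the power
  \<open>cpow teeth y\<close> of the complex number \<open>y\<close>, so that smoothness does not require a choice of the angle.\<close>

definition S_ann :: "real^2 \<Rightarrow> real" where
  "S_ann y = (2 - norm y) * tau_inv (arccos (cos (norm y - 1) * (cpow teeth y $ 1 / norm y ^ teeth)) / teeth)
     + (norm y - 1) * 12"

definition scale_ann :: "real^2 \<Rightarrow> real" where "scale_ann y = exp (S_ann y) / norm y"

text \<open>Rays are mapped into themselves, so the derivative is a multiple of the identity plus a
  map of rank one.\<close>

definition diffeo :: "real^2 \<Rightarrow> real^2" where "diffeo y = scale_ann y *\<^sub>R y"

lemma open_annulus: "open annulus"
proof -
  have "open ({x::real^2. 1 < norm x} \<inter> {x. norm x < 2})"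
    by (intro open_Int open_Collect_less continuous_intros)
  moreover have "annulus = {x. 1 < norm x} \<inter> {x. norm x < 2}" by (auto simp: annulus_def)
  ultimately show ?thesis by (simp only:)
qed

lemma annulus_pol: "y \<in> annulus \<Longrightarrow> \<exists>t. y = pol (ln (norm y)) t"
proof -
  assume "y \<in> annulus"
  then have "y \<noteq> 0" by (auto simp: annulus_def)
  then obtain t where "y = pol (ln (norm y)) t" by (rule pol_exists)
  then show ?thesis by blast
qed

lemma S_ann_pol: "S_ann (pol s t) = height (exp s) t"
proof -
  have "cpow teeth (pol s t) $ 1 / norm (pol s t) ^ teeth = cos (real teeth * t)"
    by (simp add: cpow_pol exp_of_nat_mult[symmetric])
  then show ?thesis by (simp add: S_ann_def height_def bend_def)
qed

lemma scale_ann_pol: "scale_ann (pol s t) = exp (height (exp s) t) / exp s"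
  by (simp add: scale_ann_def S_ann_pol)

lemma diffeo_pol: "diffeo (pol s t) = pol (height (exp s) t) t"
  unfolding diffeo_def scale_ann_pol by (rule vec2_eqI) auto

text \<open>Strictly inside the annulus \<open>cos (norm y - 1)\<close> lies below 1 and keeps the
  argument of \<open>arccos\<close> away from 1 and -1, the only places where it fails to be
  smooth.\<close>

lemma smooth_on_S_ann: "smooth_on annulus S_ann"
proof -
  note [intro] = open_annulus
  have n: "smooth_on annulus (\<lambda>y. norm y)" by (rule smooth_on_norm[OF open_annulus]) (simp add: annulus_def)
  have sc: "smooth_on UNIV (cos :: real \<Rightarrow> real)" using C_on_sin_cos by (auto simp: smooth_on_def)
  have c: "smooth_on annulus (\<lambda>y. cos (norm y - 1))"
    by (rule smooth_on_compose[OF sc]) (auto intro!: smooth_on_diff n smooth_on_const)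
  have x: "smooth_on annulus (\<lambda>y. cos (norm y - 1) * (cpow teeth y $ 1 / norm y ^ teeth))"
  proof (intro smooth_on_mult c smooth_on_divide smooth_on_power n open_annulus)
    show "smooth_on annulus (\<lambda>y. cpow teeth y $ 1)" using smooth_on_cpow[OF open_annulus] by blast
    show "norm y ^ teeth \<noteq> 0" if "y \<in> annulus" for y using that by (auto simp: annulus_def)
  qed
  have arg: "\<exists>t. y = pol (ln (norm y)) t \<and> cpow teeth y $ 1 / norm y ^ teeth = cos (real teeth * t)"
    if y: "y \<in> annulus" for y
  proof -
    have "y \<noteq> 0" using y by (auto simp: annulus_def)
    then obtain t where t: "y = pol (ln (norm y)) t" using pol_exists by metis
    have "cpow teeth (pol (ln (norm y)) t) $ 1 / norm (pol (ln (norm y)) t) ^ teeth = cos (real teeth * t)"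
      by (simp add: cpow_pol exp_of_nat_mult[symmetric])
    then show ?thesis using t by metis
  qed
  have lt: "\<bar>cos (norm y - 1) * (cpow teeth y $ 1 / norm y ^ teeth)\<bar> < 1" if "y \<in> annulus" for y
  proof -
    obtain t where t: "cpow teeth y $ 1 / norm y ^ teeth = cos (real teeth * t)" using arg[OF \<open>y \<in> annulus\<close>] by blast
    show ?thesis unfolding t by (rule bend_arg_less) (use \<open>y \<in> annulus\<close> in \<open>auto simp: annulus_def\<close>)
  qed
  have a: "smooth_on annulus (\<lambda>y. arccos (cos (norm y - 1) * (cpow teeth y $ 1 / norm y ^ teeth)) / teeth)"
    using teeth(1) by (intro smooth_on_divide smooth_on_arccos x lt smooth_on_const) auto
  have "smooth_on annulus (\<lambda>y. tau_inv (arccos (cos (norm y - 1) * (cpow teeth y $ 1 / norm y ^ teeth)) / teeth))"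
  proof (rule smooth_on_compose[OF smooth_on_tau_inv a open_annulus open_tau_range])
    fix y assume y: "y \<in> annulus"
    then obtain t where t: "cpow teeth y $ 1 / norm y ^ teeth = cos (real teeth * t)" using arg by blast
    show "arccos (cos (norm y - 1) * (cpow teeth y $ 1 / norm y ^ teeth)) / teeth \<in> tau_range"
      using bend_mem[of "norm y" t] Icc_tau_range unfolding t bend_def by blast
  qed
  then show ?thesis
    unfolding S_ann_def
    by (intro smooth_on_add smooth_on_mult smooth_on_diff n smooth_on_const open_annulus)
qed

lemma smooth_on_scale_ann: "smooth_on annulus scale_ann"
  unfolding scale_ann_def
  by (intro smooth_on_divide smooth_on_exp smooth_on_S_ann smooth_on_norm open_annulus) (auto simp: annulus_def)

text \<open>The quantity is the derivative along the ray of the image radius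
  \<open>exp (height r t)\<close>, so its sign is that of the derivative of
  \<open>height\<close>.\<close>

lemma scale_ann_radial:
  assumes y: "y \<in> annulus"
  shows "0 < scale_ann y + frechet_derivative scale_ann (at y) y"
proof -
  define r where "r = norm y"
  have r: "1 < r" "r < 2" using y by (auto simp: annulus_def r_def)
  obtain t where t: "y = pol (ln r) t" using annulus_pol[OF y] r_def by metis
  define n where "n = pol 0 t"
  have pn: "pol (ln q) t = q *\<^sub>R n" if "0 < q" for q using that by (intro vec2_eqI) (auto simp: n_def)
  have yn: "y = r *\<^sub>R n" using t pn[of r] r by simp
  define \<phi>' where "\<phi>' = frechet_derivative scale_ann (at y)"
  have d: "(scale_ann has_derivative \<phi>') (at y)"
    unfolding \<phi>'_def by (rule smooth_on_has_derivative[OF smooth_on_scale_ann y])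
  have l: "linear \<phi>'" using d by (rule has_derivative_linear)
  have "((\<lambda>q. scale_ann (q *\<^sub>R n)) has_derivative (\<lambda>h. \<phi>' (h *\<^sub>R n))) (at r)"
    by (rule has_derivative_compose[of "\<lambda>q. q *\<^sub>R n"]) (use d yn in \<open>auto intro!: derivative_eq_intros\<close>)
  then have d1: "((\<lambda>q. scale_ann (q *\<^sub>R n)) has_field_derivative \<phi>' n) (at r)"
    by (simp add: has_field_derivative_def linear_scale[OF l] mult_commute_abs)
  obtain D where D: "0 < D" "((\<lambda>r. height r t) has_field_derivative D) (at r)"
    using height_deriv[OF r] by blast
  have "((\<lambda>q. exp (height q t) / q) has_field_derivative
      ((exp (height r t) * D) * r - exp (height r t) * 1) / (r * r)) (at r)"
    by (rule DERIV_divide[OF DERIV_chain2[OF DERIV_exp D(2)] DERIV_ident]) (use r in auto)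
  then have "((\<lambda>q. scale_ann (q *\<^sub>R n)) has_field_derivative
      ((exp (height r t) * D) * r - exp (height r t) * 1) / (r * r)) (at r)"
  proof (rule has_field_derivative_transform_within)
    show "0 < r" using r by simp
    fix q assume "dist q r < r"
    then have q: "0 < q" using r by (auto simp: dist_real_def)
    show "exp (height q t) / q = scale_ann (q *\<^sub>R n)"
      using scale_ann_pol[of "ln q" t] q by (simp add: pn)
  qed simp
  with d1 have e: "\<phi>' n = ((exp (height r t) * D) * r - exp (height r t) * 1) / (r * r)"
    by (rule DERIV_unique)
  have "scale_ann y = exp (height r t) / r" using scale_ann_pol[of "ln r" t] t r by simp
  moreover have "\<phi>' y = r * \<phi>' n" unfolding yn using linear_scale[OF l] by simp
  moreover have "r * (((exp (height r t) * D) * r - exp (height r t) * 1) / (r * r))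
      = exp (height r t) * D - exp (height r t) / r"
    using r by (simp add: field_simps)
  ultimately have "scale_ann y + \<phi>' y = exp (height r t) * D" by (simp only: e)
  then show ?thesis using D(1) by (simp add: \<phi>'_def)
qed

lemma diffeo_image: "diffeo ` annulus = polar_region zig 12"
proof (intro equalityI subsetI)
  fix x assume "x \<in> diffeo ` annulus"
  then obtain y where y: "y \<in> annulus" "x = diffeo y" by blast
  obtain t where t: "y = pol (ln (norm y)) t" using annulus_pol[OF y(1)] by blast
  have r: "1 < norm y" "norm y < 2" using y by (auto simp: annulus_def)
  have "exp (ln (norm y)) = norm y" using y(1) by (auto simp: annulus_def intro!: exp_ln)
  then have "x = pol (height (norm y) t) t" using diffeo_pol[of "ln (norm y)" t] t y(2) by metis
  then show "x \<in> polar_region zig 12"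
    using height_strict_mono[of 1 "norm y" t] height_strict_mono[of "norm y" 2 t] r
    by (auto simp: polar_region_def height_1 height_2)
next
  fix x assume "x \<in> polar_region zig 12"
  then obtain s t where st: "x = pol s t" "zig t < s" "s < 12" by (auto simp: polar_region_def)
  obtain r where r: "1 \<le> r" "r \<le> 2" "height r t = s"
    using IVT'[of "\<lambda>r. height r t" 1 s 2] st height_cont[of "{1..2}" t] by (auto simp: height_1 height_2)
  have r': "1 < r" "r < 2" using r st height_1[of t] height_2[of t] by (auto simp: less_le)
  have "diffeo (pol (ln r) t) = x" using diffeo_pol[of "ln r" t] r' r st by simp
  moreover have "pol (ln r) t \<in> annulus" using r' by (simp add: annulus_def)
  ultimately show "x \<in> diffeo ` annulus" by blast
qed

text \<open>Equal images lie on the same ray, and on a ray the image radius is strictly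
  increasing.\<close>

lemma diffeo_inj: "inj_on diffeo annulus"
proof (rule inj_onI)
  fix x y assume xy: "x \<in> annulus" "y \<in> annulus" "diffeo x = diffeo y"
  obtain t where t: "x = pol (ln (norm x)) t" using annulus_pol[OF xy(1)] by blast
  obtain u where u: "y = pol (ln (norm y)) u" using annulus_pol[OF xy(2)] by blast
  have r: "1 < norm x" "norm x < 2" "1 < norm y" "norm y < 2" using xy by (auto simp: annulus_def)
  have en: "exp (ln (norm x)) = norm x" "exp (ln (norm y)) = norm y" using xy(1,2) by (auto simp: annulus_def intro!: exp_ln)
  have "pol (height (norm x) t) t = pol (height (norm y) u) u"
    using xy(3) diffeo_pol[of "ln (norm x)" t] diffeo_pol[of "ln (norm y)" u] t u unfolding en by metis
  then obtain n :: int where n: "height (norm x) t = height (norm y) u" "t = u + 2 * pi * of_int n"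
    by (auto simp: pol_eq_iff)
  have yt: "y = pol (ln (norm y)) t" using u n(2) pol_add_2pi_int by metis
  have "S_ann y = height (norm y) t" "S_ann y = height (norm y) u"
    using S_ann_pol[of "ln (norm y)" t] S_ann_pol[of "ln (norm y)" u] yt u unfolding en by metis+
  then have "height (norm x) t = height (norm y) t" using n(1) by simp
  then have "norm x = norm y"
    using height_strict_mono[of "norm x" "norm y" t] height_strict_mono[of "norm y" "norm x" t] r
    by (cases "norm x" "norm y" rule: linorder_cases) auto
  then show "x = y" using t yt by simp
qed

lemma doubly_connected_polar_region: "doubly_connected (polar_region zig 12)"
proof -
  define G where "G = the_inv_into annulus diffeo"
  define \<phi>' where "\<phi>' y = frechet_derivative scale_ann (at y)" for y
  define D where "D y = scale_ann y + \<phi>' y y" for y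
  have d: "(scale_ann has_derivative \<phi>' y) (at y)" if "y \<in> annulus" for y
    unfolding \<phi>'_def by (rule smooth_on_has_derivative[OF smooth_on_scale_ann that])
  have l: "linear (\<phi>' y)" if "y \<in> annulus" for y using d[OF that] by (rule has_derivative_linear)
  have sm: "smooth_on annulus diffeo"
    unfolding diffeo_def by (intro smooth_on_scaleR smooth_on_scale_ann smooth_on_ident open_annulus)
  have sp: "0 < scale_ann y" if "y \<in> annulus" for y using that by (auto simp: scale_ann_def annulus_def intro!: divide_pos_pos)
  have Dp: "0 < D y" if "y \<in> annulus" for y
    unfolding D_def \<phi>'_def by (rule scale_ann_radial[OF that])
  have GF: "G (diffeo y) = y" if "y \<in> annulus" for y
    unfolding G_def by (rule the_inv_into_f_f[OF diffeo_inj that])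
  have sD: "smooth_on annulus D"
  proof -
    have e: "\<phi>' y y = (\<Sum>b\<in>Basis. (y \<bullet> b) * \<phi>' y b)" if "y \<in> annulus" for y
    proof -
      have "\<phi>' y y = \<phi>' y (\<Sum>b\<in>Basis. (y \<bullet> b) *\<^sub>R b)" by (simp add: euclidean_representation)
      then show ?thesis by (simp add: linear_sum[OF l[OF that]] linear_scale[OF l[OF that]])
    qed
    have "smooth_on annulus (\<lambda>y. scale_ann y + (\<Sum>b\<in>Basis. (y \<bullet> b) * \<phi>' y b))"
      unfolding \<phi>'_def
      by (intro smooth_on_add smooth_on_scale_ann smooth_on_sum smooth_on_mult open_annulus
          smooth_on_inner smooth_on_ident smooth_on_const smooth_on_derivative)
    then show ?thesis
      using smooth_on_cong[OF open_annulus, of D "\<lambda>y. scale_ann y + (\<Sum>b\<in>Basis. (y \<bullet> b) * \<phi>' y b)"] e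
      by (simp add: D_def)
  qed
  have smG: "smooth_on (polar_region zig 12) G"
  \<comment> \<open>The map \<open>A\<close> is the Sherman-Morrison inverse of this rank one
    perturbation; its denominator \<open>D y\<close> is positive by
    \<open>scale_ann_radial\<close>.\<close>
  proof (rule smooth_on_inverse_function[where f = diffeo and S = annulus
        and f' = "\<lambda>y v. scale_ann y *\<^sub>R v + \<phi>' y v *\<^sub>R y"
        and A = "\<lambda>y w. (1 / scale_ann y) *\<^sub>R w - (\<phi>' y w / (scale_ann y * D y)) *\<^sub>R y"])
    show "open (polar_region zig 12)"
    proof (rule open_polar_region[OF zig_cont zig_periodic])
      show "zig t < 12" for t using zig_bounds(2)[of t] by simp
    qed
    fix y assume y: "y \<in> annulus"
    show "(diffeo has_derivative (\<lambda>v. scale_ann y *\<^sub>R v + \<phi>' y v *\<^sub>R y)) (at y)"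
      unfolding diffeo_def
      by (rule has_derivative_eq_rhs, rule has_derivative_scaleR[OF d[OF y] has_derivative_ident]) auto
    show "G (diffeo y) = y" by (rule GF[OF y])
    show "(\<lambda>v. scale_ann y *\<^sub>R v + \<phi>' y v *\<^sub>R y) \<circ>
        (\<lambda>w. (1 / scale_ann y) *\<^sub>R w - (\<phi>' y w / (scale_ann y * D y)) *\<^sub>R y) = id"
    proof (rule ext)
      fix w
      have s0: "scale_ann y \<noteq> 0" "D y \<noteq> 0" using sp[OF y] Dp[OF y] by auto
      let ?v = "(1 / scale_ann y) *\<^sub>R w - (\<phi>' y w / (scale_ann y * D y)) *\<^sub>R y"
      have "\<phi>' y ?v = \<phi>' y w / scale_ann y - (\<phi>' y w / (scale_ann y * D y)) * (D y - scale_ann y)"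
        by (simp add: linear_diff[OF l[OF y]] linear_scale[OF l[OF y]] D_def)
      also have "\<dots> = \<phi>' y w / D y" using s0 by (simp add: field_simps)
      finally have v: "\<phi>' y ?v = \<phi>' y w / D y" .
      have "scale_ann y *\<^sub>R ?v + \<phi>' y ?v *\<^sub>R y = w"
        unfolding v using s0 by (simp add: scaleR_diff_right)
      then show "((\<lambda>v. scale_ann y *\<^sub>R v + \<phi>' y v *\<^sub>R y) \<circ>
        (\<lambda>w. (1 / scale_ann y) *\<^sub>R w - (\<phi>' y w / (scale_ann y * D y)) *\<^sub>R y)) w = id w" by simp
    qed
  next
    fix b :: "real^2" assume b: "b \<in> Basis"
    have "scale_ann y \<noteq> 0" "scale_ann y * D y \<noteq> 0" if "y \<in> annulus" for y
      using sp[OF that] Dp[OF that] by auto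
    then show "smooth_on annulus (\<lambda>y. (1 / scale_ann y) *\<^sub>R b - (\<phi>' y b / (scale_ann y * D y)) *\<^sub>R y)"
      unfolding \<phi>'_def
      by (intro smooth_on_diff smooth_on_scaleR smooth_on_divide smooth_on_const smooth_on_scale_ann
          smooth_on_mult sD smooth_on_ident open_annulus smooth_on_derivative b) auto
  qed (use open_annulus diffeo_image in auto)
  show ?thesis
    unfolding doubly_connected_def diffeomorphic_def annulus_def[symmetric]
  proof (rule exI[of _ G], rule exI[of _ diffeo], intro conjI ballI)
    show "G ` polar_region zig 12 = annulus"
      using GF by (force simp flip: diffeo_image)
    show "diffeo (G x) = x" if "x \<in> polar_region zig 12" for x
      using that GF by (auto simp flip: diffeo_image)
  qed (use sm smG diffeo_image GF in auto)
qed

subsection \<open>The boundary and fiber inequalities\<close>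

lemma integral_Cauchy_Schwarz:
  fixes p q :: "real \<Rightarrow> real"
  assumes p: "continuous_on {a..b} p" and q: "continuous_on {a..b} q"
  shows "(integral {a..b} (\<lambda>x. p x * q x))\<^sup>2 \<le> integral {a..b} (\<lambda>x. (p x)\<^sup>2) * integral {a..b} (\<lambda>x. (q x)\<^sup>2)"
proof -
  define A B C where "A = integral {a..b} (\<lambda>x. (q x)\<^sup>2)" and "B = integral {a..b} (\<lambda>x. p x * q x)"
    and "C = integral {a..b} (\<lambda>x. (p x)\<^sup>2)"
  have i: "(\<lambda>x. (q x)\<^sup>2) integrable_on {a..b}" "(\<lambda>x. p x * q x) integrable_on {a..b}" "(\<lambda>x. (p x)\<^sup>2) integrable_on {a..b}"
    by (intro integrable_continuous_real continuous_on_power continuous_on_mult p q)+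
  have Q: "0 \<le> A - 2 * t * B + t\<^sup>2 * C" for t
  proof -
    have "((\<lambda>x. (q x)\<^sup>2 - (2 * t) * (p x * q x) + t\<^sup>2 * (p x)\<^sup>2) has_integral (A - (2 * t) * B + t\<^sup>2 * C)) {a..b}"
      unfolding A_def B_def C_def
      by (intro has_integral_add has_integral_diff has_integral_mult_right integrable_integral i)
    moreover have "(q x)\<^sup>2 - (2 * t) * (p x * q x) + t\<^sup>2 * (p x)\<^sup>2 = (q x - t * p x)\<^sup>2" for x
      by (simp add: power2_eq_square algebra_simps)
    ultimately have "((\<lambda>x. (q x - t * p x)\<^sup>2) has_integral (A - (2 * t) * B + t\<^sup>2 * C)) {a..b}"
      by (simp only:)
    from has_integral_nonneg[OF this] show ?thesis by simp
  qed
  have C: "0 \<le> C" unfolding C_def by (rule integral_nonneg[OF i(3)]) simp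
  have "B\<^sup>2 \<le> C * A"
  proof (cases "C = 0")
    case True
    have "B = 0"
    proof (rule ccontr)
      assume "B \<noteq> 0"
      then show False using Q[of "(A + 1) / (2 * B)"] True by (simp add: field_simps)
    qed
    then show ?thesis using True by simp
  next
    case False
    then have "C > 0" using C by simp
    then show ?thesis using Q[of "B / C"] by (simp add: field_simps power2_eq_square)
  qed
  then show ?thesis by (simp add: A_def B_def C_def)
qed

text \<open>Writes the boundary form of a linear function with end values \<open>A\<close> at
  \<open>-l\<close> and \<open>B\<close> at 12 through its value at 0 and its slope. The mixed terms
  cancel because the weights \<open>1 / l\<close> and \<open>1 / 12\<close> make constants and
  \<open>s\<close> orthogonal.\<close>

lemma fiber_identity:
  fixes A B l :: real
  assumes "0 < l"
  shows "A\<^sup>2 / l + B\<^sup>2 / 12 =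
    ((12 * A + l * B) / (12 + l))\<^sup>2 * (1 / l + 1 / 12) + ((B - A) / (12 + l))\<^sup>2 * (12 + l)"
proof -
  define k where "k = 12 + l"
  have k: "k > 0" "k = 12 + l" using assms by (auto simp: k_def)
  have "((12 * A + l * B) / k)\<^sup>2 * (1 / l + 1 / 12) + ((B - A) / k)\<^sup>2 * k
    = ((12 * A + l * B)\<^sup>2 + (B - A)\<^sup>2 * (12 * l)) / (12 * l * k)"
    using assms k(1) by (simp add: power_divide divide_simps k(2) power2_eq_square)
  also have "(12 * A + l * B)\<^sup>2 + (B - A)\<^sup>2 * (12 * l) = (12 * A\<^sup>2 + l * B\<^sup>2) * k"
    by (simp add: k(2) power2_eq_square algebra_simps)
  also have "(12 * A\<^sup>2 + l * B\<^sup>2) * k / (12 * l * k) = A\<^sup>2 / l + B\<^sup>2 / 12"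
    using assms k(1) by (simp add: field_simps)
  finally show ?thesis by (simp add: k_def)
qed

text \<open>Splitting \<open>f\<close> into its linear interpolation and a remainder vanishing at both ends, the only
  negative contribution is the square of the interpolated value at 0, which is compared with the mean
  of \<open>f\<close> over the central interval.\<close>

lemma fiber_inequality:
  fixes f f' :: "real \<Rightarrow> real"
  assumes l: "12 \<le> l" "l \<le> 16"
    and d: "\<And>s. s \<in> {-l..12} \<Longrightarrow> (f has_field_derivative f' s) (at s within {-l..12})"
    and c: "continuous_on {-l..12} f'"
  shows "(f (- l))\<^sup>2 / l + (f 12)\<^sup>2 / 12
    \<le> integral {-l..12} (\<lambda>s. (f' s)\<^sup>2) + (1/3) * ((1/24) * integral {-12..12} f)\<^sup>2"
proof -
  define A B D M where "A = f (- l)" and "B = f 12" and "D = (B - A) / (12 + l)"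
    and "M = (1/24) * integral {-12..12} f"
  \<comment> \<open>\<open>D\<close> is the slope of the linear interpolation and \<open>Im\<close>
    its value at 0; \<open>q\<close> below is the derivative of the remainder, whose integral is 0
    because the remainder vanishes at both ends.\<close>
  define Im where "Im = (12 * A + l * B) / (12 + l)"
  define q where "q s = f' s - D" for s
  have qc: "continuous_on {-l..12} q" unfolding q_def by (intro continuous_intros c)
  have sub: "{-l..-12} \<subseteq> {-l..12}" "{-12..12} \<subseteq> {-l..12}" using l by auto
  have d': "(f has_vector_derivative f' s) (at s within S)" if "s \<in> S" "S \<subseteq> {-l..12}" for s S
    using d[of s] that has_field_derivative_subset has_real_derivative_iff_has_vector_derivative by blast
  have fi: "(f' has_integral (B - A)) {-l..12}"
    unfolding A_def B_def using l by (intro fundamental_theorem_of_calculus d') auto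
  have fi1: "(f' has_integral (f (-12) - A)) {-l..-12}"
    unfolding A_def using l by (intro fundamental_theorem_of_calculus d' sub) auto
  have q0: "(q has_integral 0) {-l..12}"
  proof -
    have "(q has_integral (B - A) - D * (12 + l)) {-l..12}"
      unfolding q_def using has_integral_diff[OF fi has_integral_const_real[of D "-l" 12]] l by (simp add: mult.commute)
    moreover have "D * (12 + l) = B - A" using l by (simp add: D_def)
    ultimately show ?thesis by simp
  qed
  have q2i: "(\<lambda>s. (q s)\<^sup>2) integrable_on {u..v}" if "-l \<le> u" "v \<le> 12" for u v
    by (intro integrable_continuous_real continuous_on_power continuous_on_subset[OF qc]) (use that in auto)
  define X Y where "X = integral {-l..-12} (\<lambda>s. (q s)\<^sup>2)" and "Y = integral {-12..12} (\<lambda>s. (q s)\<^sup>2)"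
  have XY0: "0 \<le> X" "0 \<le> Y" unfolding X_def Y_def using l by (intro integral_nonneg q2i; simp)+
  have Q: "integral {-l..12} (\<lambda>s. (q s)\<^sup>2) = X + Y"
    unfolding X_def Y_def using l by (intro Henstock_Kurzweil_Integration.integral_combine[symmetric] q2i) auto
  have E: "integral {-l..12} (\<lambda>s. (f' s)\<^sup>2) = X + Y + D\<^sup>2 * (12 + l)"
  proof -
    have "((\<lambda>s. (q s)\<^sup>2 + (2 * D) * q s + D\<^sup>2) has_integral ((X + Y) + (2 * D) * 0 + (12 + l) *\<^sub>R D\<^sup>2)) {-l..12}"
      unfolding Q[symmetric]
      using l has_integral_const_real[of "D\<^sup>2" "-l" 12]
      by (intro has_integral_add has_integral_mult_right q0 integrable_integral q2i) (auto simp: add.commute)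
    moreover have "(q s)\<^sup>2 + (2 * D) * q s + D\<^sup>2 = (f' s)\<^sup>2" for s
      by (simp add: q_def power2_eq_square algebra_simps)
    ultimately have "((\<lambda>s. (f' s)\<^sup>2) has_integral ((X + Y) + (2 * D) * 0 + (12 + l) *\<^sub>R D\<^sup>2)) {-l..12}" by simp
    from integral_unique[OF this] show ?thesis by (simp add: mult.commute)
  qed
  \<comment> \<open>Integration by parts expresses the difference between \<open>Im\<close> and the
    mean \<open>M\<close> through these two moments of \<open>q\<close>; Cauchy-Schwarz then
    controls them by the energy of the remainder.\<close>
  define r1 r2 where "r1 = integral {-l..-12} q" and "r2 = integral {-12..12} (\<lambda>s. s * q s)"
  have r1: "r1 = f (-12) - A - D * (l - 12)"
  proof -
    have "(q has_integral (f (-12) - A) - D * (l - 12)) {-l..-12}"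
      unfolding q_def using has_integral_diff[OF fi1 has_integral_const_real[of D "-l" "-12"]] l by (simp add: mult.commute)
    then show ?thesis unfolding r1_def by (rule integral_unique)
  qed
  have r2: "integral {-12..12} f = 12 * B + 12 * f (-12) - r2"
  proof -
    have fc: "continuous_on {-12..12} f"
      by (rule DERIV_continuous_on) (use d sub has_field_derivative_subset in blast)
    have "((\<lambda>s. s * f' s + 1 * f s) has_integral (12 * f 12 - (-12) * f (-12))) {-12..12}"
    proof (rule fundamental_theorem_of_calculus)
      fix s :: real assume s: "s \<in> {-12..12}"
      have "(f has_field_derivative f' s) (at s within {-12..12})"
        using d sub s has_field_derivative_subset by blast
      then show "((\<lambda>s. s * f s) has_vector_derivative s * f' s + 1 * f s) (at s within {-12..12})"
        unfolding has_real_derivative_iff_has_vector_derivative[symmetric]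
        by (auto intro!: derivative_eq_intros)
    qed simp
    moreover have sq: "(\<lambda>s. s * q s) integrable_on {-12..12}"
      by (intro integrable_continuous_real continuous_intros continuous_on_subset[OF qc sub(2)])
    then have "((\<lambda>s. s * q s) has_integral r2) {-12..12}" unfolding r2_def by (rule integrable_integral)
    moreover have "((\<lambda>s. s * D) has_integral (12\<^sup>2 / 2 * D - (-12)\<^sup>2 / 2 * D)) {-12..12}"
      by (rule fundamental_theorem_of_calculus)
        (auto intro!: derivative_eq_intros simp: has_real_derivative_iff_has_vector_derivative[symmetric])
    ultimately have "((\<lambda>s. (s * f' s + 1 * f s) - s * q s - s * D) has_integral
        ((12 * f 12 - (-12) * f (-12)) - r2 - (12\<^sup>2 / 2 * D - (-12)\<^sup>2 / 2 * D))) {-12..12}"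
      by (intro has_integral_diff)
    moreover have "(s * f' s + 1 * f s) - s * q s - s * D = f s" for s by (simp add: q_def algebra_simps)
    ultimately have "(f has_integral ((12 * f 12 - (-12) * f (-12)) - r2 - (12\<^sup>2 / 2 * D - (-12)\<^sup>2 / 2 * D))) {-12..12}" by (simp only:)
    from integral_unique[OF this] show ?thesis by (simp add: B_def)
  qed
  have ImD: "Im = A + l * D" and Bm: "B = A + (12 + l) * D"
    using l by (simp_all add: Im_def D_def field_simps)
  have "24 * Im = integral {-12..12} f - 12 * r1 + r2"
    unfolding ImD r2 r1 Bm by (simp add: algebra_simps)
  then have Im: "Im = M - r1 / 2 + r2 / 24"
    unfolding M_def by linarith
  have r1sq: "r1\<^sup>2 \<le> (l - 12) * X"
    using integral_Cauchy_Schwarz[of "-l" "-12" "\<lambda>_. 1" q] l continuous_on_subset[OF qc sub(1)]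
    by (simp add: r1_def X_def)
  have r2sq: "r2\<^sup>2 \<le> 1152 * Y"
  proof -
    have "((\<lambda>s. s\<^sup>2) has_integral (12 ^ 3 / 3 - (-12) ^ 3 / 3)) {-12..12::real}"
      by (rule fundamental_theorem_of_calculus)
        (auto intro!: derivative_eq_intros simp: has_real_derivative_iff_has_vector_derivative[symmetric] power2_eq_square)
    then have "integral {-12..12::real} (\<lambda>s. s\<^sup>2) = 1152" by (simp add: integral_unique)
    then show ?thesis
      using integral_Cauchy_Schwarz[of "-12" 12 "\<lambda>s. s" q] continuous_on_subset[OF qc sub(2)]
      by (simp add: r2_def Y_def continuous_on_id)
  qed
  \<comment> \<open>The scaling turns the moment bounds into \<open>a\<^sup>2 \<le> X\<close>, from
    \<open>l - 12 \<le> 4\<close>, and \<open>b\<^sup>2 \<le> 2 * Y\<close>, from 1152 = 2 * 24 *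
    24.\<close>
  define a b where "a = r1 / 2" and "b = r2 / 24"
  have a2: "a\<^sup>2 \<le> X"
  proof -
    have "(l - 12) * X \<le> 4 * X" using l XY0 by (intro mult_right_mono) auto
    then show ?thesis using r1sq by (simp add: a_def power_divide)
  qed
  have b2: "b\<^sup>2 \<le> 2 * Y" using r2sq by (simp add: b_def power_divide)
  \<comment> \<open>This square gives
    \<open>(a - b)\<^sup>2 \<le> 3 * a\<^sup>2 + (3/2) * b\<^sup>2\<close>, the weighting that
    matches the two bounds.\<close>
  have "0 \<le> (2 * a + b)\<^sup>2" by simp
  then have ab: "(a - b)\<^sup>2 \<le> 3 * (X + Y)" using a2 b2 by (simp add: power2_eq_square algebra_simps)
  have ImM: "Im = M - (a - b)" using Im by (simp add: a_def b_def)
  have "Im\<^sup>2 + (M + (a - b))\<^sup>2 = 2 * M\<^sup>2 + 2 * (a - b)\<^sup>2"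
    unfolding ImM by (simp add: power2_eq_square algebra_simps)
  then have I2: "Im\<^sup>2 \<le> 2 * M\<^sup>2 + 6 * (X + Y)"
    using ab zero_le_power2[of "M + (a - b)"] by linarith
  \<comment> \<open>With the weight at most 1/6, the term \<open>6 * (X + Y)\<close> is exactly paid
    by the energy of the remainder, and \<open>2 * M\<^sup>2\<close> leaves the coefficient
    1/3.\<close>
  have w: "1 / l + 1 / 12 \<le> 1 / 6" "0 \<le> 1 / l + 1 / 12"
  proof -
    have "1 / l \<le> 1 / 12" "0 \<le> 1 / l" using l by (auto intro!: divide_left_mono)
    then show "1 / l + 1 / 12 \<le> 1 / 6" "0 \<le> 1 / l + 1 / 12" by linarith+
  qed
  have "A\<^sup>2 / l + B\<^sup>2 / 12 = Im\<^sup>2 * (1 / l + 1 / 12) + D\<^sup>2 * (12 + l)"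
    unfolding Im_def D_def by (rule fiber_identity) (use l in simp)
  also have "Im\<^sup>2 * (1 / l + 1 / 12) \<le> Im\<^sup>2 * (1 / 6)" using w by (intro mult_left_mono) auto
  also have "\<dots> \<le> (2 * M\<^sup>2 + 6 * (X + Y)) * (1 / 6)" using I2 by (intro mult_right_mono) auto
  finally have "A\<^sup>2 / l + B\<^sup>2 / 12 \<le> (2 * M\<^sup>2 + 6 * (X + Y)) * (1 / 6) + D\<^sup>2 * (12 + l)" by simp
  then show ?thesis unfolding E A_def[symmetric] B_def[symmetric] M_def[symmetric] by (simp add: algebra_simps)
qed

lemma increment_square_le:
  fixes f f' :: "real \<Rightarrow> real"
  assumes ab: "a \<le> x" "x \<le> b"
    and d: "\<And>s. s \<in> {a..b} \<Longrightarrow> (f has_field_derivative f' s) (at s within {a..b})"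
    and c: "continuous_on {a..b} f'"
  shows "(f x - f a)\<^sup>2 \<le> (b - a) * integral {a..b} (\<lambda>s. (f' s)\<^sup>2)"
    and "(f b - f x)\<^sup>2 \<le> (b - a) * integral {a..b} (\<lambda>s. (f' s)\<^sup>2)"
proof -
  have key: "(f v - f u)\<^sup>2 \<le> (b - a) * integral {a..b} (\<lambda>s. (f' s)\<^sup>2)" if uv: "a \<le> u" "u \<le> v" "v \<le> b" for u v
  proof -
    have sub: "{u..v} \<subseteq> {a..b}" using uv by auto
    have "(f' has_integral (f v - f u)) {u..v}"
    proof (rule fundamental_theorem_of_calculus[OF uv(2)])
      fix s assume "s \<in> {u..v}"
      then show "(f has_vector_derivative f' s) (at s within {u..v})"
        using d sub has_field_derivative_subset has_real_derivative_iff_has_vector_derivative by blast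
    qed
    then have "(f v - f u)\<^sup>2 = (integral {u..v} (\<lambda>s. 1 * f' s))\<^sup>2" by (simp add: integral_unique)
    also have "\<dots> \<le> integral {u..v} (\<lambda>s. 1\<^sup>2) * integral {u..v} (\<lambda>s. (f' s)\<^sup>2)"
      by (rule integral_Cauchy_Schwarz) (auto intro: continuous_on_subset[OF c sub])
    also have "\<dots> = (v - u) * integral {u..v} (\<lambda>s. (f' s)\<^sup>2)" using uv by simp
    also have "\<dots> \<le> (b - a) * integral {a..b} (\<lambda>s. (f' s)\<^sup>2)"
    proof (rule mult_mono)
      show "integral {u..v} (\<lambda>s. (f' s)\<^sup>2) \<le> integral {a..b} (\<lambda>s. (f' s)\<^sup>2)"
        by (rule integral_subset_le[OF sub])
          (auto intro!: integrable_continuous_real continuous_intros continuous_on_subset[OF c] c sub)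
      show "0 \<le> integral {u..v} (\<lambda>s. (f' s)\<^sup>2)"
        by (rule integral_nonneg)
          (auto intro!: integrable_continuous_real continuous_intros continuous_on_subset[OF c] sub)
    qed (use uv in auto)
    finally show ?thesis .
  qed
  show "(f x - f a)\<^sup>2 \<le> (b - a) * integral {a..b} (\<lambda>s. (f' s)\<^sup>2)" using key[of a x] ab by simp
  show "(f b - f x)\<^sup>2 \<le> (b - a) * integral {a..b} (\<lambda>s. (f' s)\<^sup>2)" using key[of x b] ab by simp
qed

section \<open>Arc length on the two boundary curves\<close>

lemma pol_Lipschitz:
  assumes "s \<le> 12" "s' \<le> 12"
  shows "dist (pol s t) (pol s' t') \<le> 2 * exp 12 * (\<bar>s - s'\<bar> + \<bar>t - t'\<bar>)"
proof -
  define S where "S = {v::real^2. v $ 1 \<le> 12}"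
  have "convex S"
  proof -
    have "S = {v. axis 1 1 \<bullet> v \<le> 12}" by (auto simp: S_def inner_axis')
    then show ?thesis by (simp add: convex_halfspace_le)
  qed
  then have "norm (pol ((vector [s, t] :: real^2) $ 1) ((vector [s, t] :: real^2) $ 2)
      - pol ((vector [s', t'] :: real^2) $ 1) ((vector [s', t'] :: real^2) $ 2))
      \<le> 2 * exp 12 * norm (vector [s, t] - vector [s', t'] :: real^2)"
  proof (rule differentiable_bound[of S "\<lambda>v. pol (v $ 1) (v $ 2)"])
    fix v :: "real^2" assume v: "v \<in> S"
    show "((\<lambda>v. pol (v $ 1) (v $ 2)) has_derivative
        (\<lambda>h. h $ 1 *\<^sub>R pol (v $ 1) (v $ 2) + h $ 2 *\<^sub>R pol' (v $ 1) (v $ 2))) (at v within S)"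
      by (rule has_derivative_pol)
    show "onorm (\<lambda>h::real^2. h $ 1 *\<^sub>R pol (v $ 1) (v $ 2) + h $ 2 *\<^sub>R pol' (v $ 1) (v $ 2)) \<le> 2 * exp 12"
    proof (rule onorm_le)
      fix h :: "real^2"
      have "norm (h $ 1 *\<^sub>R pol (v $ 1) (v $ 2) + h $ 2 *\<^sub>R pol' (v $ 1) (v $ 2))
          \<le> \<bar>h $ 1\<bar> * exp (v $ 1) + \<bar>h $ 2\<bar> * exp (v $ 1)"
        using norm_triangle_ineq[of "h $ 1 *\<^sub>R pol (v $ 1) (v $ 2)" "h $ 2 *\<^sub>R pol' (v $ 1) (v $ 2)"] by simp
      also have "\<dots> \<le> norm h * exp 12 + norm h * exp 12"
        using v component_le_norm_cart[of h] by (intro add_mono mult_mono) (auto simp: S_def)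
      finally show "norm (h $ 1 *\<^sub>R pol (v $ 1) (v $ 2) + h $ 2 *\<^sub>R pol' (v $ 1) (v $ 2)) \<le> 2 * exp 12 * norm h"
        by (simp add: mult.commute)
    qed
  qed (use assms in \<open>auto simp: S_def\<close>)
  also have "norm (vector [s, t] - vector [s', t'] :: real^2) \<le> \<bar>s - s'\<bar> + \<bar>t - t'\<bar>"
    using norm_le_l1_cart[of "vector [s, t] - vector [s', t'] :: real^2"] by (simp add: sum_2)
  finally show ?thesis by (simp add: dist_norm)
qed

abbreviation Om :: "(real^2) set" where "Om \<equiv> polar_region zig 12"

lemma zig_less_12: "zig t < 12" using zig_bounds(2)[of t] by simp

lemmas Om_facts = zig_cont[of UNIV] zig_periodic zig_less_12

lemma inner_boundary_integral:
  fixes F :: "real^2 \<Rightarrow> real"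
  assumes F: "continuous_on ((\<lambda>t. pol (zig t) t) ` {0..2 * pi}) F"
  shows "set_integrable (hausdorff_measure 1) ((\<lambda>t. pol (zig t) t) ` {0..2 * pi}) F"
    and "((\<lambda>t. F (pol (zig t) t) * (1 / (sg * - zig t))) has_integral
      (LINT x:(\<lambda>t. pol (zig t) t) ` {0..2 * pi}|hausdorff_measure 1. F x)) {0..2 * pi}"
    and "emeasure (hausdorff_measure 1) ((\<lambda>t. pol (zig t) t) ` {0..2 * pi}) < \<infinity>"
proof -
  let ?\<gamma> = "\<lambda>t. pol (zig t) t"
  define C where "C = 2 * exp 12 * (real teeth + 1)"
  have C: "0 \<le> C" by (simp add: C_def)
  have inj: "inj_on ?\<gamma> {0..<2 * pi}" by (rule inj_on_polar_curve[OF Om_facts])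
  have cl: "?\<gamma> (2 * pi) = ?\<gamma> 0" using zig_periodic[of 0] pol_add_2pi_int[of "zig 0" 0 1] by simp
  have lip: "dist (?\<gamma> x) (?\<gamma> y) \<le> C * \<bar>x - y\<bar>" for x y
  proof -
    have "dist (?\<gamma> x) (?\<gamma> y) \<le> 2 * exp 12 * (\<bar>zig x - zig y\<bar> + \<bar>x - y\<bar>)"
      by (rule pol_Lipschitz) (use zig_less_12 less_imp_le in auto)
    also have "\<dots> \<le> 2 * exp 12 * (real teeth * \<bar>x - y\<bar> + \<bar>x - y\<bar>)"
      using zig_Lipschitz[of x y] by (intro mult_left_mono add_mono) auto
    finally show ?thesis by (simp add: C_def algebra_simps)
  qed
  have v: "0 < 1 / (sg * - zig t)" for t using sg_bounds zig_bounds(2)[of t] by (simp add: mult_pos_neg)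
  have loc: "\<exists>\<delta>>0. \<forall>x\<in>ball t \<delta>. \<forall>y\<in>ball t \<delta>. \<bar>dist (?\<gamma> x) (?\<gamma> y) - (1 / (sg * - zig t)) * \<bar>x - y\<bar>\<bar> \<le> \<epsilon> * \<bar>x - y\<bar>"
    if t: "t \<in> {0<..<2 * pi} - corners \<inter> {0..2 * pi}" and \<epsilon>: "0 < \<epsilon>" for t \<epsilon>
  proof -
    have tc: "t \<notin> corners" using t by auto
    show ?thesis
      unfolding norm_zig_curve_deriv[OF tc, symmetric]
    proof (rule distance_scaling_of_C1[OF open_noncorners _ _ _ \<epsilon>])
      show "t \<in> - corners" using tc by simp
      show "(?\<gamma> has_vector_derivative zig' x *\<^sub>R pol (zig x) x + pol' (zig x) x) (at x)" if "x \<in> - corners" for x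
        by (rule zig_curve_deriv) (use that in simp)
      show "continuous_on (- corners) (\<lambda>x. zig' x *\<^sub>R pol (zig x) x + pol' (zig x) x)"
        by (intro continuous_intros zig'_cont zig_cont)
    qed
  qed
  note L = hausdorff_line_integral[where \<gamma> = ?\<gamma> and a = 0 and b = "2 * pi" and F = F
      and v = "\<lambda>t. 1 / (sg * - zig t)", OF _ inj cl C _ finite_corners]
  show "set_integrable (hausdorff_measure 1) (?\<gamma> ` {0..2 * pi}) F"
    by (rule L(1)) ((rule F | rule lip | rule v | (rule loc, assumption, assumption) | simp)+)
  show "((\<lambda>t. F (?\<gamma> t) * (1 / (sg * - zig t))) has_integral
      (LINT x:?\<gamma> ` {0..2 * pi}|hausdorff_measure 1. F x)) {0..2 * pi}"
    by (rule L(2)) ((rule F | rule lip | rule v | (rule loc, assumption, assumption) | simp)+)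
  show "emeasure (hausdorff_measure 1) (?\<gamma> ` {0..2 * pi}) < \<infinity>"
    by (rule L(3)) ((rule F | rule lip | rule v | (rule loc, assumption, assumption) | simp)+)
qed

lemma outer_boundary_integral:
  fixes F :: "real^2 \<Rightarrow> real"
  assumes F: "continuous_on ((\<lambda>t. pol 12 t) ` {0..2 * pi}) F"
  shows "set_integrable (hausdorff_measure 1) ((\<lambda>t. pol 12 t) ` {0..2 * pi}) F"
    and "((\<lambda>t. F (pol 12 t) * exp 12) has_integral
      (LINT x:(\<lambda>t. pol 12 t) ` {0..2 * pi}|hausdorff_measure 1. F x)) {0..2 * pi}"
    and "emeasure (hausdorff_measure 1) ((\<lambda>t. pol 12 t) ` {0..2 * pi}) < \<infinity>"
proof -
  let ?\<gamma> = "\<lambda>t. pol 12 t"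
  have inj: "inj_on ?\<gamma> {0..<2 * pi}" by (rule inj_on_polar_curve[OF Om_facts])
  have cl: "?\<gamma> (2 * pi) = ?\<gamma> 0" using pol_add_2pi_int[of 12 0 1] by simp
  have lip: "dist (?\<gamma> x) (?\<gamma> y) \<le> 2 * exp 12 * \<bar>x - y\<bar>" for x y
    using pol_Lipschitz[of 12 12 x y] by simp
  have dp: "(?\<gamma> has_vector_derivative pol' 12 x) (at x)" for x
    unfolding pol_decomp by (auto intro!: derivative_eq_intros simp: algebra_simps)
  have loc: "\<exists>\<delta>>0. \<forall>x\<in>ball t \<delta>. \<forall>y\<in>ball t \<delta>. \<bar>dist (?\<gamma> x) (?\<gamma> y) - exp 12 * \<bar>x - y\<bar>\<bar> \<le> \<epsilon> * \<bar>x - y\<bar>"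
    if \<epsilon>: "0 < \<epsilon>" for t \<epsilon>
    using distance_scaling_of_C1[OF open_UNIV _ dp _ \<epsilon>, of t] continuous_on_pol(2)[of UNIV "\<lambda>_. 12" "\<lambda>t. t"]
    by (simp add: continuous_on_id)
  note L = hausdorff_line_integral[where \<gamma> = ?\<gamma> and a = 0 and b = "2 * pi" and F = F and X = "{}"
      and v = "\<lambda>_. exp 12" and C = "2 * exp 12", OF _ inj cl]
  show "set_integrable (hausdorff_measure 1) (?\<gamma> ` {0..2 * pi}) F"
    by (rule L(1)) ((rule F | rule lip | (rule loc, assumption) | simp)+)
  show "((\<lambda>t. F (?\<gamma> t) * exp 12) has_integral
      (LINT x:?\<gamma> ` {0..2 * pi}|hausdorff_measure 1. F x)) {0..2 * pi}"
    by (rule L(2)) ((rule F | rule lip | (rule loc, assumption) | simp)+)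
  show "emeasure (hausdorff_measure 1) (?\<gamma> ` {0..2 * pi}) < \<infinity>"
    by (rule L(3)) ((rule F | rule lip | (rule loc, assumption) | simp)+)
qed

lemma boundary_measure_Om: "boundary_measure Om = restrict_space (hausdorff_measure 1) (frontier Om)"
  by (simp add: boundary_measure_def)

text \<open>After multiplication by \<open>sg\<close> the length measure becomes
  \<open>dt / \<bar>s\<bar>\<close> on both curves: by the construction of the zigzag on the inner
  one, and because \<open>sg * exp 12 = 1 / 12\<close> on the outer one.\<close>

lemma boundary_integral:
  fixes F :: "real^2 \<Rightarrow> real"
  assumes F: "continuous_on (frontier Om) F"
  shows "((\<lambda>t. F (pol (zig t) t) / (- zig t) + F (pol 12 t) / 12) has_integral
      (sg * (LINT x|boundary_measure Om. F x))) {0..2 * pi}"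
    and "finite_measure (boundary_measure Om)" and "integrable (boundary_measure Om) F"
proof -
  let ?A = "(\<lambda>t. pol (zig t) t) ` {0..2 * pi}" and ?B = "(\<lambda>t. pol 12 t) ` {0..2 * pi}"
  let ?H = "hausdorff_measure 1 :: (real^2) measure"
  have fr: "frontier Om = ?A \<union> ?B" by (rule frontier_polar_region[OF Om_facts])
  have FA: "continuous_on ?A F" and FB: "continuous_on ?B F" using F by (auto simp: fr intro: continuous_on_subset)
  have cAB: "compact ?A" "compact ?B"
    by (auto intro!: compact_continuous_image continuous_intros zig_cont)
  then have AB: "?A \<in> sets ?H" "?B \<in> sets ?H"
    by (simp_all add: borel_closed compact_imp_closed del: One_nat_def)
  have frs: "frontier Om \<inter> space ?H \<in> sets ?H" unfolding fr using AB by simp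
  have si: "set_integrable ?H (?A \<union> ?B) F"
    by (rule set_integrable_Un[OF inner_boundary_integral(1)[OF FA] outer_boundary_integral(1)[OF FB] AB])
  have I: "(LINT x|boundary_measure Om. F x) = (LINT x:?A|?H. F x) + (LINT x:?B|?H. F x)"
  proof -
    have "(LINT x|boundary_measure Om. F x) = (LINT x:?A \<union> ?B|?H. F x)"
      unfolding boundary_measure_Om set_lebesgue_integral_def fr[symmetric]
      by (rule integral_restrict_space[OF frs])
    also have "\<dots> = (LINT x:?A|?H. F x) + (LINT x:?B|?H. F x)"
      by (rule set_integral_Un[OF disjoint_boundary_curves[OF Om_facts] inner_boundary_integral(1)[OF FA] outer_boundary_integral(1)[OF FB]])
    finally show ?thesis .
  qed
  show "integrable (boundary_measure Om) F"
    unfolding boundary_measure_Om integrable_restrict_space[OF frs] using si by (simp add: set_integrable_def fr)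
  show "finite_measure (boundary_measure Om)"
  proof (rule finite_measureI)
    have "emeasure ?H (?A \<union> ?B) \<le> emeasure ?H ?A + emeasure ?H ?B" by (rule emeasure_subadditive[OF AB])
    also have "\<dots> < \<infinity>" using inner_boundary_integral(3)[OF FA] outer_boundary_integral(3)[OF FB] by simp
    finally show "emeasure (boundary_measure Om) (space (boundary_measure Om)) \<noteq> \<infinity>"
      unfolding boundary_measure_Om using frs by (simp add: emeasure_restrict_space space_restrict_space fr)
  qed
  have "((\<lambda>t. sg * (F (pol (zig t) t) * (1 / (sg * - zig t)) + F (pol 12 t) * exp 12)) has_integral
      (sg * (LINT x|boundary_measure Om. F x))) {0..2 * pi}"
    unfolding I
    by (intro has_integral_mult_right has_integral_add inner_boundary_integral(2)[OF FA] outer_boundary_integral(2)[OF FB])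
  moreover have "sg * (F (pol (zig t) t) * (1 / (sg * - zig t)) + F (pol 12 t) * exp 12)
      = F (pol (zig t) t) / (- zig t) + F (pol 12 t) / 12" for t
  proof -
    have "sg * exp 12 = 1 / 12" by (simp add: sg_def mult_exp_exp)
    moreover have "sg * (F (pol (zig t) t) * (1 / (sg * - zig t))) = F (pol (zig t) t) / (- zig t)"
      using sg_bounds by simp
    moreover have "sg * (x + y * exp 12) = sg * x + (sg * exp 12) * y" for x y by (simp add: algebra_simps)
    ultimately show ?thesis by (simp only:)
  qed
  ultimately show "((\<lambda>t. F (pol (zig t) t) / (- zig t) + F (pol 12 t) / 12) has_integral
      (sg * (LINT x|boundary_measure Om. F x))) {0..2 * pi}" by simp
qed

subsection \<open>The energy inequality\<close>

lemma closure_Om: "closure Om = polar_closure zig 12"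
  by (rule closure_polar_region[OF Om_facts])

lemma pol_mem_closure_Om: "pol s t \<in> closure Om \<longleftrightarrow> zig t \<le> s \<and> s \<le> 12"
  unfolding closure_Om by (rule pol_mem_polar_closure[OF Om_facts])

lemma frontier_Om_subset: "frontier Om \<subseteq> closure Om" by (simp add: frontier_def)

lemma zero_notin_closure_Om: "0 \<notin> closure Om"
  by (auto simp: closure_Om polar_closure_def)

context
  fixes U :: "(real^2) set" and F :: "real^2 \<Rightarrow> real"
  assumes U: "open U" "closure Om \<subseteq> U" "smooth_on U F"
begin

text \<open>The partial derivative of \<open>F\<close> in the coordinate \<open>s\<close>, by the
  chain rule; \<open>FT\<close> is the one in \<open>t\<close>.\<close>

definition FS :: "real \<Rightarrow> real \<Rightarrow> real" where "FS s t = grad F (pol s t) \<bullet> pol s t"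

definition FT :: "real \<Rightarrow> real \<Rightarrow> real" where "FT s t = grad F (pol s t) \<bullet> pol' s t"

lemma pol_in_U: "zig t \<le> s \<Longrightarrow> s \<le> 12 \<Longrightarrow> pol s t \<in> U"
  using pol_mem_closure_Om U(2) by blast

lemma F_continuous: "continuous_on (closure Om) F" "continuous_on (closure Om) (grad F)"
  using smooth_on_imp_continuous[OF U(3)] continuous_on_grad[OF U(3)] U(2) continuous_on_subset by blast+

lemma F_pol_continuous:
  fixes A :: "'x::t2_space set"
  assumes a: "continuous_on A a" and b: "continuous_on A b"
    and m: "\<And>x. x \<in> A \<Longrightarrow> zig (b x) \<le> a x \<and> a x \<le> 12"
  shows "continuous_on A (\<lambda>x. F (pol (a x) (b x)))" "continuous_on A (\<lambda>x. FS (a x) (b x))"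
    "continuous_on A (\<lambda>x. FT (a x) (b x))"
proof -
  have p: "continuous_on A (\<lambda>x. pol (a x) (b x))" "continuous_on A (\<lambda>x. pol' (a x) (b x))"
    by (rule continuous_on_pol[OF a b])+
  have im: "(\<lambda>x. pol (a x) (b x)) ` A \<subseteq> closure Om" using m pol_mem_closure_Om by blast
  show "continuous_on A (\<lambda>x. F (pol (a x) (b x)))" by (rule continuous_on_compose2[OF F_continuous(1) p(1) im])
  have g: "continuous_on A (\<lambda>x. grad F (pol (a x) (b x)))"
    by (rule continuous_on_compose2[OF F_continuous(2) p(1) im])
  show "continuous_on A (\<lambda>x. FS (a x) (b x))" "continuous_on A (\<lambda>x. FT (a x) (b x))"
    unfolding FS_def FT_def by (intro continuous_on_inner g p)+
qed

lemma F_pol_has_derivative: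
  fixes v :: "real^2"
  assumes "zig (v $ 2) \<le> v $ 1" "v $ 1 \<le> 12"
  shows "((\<lambda>v. F (pol (v $ 1) (v $ 2))) has_derivative
    (\<lambda>h. h $ 1 * FS (v $ 1) (v $ 2) + h $ 2 * FT (v $ 1) (v $ 2))) (at v)"
proof -
  have "((\<lambda>v. F (pol (v $ 1) (v $ 2))) has_derivative
    (\<lambda>h. grad F (pol (v $ 1) (v $ 2)) \<bullet> (h $ 1 *\<^sub>R pol (v $ 1) (v $ 2) + h $ 2 *\<^sub>R pol' (v $ 1) (v $ 2)))) (at v)"
    by (rule has_derivative_compose[OF has_derivative_pol has_derivative_grad[OF U(3)]]) (rule pol_in_U[OF assms])
  then show ?thesis by (simp add: FS_def FT_def inner_add_right)
qed

lemma F_pol_deriv: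
  assumes "zig t \<le> s" "s \<le> 12"
  shows "((\<lambda>s. F (pol s t)) has_field_derivative FS s t) (at s within A)"
    and "((\<lambda>t. F (pol s t)) has_field_derivative FT s t) (at t within A)"
proof -
  let ?v = "vector [s, t] :: real^2"
  have D: "((\<lambda>v. F (pol (v $ 1) (v $ 2))) has_derivative (\<lambda>h. h $ 1 * FS s t + h $ 2 * FT s t)) (at ?v)"
    using F_pol_has_derivative[of ?v] assms by simp
  have 1: "((\<lambda>s. vector [s, t] :: real^2) has_derivative (\<lambda>h. vector [h, 0])) (at s within A)"
    unfolding vector_2_decomp by (auto intro!: derivative_eq_intros)
  have 2: "((\<lambda>t. vector [s, t] :: real^2) has_derivative (\<lambda>h. vector [0, h])) (at t within A)"
    unfolding vector_2_decomp by (auto intro!: derivative_eq_intros)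
  show "((\<lambda>s. F (pol s t)) has_field_derivative FS s t) (at s within A)"
    using has_derivative_compose[OF 1 D] by (simp add: has_field_derivative_def mult_commute_abs)
  show "((\<lambda>t. F (pol s t)) has_field_derivative FT s t) (at t within A)"
    using has_derivative_compose[OF 2 D] by (simp add: has_field_derivative_def mult_commute_abs)
qed

text \<open>Conformality: the Jacobian factor \<open>exp (2 * s)\<close> of the area is the one by
  which the squared gradient shrinks.\<close>

lemma norm_grad_polar: "exp (2 * s) * (norm (grad F (pol s t)))\<^sup>2 = (FS s t)\<^sup>2 + (FT s t)\<^sup>2"
proof -
  let ?g = "grad F (pol s t)"
  have p: "pol s t = exp s *\<^sub>R pol 0 t" "pol' s t = exp s *\<^sub>R pol' 0 t" by (simp_all add: pol_def pol'_def)
  have "(FS s t)\<^sup>2 + (FT s t)\<^sup>2 = (exp s)\<^sup>2 * ((?g \<bullet> pol 0 t)\<^sup>2 + (?g \<bullet> pol' 0 t)\<^sup>2)"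
    unfolding FS_def FT_def by (subst (2) p(1), subst (1) p(2)) (simp add: power_mult_distrib algebra_simps)
  also have "\<dots> = (exp s)\<^sup>2 * (norm ?g)\<^sup>2" by (simp only: norm_frame[of ?g t])
  also have "(exp s)\<^sup>2 = exp (2 * s)" by (simp add: power2_eq_square mult_exp_exp)
  finally show ?thesis by simp
qed

lemma polar_integral_Om:
  assumes "continuous_on (closure Om) K"
  shows "((\<lambda>t. integral {zig t..12} (\<lambda>s. exp (2 * s) * K (pol s t))) has_integral
      (LINT x|lebesgue_on Om. K x)) {0..2 * pi}"
proof (rule polar_integral[OF Om_facts])
  show "continuous_on {pol s t |s t. zig t \<le> s \<and> s \<le> 12} K"
    using assms by (simp add: closure_Om polar_closure_def)
  show "integrable (lebesgue_on Om) K"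
    by (rule continuous_on_closure_integrable[OF open_polar_region[OF Om_facts] bounded_polar_region[OF Om_facts] assms])
  show "Om \<in> sets lebesgue" using open_polar_region[OF Om_facts] by auto
qed

lemma energy_integral:
  "((\<lambda>t. integral {zig t..12} (\<lambda>s. (FS s t)\<^sup>2 + (FT s t)\<^sup>2)) has_integral
      (LINT x|lebesgue_on Om. (norm (grad F x))\<^sup>2)) {0..2 * pi}"
  using polar_integral_Om[of "\<lambda>x. (norm (grad F x))\<^sup>2"] F_continuous(2)
  by (simp add: norm_grad_polar continuous_on_power continuous_on_norm)

lemma FS_FT_integrable:
  assumes "zig t \<le> a" "b \<le> 12"
  shows "(\<lambda>s. (FS s t)\<^sup>2) integrable_on {a..b}" "(\<lambda>s. (FT s t)\<^sup>2) integrable_on {a..b}"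
    "(\<lambda>s. (FS s t)\<^sup>2 + (FT s t)\<^sup>2) integrable_on {a..b}"
  using F_pol_continuous(2,3)[of "{a..b}" "\<lambda>s. s" "\<lambda>_. t"] assms
  by (auto intro!: integrable_continuous_real continuous_on_power continuous_on_add)

text \<open>On both boundary curves the weight \<open>1 / \<bar>s\<bar>\<close> of the boundary integral cancels the value \<open>s\<close> of
  \<open>ln (norm x)\<close> up to sign, leaving exactly the boundary terms of the integral of the radial derivative.\<close>

lemma Green_ln_norm:
  "(LINT x|lebesgue_on Om. grad (\<lambda>x. ln (norm x)) x \<bullet> grad F x)
     = sg * (LINT x|boundary_measure Om. ln (norm x) * F x)"
proof -
  have g: "grad (\<lambda>x. ln (norm x)) x = (1 / (norm x)\<^sup>2) *\<^sub>R x" if "x \<noteq> 0" for x :: "real^2"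
  proof (rule grad_eqI)
    have "(norm has_derivative (\<lambda>h. h \<bullet> sgn x)) (at x)"
      using GDERIV_norm[OF that] by (simp add: gderiv_def)
    moreover have "(ln has_derivative (*) (inverse (norm x))) (at (norm x))"
      using DERIV_ln[of "norm x"] that by (simp add: has_field_derivative_def)
    ultimately have "((\<lambda>x. ln (norm x)) has_derivative (\<lambda>h. inverse (norm x) * (h \<bullet> sgn x))) (at x)"
      by (rule has_derivative_compose)
    then show "((\<lambda>x. ln (norm x)) has_derivative (\<lambda>h. ((1 / (norm x)\<^sup>2) *\<^sub>R x) \<bullet> h)) (at x)"
      by (simp add: sgn_div_norm inner_commute power2_eq_square divide_inverse mult.assoc)
  qed
  define K where "K x = (1 / (norm x)\<^sup>2) *\<^sub>R x \<bullet> grad F x" for x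
  have Kc: "continuous_on (closure Om) K"
    unfolding K_def using zero_notin_closure_Om
    by (intro continuous_intros F_continuous) auto
  have eK: "exp (2 * s) * K (pol s t) = FS s t" for s t
    by (simp add: K_def FS_def inner_commute power2_eq_square mult_exp_exp)
  have 1: "((\<lambda>t. F (pol 12 t) - F (pol (zig t) t)) has_integral (LINT x|lebesgue_on Om. K x)) {0..2 * pi}"
  proof -
    have "integral {zig t..12} (\<lambda>s. exp (2 * s) * K (pol s t)) = F (pol 12 t) - F (pol (zig t) t)" for t
    proof -
      have "((\<lambda>s. FS s t) has_integral (F (pol 12 t) - F (pol (zig t) t))) {zig t..12}"
        by (rule fundamental_theorem_of_calculus)
          (use zig_less_12[of t] F_pol_deriv(1) in \<open>auto simp: has_real_derivative_iff_has_vector_derivative[symmetric]\<close>)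
      then show ?thesis unfolding eK by (rule integral_unique)
    qed
    then show ?thesis using polar_integral_Om[OF Kc] by simp
  qed
  have fc: "continuous_on (frontier Om) (\<lambda>x. ln (norm x) * F x)"
    using zero_notin_closure_Om frontier_Om_subset
    by (intro continuous_intros continuous_on_subset[OF F_continuous(1)]) auto
  have "((\<lambda>t. ln (norm (pol (zig t) t)) * F (pol (zig t) t) / (- zig t) + ln (norm (pol 12 t)) * F (pol 12 t) / 12)
      has_integral (sg * (LINT x|boundary_measure Om. ln (norm x) * F x))) {0..2 * pi}"
    by (rule boundary_integral(1)[OF fc])
  moreover have "ln (norm (pol (zig t) t)) * F (pol (zig t) t) / (- zig t) + ln (norm (pol 12 t)) * F (pol 12 t) / 12
      = F (pol 12 t) - F (pol (zig t) t)" for t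
    using zig_bounds(2)[of t] by simp
  ultimately have 2: "((\<lambda>t. F (pol 12 t) - F (pol (zig t) t)) has_integral
      (sg * (LINT x|boundary_measure Om. ln (norm x) * F x))) {0..2 * pi}" by simp
  have "(LINT x|lebesgue_on Om. grad (\<lambda>x. ln (norm x)) x \<bullet> grad F x) = (LINT x|lebesgue_on Om. K x)"
  proof (rule Bochner_Integration.integral_cong[OF refl])
    fix x assume "x \<in> space (lebesgue_on Om)"
    then have "x \<noteq> 0" using zero_notin_closure_Om closure_subset[of Om] by (auto simp: space_restrict_space)
    then show "grad (\<lambda>x. ln (norm x)) x \<bullet> grad F x = K x" by (simp add: g K_def)
  qed
  then show ?thesis using has_integral_unique[OF 1 2] by simp
qed

text \<open>The mean is taken over the part of the fiber that is common to all angles. Its limits do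
  not depend on \<open>t\<close>, so it can be differentiated under the integral without regard to
  the zigzag.\<close>

definition FM :: "real \<Rightarrow> real" where "FM t = (1/24) * integral {-12..12} (\<lambda>s. F (pol s t))"

definition FN :: "real \<Rightarrow> real" where "FN t = integral {-12..12} (\<lambda>s. (FT s t)\<^sup>2)"

lemma middle_region: "s \<in> {-12..12} \<Longrightarrow> zig t \<le> s \<and> s \<le> 12"
  using zig_bounds(2)[of t] by auto

lemma FN_continuous: "continuous_on {0..2 * pi} FN"
  unfolding FN_def
proof (rule integral_continuous_on_param[of "{0..2*pi}" "-12" 12 "\<lambda>t s. (FT s t)\<^sup>2", unfolded interval_cbox[symmetric]])
  show "continuous_on ({0..2 * pi} \<times> {-12..12}) (\<lambda>(t, s). (FT s t)\<^sup>2)"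
    unfolding case_prod_unfold
    by (intro continuous_on_power F_pol_continuous(3) continuous_on_fst continuous_on_snd continuous_on_id)
      (use middle_region in auto)
qed

lemma FM_deriv: "t \<in> {0..2 * pi} \<Longrightarrow>
    (FM has_field_derivative (1/24) * integral {-12..12} (\<lambda>s. FT s t)) (at t within {0..2 * pi})"
  unfolding FM_def
proof (rule DERIV_cmult)
  assume t: "t \<in> {0..2 * pi}"
  show "((\<lambda>t. integral {-12..12} (\<lambda>s. F (pol s t))) has_field_derivative integral {-12..12} (\<lambda>s. FT s t))
      (at t within {0..2 * pi})"
  proof (rule leibniz_rule_field_derivative[of "{0..2*pi}" "-12" 12 "\<lambda>t s. F (pol s t)" "\<lambda>t s. FT s t", unfolded interval_cbox[symmetric]])
    show "((\<lambda>t. F (pol s t)) has_field_derivative FT s t) (at t within {0..2 * pi})"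
      if "t \<in> {0..2 * pi}" "s \<in> {-12..12}" for t s
      using F_pol_deriv(2) middle_region[OF that(2)] by blast
    show "(\<lambda>s. F (pol s t)) integrable_on {-12..12}" for t
      using F_pol_continuous(1)[of "{-12..12}" "\<lambda>s. s" "\<lambda>_. t"] middle_region
      by (auto intro!: integrable_continuous_real)
    show "continuous_on ({0..2 * pi} \<times> {-12..12}) (\<lambda>(t, s). FT s t)"
      unfolding case_prod_unfold
      by (intro F_pol_continuous(3) continuous_on_fst continuous_on_snd continuous_on_id)
        (use middle_region in auto)
  qed (use t in auto)
qed

lemma FM'_continuous: "continuous_on {0..2 * pi} (\<lambda>t. (1/24) * integral {-12..12} (\<lambda>s. FT s t))"
proof (intro continuous_on_mult continuous_on_const)
  show "continuous_on {0..2 * pi} (\<lambda>t. integral {-12..12} (\<lambda>s. FT s t))"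
  proof (rule integral_continuous_on_param[of "{0..2*pi}" "-12" 12 "\<lambda>t s. FT s t", unfolded interval_cbox[symmetric]])
    show "continuous_on ({0..2 * pi} \<times> {-12..12}) (\<lambda>(t, s). FT s t)"
      unfolding case_prod_unfold
      by (intro F_pol_continuous(3) continuous_on_fst continuous_on_snd continuous_on_id)
        (use middle_region in auto)
  qed
qed

text \<open>Cauchy-Schwarz in \<open>t\<close> gives the factor \<open>2 * pi\<close>, and in
  \<open>s\<close> the factor 1/24.\<close>

lemma FM_bound:
  assumes t: "t \<in> {0..2 * pi}"
  shows "(FM t - FM 0)\<^sup>2 \<le> (pi / 12) * integral {0..2 * pi} FN"
proof -
  let ?M' = "\<lambda>t. (1/24) * integral {-12..12} (\<lambda>s. FT s t)"
  have "(FM t - FM 0)\<^sup>2 \<le> (2 * pi - 0) * integral {0..2 * pi} (\<lambda>t. (?M' t)\<^sup>2)"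
    by (rule increment_square_le(1)) (use t FM_deriv FM'_continuous in auto)
  also have "\<dots> \<le> (2 * pi - 0) * integral {0..2 * pi} (\<lambda>t. (1/24) * FN t)"
  proof (intro mult_left_mono integral_le)
    show "(\<lambda>t. (?M' t)\<^sup>2) integrable_on {0..2 * pi}"
      by (intro integrable_continuous_real continuous_on_power FM'_continuous)
    show "(\<lambda>t. (1/24) * FN t) integrable_on {0..2 * pi}"
      by (intro integrable_continuous_real continuous_on_mult continuous_on_const FN_continuous)
    fix t
    have c: "continuous_on {-12..12} (\<lambda>s. FT s t)"
      by (rule F_pol_continuous(3)) (use middle_region in \<open>auto intro: continuous_on_id continuous_on_const\<close>)
    have "(integral {-12..12} (\<lambda>s. 1 * FT s t))\<^sup>2 \<le> integral {-12..12::real} (\<lambda>s. 1\<^sup>2) * FN t"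
      unfolding FN_def by (rule integral_Cauchy_Schwarz[OF continuous_on_const c])
    then show "(?M' t)\<^sup>2 \<le> (1/24) * FN t" by (simp add: power_mult_distrib power_divide)
  qed simp
  finally show ?thesis by simp
qed

lemma boundary_terms_continuous:
  assumes "continuous_on {0..2*pi} a" "continuous_on {0..2*pi} b"
  shows "continuous_on {0..2 * pi} (\<lambda>t. a t / (- zig t) + b t / 12 :: real)"
  using assms zig_bounds(2) zig_cont
  by (intro continuous_on_add continuous_on_divide continuous_on_minus continuous_on_const) (auto, smt (verit))

text \<open>The one-dimensional inequality uses the radial derivative only, so the angular energy
  \<open>FN t\<close> of the common part of the fiber is left over to pay for the mean.\<close>

lemma fiber_bound:
  fixes c :: real
  shows "(F (pol (zig t) t) - c)\<^sup>2 / (- zig t) + (F (pol 12 t) - c)\<^sup>2 / 12 - (1/3) * (FM t - c)\<^sup>2 + FN t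
    \<le> integral {zig t..12} (\<lambda>s. (FS s t)\<^sup>2 + (FT s t)\<^sup>2)"
proof -
  have z: "12 \<le> - zig t" "- zig t \<le> 16" using zig_bounds[of t] by auto
  have f1: "(F (pol (- (- zig t)) t) - c)\<^sup>2 / (- zig t) + (F (pol 12 t) - c)\<^sup>2 / 12
      \<le> integral {- (- zig t)..12} (\<lambda>s. (FS s t)\<^sup>2) + (1/3) * ((1/24) * integral {-12..12} (\<lambda>s. F (pol s t) - c))\<^sup>2"
  proof (rule fiber_inequality[OF z])
    fix s assume "s \<in> {- (- zig t)..12}"
    then have s: "zig t \<le> s" "s \<le> 12" by auto
    show "((\<lambda>s. F (pol s t) - c) has_field_derivative FS s t) (at s within {- (- zig t)..12})"
      using DERIV_diff[OF F_pol_deriv(1)[OF s] DERIV_const[of c]] by simp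
  next
    show "continuous_on {- (- zig t)..12} (\<lambda>s. FS s t)"
      by (rule F_pol_continuous(2)) (auto intro: continuous_on_id continuous_on_const)
  qed
  have f2: "(1/24) * integral {-12..12} (\<lambda>s. F (pol s t) - c) = FM t - c"
  proof -
    have i: "(\<lambda>s. F (pol s t)) integrable_on {-12..12}"
      using F_pol_continuous(1)[of "{-12..12}" "\<lambda>s. s" "\<lambda>_. t"] middle_region
      by (auto intro!: integrable_continuous_real)
    have "integral {-12..12} (\<lambda>s. F (pol s t) - c) = integral {-12..12} (\<lambda>s. F (pol s t)) - integral {-12..12::real} (\<lambda>s. c)"
      by (rule Henstock_Kurzweil_Integration.integral_diff[OF i integrable_const_ivl])
    then show ?thesis by (simp add: FM_def)
  qed
  have "FN t \<le> integral {zig t..12} (\<lambda>s. (FT s t)\<^sup>2)"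
    unfolding FN_def using z by (intro integral_subset_le FS_FT_integrable) auto
  moreover have "integral {zig t..12} (\<lambda>s. (FS s t)\<^sup>2 + (FT s t)\<^sup>2)
      = integral {zig t..12} (\<lambda>s. (FS s t)\<^sup>2) + integral {zig t..12} (\<lambda>s. (FT s t)\<^sup>2)"
    by (rule Henstock_Kurzweil_Integration.integral_add) (intro FS_FT_integrable; simp)+
  ultimately show ?thesis using f1 unfolding f2 minus_minus by linarith
qed

text \<open>The fiber inequality is applied to \<open>F - c\<close>, where \<open>c\<close> is the radial mean of \<open>F\<close> at angle 0;
  completing the square in \<open>c\<close> leaves only the square of the boundary mean.\<close>

lemma energy_inequality:
  "sg * (LINT x|boundary_measure Om. (F x)\<^sup>2)
    \<le> (LINT x|lebesgue_on Om. (norm (grad F x))\<^sup>2) + 2 * (sg * (LINT x|boundary_measure Om. F x))\<^sup>2"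
proof -
  define c where "c = FM 0"
  define E where "E = (LINT x|lebesgue_on Om. (norm (grad F x))\<^sup>2)"
  define T where "T = sg * (LINT x|boundary_measure Om. (F x)\<^sup>2)"
  define S where "S = sg * (LINT x|boundary_measure Om. F x)"
  define N where "N = integral {0..2 * pi} FN"
  define W where "W = integral {0..2 * pi} (\<lambda>t. 1 / (- zig t) + 1 / 12)"
  let ?A = "\<lambda>t. F (pol (zig t) t)" and ?B = "\<lambda>t. F (pol 12 t)"
  have Fc: "continuous_on (frontier Om) F"
    by (rule continuous_on_subset[OF F_continuous(1) frontier_Om_subset])
  have hS: "((\<lambda>t. ?A t / (- zig t) + ?B t / 12) has_integral S) {0..2 * pi}"
    unfolding S_def by (rule boundary_integral(1)[OF Fc])
  have hT: "((\<lambda>t. (?A t)\<^sup>2 / (- zig t) + (?B t)\<^sup>2 / 12) has_integral T) {0..2 * pi}"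
    unfolding T_def by (rule boundary_integral(1)[OF continuous_on_power[OF Fc]])
  have hW: "((\<lambda>t. 1 / (- zig t) + 1 / 12) has_integral W) {0..2 * pi}"
    unfolding W_def
    by (intro integrable_integral integrable_continuous_real boundary_terms_continuous continuous_on_const)
  have hN: "(FN has_integral N) {0..2 * pi}"
    unfolding N_def by (intro integrable_integral integrable_continuous_real FN_continuous)
  have N0: "0 \<le> N"
    by (rule has_integral_nonneg[OF hN]) (auto simp: FN_def intro!: integral_nonneg FS_FT_integrable middle_region[THEN conjunct1])
  have hE: "((\<lambda>t. integral {zig t..12} (\<lambda>s. (FS s t)\<^sup>2 + (FT s t)\<^sup>2)) has_integral E) {0..2 * pi}"
    unfolding E_def by (rule energy_integral)
  have content: "measure lborel {0..2 * pi} = 2 * pi - 0" by (rule measure_lborel_Icc) simp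
  have hC: "((\<lambda>t. k) has_integral (2 * pi - 0) *\<^sub>R k) {0..2 * pi}" for k :: real
    using has_integral_const_real[of k 0 "2 * pi"] unfolding content .
  have "((\<lambda>t. ((?A t)\<^sup>2 / (- zig t) + (?B t)\<^sup>2 / 12) - (2 * c) * (?A t / (- zig t) + ?B t / 12)
      + c\<^sup>2 * (1 / (- zig t) + 1 / 12) - (1/3) * ((pi / 12) * N) + FN t)
      has_integral (T - (2 * c) * S + c\<^sup>2 * W - (2 * pi - 0) *\<^sub>R ((1/3) * ((pi / 12) * N)) + N)) {0..2 * pi}"
    by (intro has_integral_add has_integral_diff has_integral_mult_right hS hT hW hN hC)
  then have main: "T - (2 * c) * S + c\<^sup>2 * W - (2 * pi - 0) *\<^sub>R ((1/3) * ((pi / 12) * N)) + N \<le> E"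
  proof (rule has_integral_le[OF _ hE])
    fix t assume t: "t \<in> {0..2 * pi}"
    have "((?A t)\<^sup>2 / (- zig t) + (?B t)\<^sup>2 / 12) - (2 * c) * (?A t / (- zig t) + ?B t / 12)
      + c\<^sup>2 * (1 / (- zig t) + 1 / 12) = (?A t - c)\<^sup>2 / (- zig t) + (?B t - c)\<^sup>2 / 12"
      by (simp add: power2_diff add_divide_distrib diff_divide_distrib algebra_simps)
    moreover have "(1/3) * (FM t - c)\<^sup>2 \<le> (1/3) * ((pi / 12) * N)"
      unfolding c_def N_def by (intro mult_left_mono FM_bound t) simp
    ultimately show "((?A t)\<^sup>2 / (- zig t) + (?B t)\<^sup>2 / 12) - (2 * c) * (?A t / (- zig t) + ?B t / 12)
      + c\<^sup>2 * (1 / (- zig t) + 1 / 12) - (1/3) * ((pi / 12) * N) + FN t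
      \<le> integral {zig t..12} (\<lambda>s. (FS s t)\<^sup>2 + (FT s t)\<^sup>2)"
      using fiber_bound[of t c] by linarith
  qed
  \<comment> \<open>The variation of the radial mean costs \<open>pi * pi / 18\<close> times the
    angular energy, which is less than the angular energy available.\<close>
  have "(2 * pi - 0) *\<^sub>R ((1/3) * ((pi / 12) * N)) \<le> N"
  proof -
    have "pi * pi \<le> 4 * 4" using pi_less_4 pi_gt_zero by (intro mult_mono) auto
    then have "pi * pi * N \<le> 18 * N" using N0 by (intro mult_right_mono) auto
    moreover have "(2 * pi - 0) *\<^sub>R ((1/3) * ((pi / 12) * N)) = pi * pi * N / 18" by simp
    ultimately show ?thesis by linarith
  qed
  \<comment> \<open>The outer circle alone contributes \<open>2 * pi / 12\<close>, which exceeds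
    1/2; this coefficient of \<open>c\<^sup>2\<close> produces the constant 2 in front of the
    squared boundary mean.\<close>
  moreover have "1 / 2 \<le> W"
  proof -
    have "(2 * pi - 0) *\<^sub>R (1 / 12 :: real) \<le> W"
    proof (rule has_integral_le[OF hC hW])
      fix t
      have "0 \<le> 1 / (- zig t)" using zig_bounds(2)[of t] by (intro divide_nonneg_nonneg) auto
      then show "1 / 12 \<le> 1 / (- zig t) + 1 / 12" by simp
    qed
    then show ?thesis using pi_gt3 by simp
  qed
  then have "c\<^sup>2 * (1 / 2) \<le> c\<^sup>2 * W" by (intro mult_left_mono) auto
  moreover have "0 \<le> (c - 2 * S)\<^sup>2" by simp
  then have "- 2 * S\<^sup>2 \<le> c\<^sup>2 * (1 / 2) - (2 * c) * S" by (simp add: power2_eq_square algebra_simps)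
  ultimately have "T \<le> E + 2 * S\<^sup>2" using main by linarith
  then show ?thesis by (simp only: T_def E_def S_def)
qed

text \<open>A Friedrichs inequality, for ruling out eigenfunctions with vanishing trace. Each value
  on a fiber is reached from the outer circle; fibers have length at most 28, the Jacobian factor is
  at most \<open>exp 24\<close>, and 1568 = 28 * 56.\<close>

lemma L2_norm_bound:
  "(LINT x|lebesgue_on Om. (F x)\<^sup>2) \<le> 1568 * exp 24 *
    ((LINT x|lebesgue_on Om. (norm (grad F x))\<^sup>2) + sg * (LINT x|boundary_measure Om. (F x)\<^sup>2))"
proof -
  define E where "E = (LINT x|lebesgue_on Om. (norm (grad F x))\<^sup>2)"
  define T where "T = sg * (LINT x|boundary_measure Om. (F x)\<^sup>2)"
  let ?A = "\<lambda>t. F (pol (zig t) t)" and ?B = "\<lambda>t. F (pol 12 t)"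
  have Fc: "continuous_on (frontier Om) F"
    by (rule continuous_on_subset[OF F_continuous(1) frontier_Om_subset])
  have hT: "((\<lambda>t. (?A t)\<^sup>2 / (- zig t) + (?B t)\<^sup>2 / 12) has_integral T) {0..2 * pi}"
    unfolding T_def by (rule boundary_integral(1)[OF continuous_on_power[OF Fc]])
  have hE: "((\<lambda>t. integral {zig t..12} (\<lambda>s. (FS s t)\<^sup>2 + (FT s t)\<^sup>2)) has_integral E) {0..2 * pi}"
    unfolding E_def by (rule energy_integral)
  have "(LINT x|lebesgue_on Om. (F x)\<^sup>2) \<le> (1568 * exp 24) * (E + T)"
  proof (rule has_integral_le[OF polar_integral_Om[OF continuous_on_power[OF F_continuous(1)]]
        has_integral_mult_right[OF has_integral_add[OF hE hT]]])
    fix t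
    define e where "e = integral {zig t..12} (\<lambda>s. (FS s t)\<^sup>2 + (FT s t)\<^sup>2)"
    have z: "-16 \<le> zig t" "zig t \<le> -12" by (rule zig_bounds)+
    have iS: "integral {zig t..12} (\<lambda>s. (FS s t)\<^sup>2) \<le> e"
      unfolding e_def by (intro integral_le FS_FT_integrable) auto
    have iS0: "0 \<le> integral {zig t..12} (\<lambda>s. (FS s t)\<^sup>2)" by (intro integral_nonneg FS_FT_integrable) auto
    have pt: "exp (2 * s) * (F (pol s t))\<^sup>2 \<le> exp 24 * (2 * (?B t)\<^sup>2 + 56 * e)" if s: "s \<in> {zig t..12}" for s
    proof -
      have "(?B t - F (pol s t))\<^sup>2 \<le> (12 - zig t) * integral {zig t..12} (\<lambda>s. (FS s t)\<^sup>2)"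
      proof (rule increment_square_le(2))
        show "((\<lambda>s. F (pol s t)) has_field_derivative FS s t) (at s within {zig t..12})"
          if "s \<in> {zig t..12}" for s
          using that by (intro F_pol_deriv(1)) auto
        show "continuous_on {zig t..12} (\<lambda>s. FS s t)"
          by (rule F_pol_continuous(2)) (auto intro: continuous_on_id continuous_on_const)
      qed (use s in auto)
      also have "\<dots> \<le> 28 * e" using z iS iS0 by (intro mult_mono) auto
      finally have "(?B t - F (pol s t))\<^sup>2 \<le> 28 * e" .
      moreover have "(F (pol s t))\<^sup>2 \<le> 2 * (?B t)\<^sup>2 + 2 * (?B t - F (pol s t))\<^sup>2"
      proof -
        have "0 \<le> (2 * ?B t - F (pol s t))\<^sup>2" by simp
        then show ?thesis by (simp add: power2_eq_square algebra_simps)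
      qed
      ultimately have "(F (pol s t))\<^sup>2 \<le> 2 * (?B t)\<^sup>2 + 56 * e" by linarith
      moreover have "exp (2 * s) \<le> exp 24" using s by simp
      ultimately show ?thesis by (intro mult_mono) auto
    qed
    have "integral {zig t..12} (\<lambda>s. exp (2 * s) * (F (pol s t))\<^sup>2)
        \<le> integral {zig t..12} (\<lambda>s. exp 24 * (2 * (?B t)\<^sup>2 + 56 * e))"
    proof (rule integral_le)
      show "(\<lambda>s. exp (2 * s) * (F (pol s t))\<^sup>2) integrable_on {zig t..12}"
        by (intro integrable_continuous_real continuous_on_mult continuous_on_power F_pol_continuous(1)
            continuous_on_exp continuous_on_id continuous_on_const) auto
    qed (use pt in auto)
    also have "\<dots> = (12 - zig t) * (exp 24 * (2 * (?B t)\<^sup>2 + 56 * e))" using z by simp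
    also have "\<dots> \<le> 28 * (exp 24 * (2 * (?B t)\<^sup>2 + 56 * e))"
      using z iS iS0 by (intro mult_right_mono mult_nonneg_nonneg) auto
    also have "\<dots> \<le> (1568 * exp 24) * (e + ((?A t)\<^sup>2 / (- zig t) + (?B t)\<^sup>2 / 12))"
    proof -
      have "0 \<le> (?A t)\<^sup>2 / (- zig t)" using z by (intro divide_nonneg_nonneg) auto
      moreover have gen: "28 * (2 * b + 56 * e) \<le> 1568 * (e + (p + b / 12))" if "0 \<le> p" "0 \<le> b" for b p :: real
        using that by simp
      ultimately have "28 * (2 * (?B t)\<^sup>2 + 56 * e) \<le> 1568 * (e + ((?A t)\<^sup>2 / (- zig t) + (?B t)\<^sup>2 / 12))"
        by (intro gen) auto
      then have "exp 24 * (28 * (2 * (?B t)\<^sup>2 + 56 * e)) \<le> exp 24 * (1568 * (e + ((?A t)\<^sup>2 / (- zig t) + (?B t)\<^sup>2 / 12)))"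
        by (intro mult_left_mono) auto
      then show ?thesis by (simp only: mult_ac)
    qed
    finally show "integral {zig t..12} (\<lambda>s. exp (2 * s) * (F (pol s t))\<^sup>2)
      \<le> (1568 * exp 24) * (integral {zig t..12} (\<lambda>s. (FS s t)\<^sup>2 + (FT s t)\<^sup>2) + ((?A t)\<^sup>2 / (- zig t) + (?B t)\<^sup>2 / 12))"
      by (simp only: e_def)
  qed
  then show ?thesis by (simp only: E_def T_def)
qed

end

subsection \<open>The first Steklov eigenvalue\<close>

lemma Om_open: "open Om" and Om_bounded: "bounded Om"
  using open_polar_region[OF Om_facts] bounded_polar_region[OF Om_facts] by auto

lemma finite_measure_boundary: "finite_measure (boundary_measure Om)"
  by (rule boundary_integral(2)[of "\<lambda>_. 0"]) simp

lemma continuous_on_frontier_L2: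
  fixes F :: "real^2 \<Rightarrow> real"
  assumes "continuous_on (frontier Om) F"
  shows "F \<in> L2 (boundary_measure Om)"
  unfolding L2_def mem_Collect_eq
proof
  show "F \<in> borel_measurable (boundary_measure Om)"
    using boundary_integral(3)[OF assms] by (rule borel_measurable_integrable)
  show "integrable (boundary_measure Om) (\<lambda>x. (norm (F x))\<^sup>2)"
    by (rule boundary_integral(3)) (intro continuous_on_power continuous_on_norm assms)
qed

lemma trace_approximation:
  assumes "has_trace Om \<phi> h"
  obtains F where "\<forall>n. \<exists>U. open U \<and> closure Om \<subseteq> U \<and> smooth_on U (F n)"
    "L2_tendsto (lebesgue_on Om) F \<phi>"
    "L2_tendsto (lebesgue_on Om) (\<lambda>n. grad (F n)) (weak_grad Om \<phi>)"
    "L2_tendsto (boundary_measure Om) F h"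
  using assms unfolding has_trace_def by blast

text \<open>All four integrals are continuous along the approximating sequence that
  \<open>has_trace\<close> supplies, so both estimates for smooth functions pass to the
  limit.\<close>

lemma trace_energy_inequality:
  assumes "has_trace Om \<phi> h"
  shows "sg * (LINT x|boundary_measure Om. (h x)\<^sup>2)
    \<le> (LINT x|lebesgue_on Om. (norm (weak_grad Om \<phi> x))\<^sup>2) + 2 * (sg * (LINT x|boundary_measure Om. h x))\<^sup>2"
    and "(LINT x|lebesgue_on Om. (\<phi> x)\<^sup>2) \<le> 1568 * exp 24 *
    ((LINT x|lebesgue_on Om. (norm (weak_grad Om \<phi> x))\<^sup>2) + sg * (LINT x|boundary_measure Om. (h x)\<^sup>2))"
proof -
  interpret finite_measure "boundary_measure Om" by (rule finite_measure_boundary)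
  obtain F where F: "\<forall>n. \<exists>U. open U \<and> closure Om \<subseteq> U \<and> smooth_on U (F n)"
    "L2_tendsto (lebesgue_on Om) F \<phi>"
    "L2_tendsto (lebesgue_on Om) (\<lambda>n. grad (F n)) (weak_grad Om \<phi>)"
    "L2_tendsto (boundary_measure Om) F h"
    by (rule trace_approximation[OF assms])
  have lims: "(\<lambda>n. LINT x|boundary_measure Om. (F n x)\<^sup>2) \<longlonglongrightarrow> (LINT x|boundary_measure Om. (h x)\<^sup>2)"
    "(\<lambda>n. LINT x|lebesgue_on Om. (F n x)\<^sup>2) \<longlonglongrightarrow> (LINT x|lebesgue_on Om. (\<phi> x)\<^sup>2)"
    using L2_tendsto_norm[OF F(4)] L2_tendsto_norm[OF F(2)] by simp_all
  note limg = L2_tendsto_norm[OF F(3)] and limb = L2_tendsto_integral[OF F(4)]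
  have e: "sg * (LINT x|boundary_measure Om. (F n x)\<^sup>2)
    \<le> (LINT x|lebesgue_on Om. (norm (grad (F n) x))\<^sup>2) + 2 * (sg * (LINT x|boundary_measure Om. F n x))\<^sup>2" for n
    using F(1)[rule_format, of n] energy_inequality by blast
  have b: "(LINT x|lebesgue_on Om. (F n x)\<^sup>2) \<le> 1568 * exp 24 *
    ((LINT x|lebesgue_on Om. (norm (grad (F n) x))\<^sup>2) + sg * (LINT x|boundary_measure Om. (F n x)\<^sup>2))" for n
    using F(1)[rule_format, of n] L2_norm_bound by blast
  show "sg * (LINT x|boundary_measure Om. (h x)\<^sup>2)
    \<le> (LINT x|lebesgue_on Om. (norm (weak_grad Om \<phi> x))\<^sup>2) + 2 * (sg * (LINT x|boundary_measure Om. h x))\<^sup>2"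
    by (rule LIMSEQ_le[OF tendsto_mult[OF tendsto_const lims(1)]
          tendsto_add[OF limg tendsto_mult[OF tendsto_const tendsto_power[OF tendsto_mult[OF tendsto_const limb]]]]])
      (use e in blast)
  show "(LINT x|lebesgue_on Om. (\<phi> x)\<^sup>2) \<le> 1568 * exp 24 *
    ((LINT x|lebesgue_on Om. (norm (weak_grad Om \<phi> x))\<^sup>2) + sg * (LINT x|boundary_measure Om. (h x)\<^sup>2))"
    by (rule LIMSEQ_le[OF lims(2) tendsto_mult[OF tendsto_const tendsto_add[OF limg tendsto_mult[OF tendsto_const lims(1)]]]])
      (use b in blast)
qed

definition radial_log :: "real^2 \<Rightarrow> real" where "radial_log x = ln (norm x)"

lemma smooth_on_radial_log: "smooth_on (- {0}) radial_log"
  unfolding radial_log_def[abs_def]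
  by (intro smooth_on_ln smooth_on_norm) auto

lemma closure_Om_nonzero: "closure Om \<subseteq> - {0}" using zero_notin_closure_Om by blast

lemma radial_log_L2: "radial_log \<in> L2 (boundary_measure Om)"
  by (rule continuous_on_frontier_L2, rule continuous_on_subset[OF smooth_on_imp_continuous[OF smooth_on_radial_log]])
    (use closure_Om_nonzero frontier_Om_subset in blast)

lemma open_nonzero: "open (- {0 :: real^2})" by (rule open_Compl) (rule closed_singleton)

lemmas radial_log_trace = has_trace_smooth[OF Om_open Om_bounded open_nonzero closure_Om_nonzero
    smooth_on_radial_log radial_log_L2]

lemma radial_log_H1: "radial_log \<in> H1 Om"
  by (rule is_weak_grad_smooth(2)[OF Om_open Om_bounded open_nonzero closure_Om_nonzero smooth_on_radial_log])

lemma weak_grad_L2: "u \<in> H1 Om \<Longrightarrow> weak_grad Om u \<in> L2 (lebesgue_on Om)"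
  using is_weak_grad_weak_grad[of u Om] by (simp add: is_weak_grad_def)

text \<open>Green's formula holds for each smooth approximation of \<phi>, and both sides are inner
  products with a fixed square integrable function, so they converge.\<close>

lemma radial_log_weak_equation:
  assumes "has_trace Om \<phi> h"
  shows "(LINT x|lebesgue_on Om. weak_grad Om radial_log x \<bullet> weak_grad Om \<phi> x)
    = sg * (LINT x|boundary_measure Om. radial_log x * h x)"
proof -
  obtain F where F: "\<forall>n. \<exists>U. open U \<and> closure Om \<subseteq> U \<and> smooth_on U (F n)"
    "L2_tendsto (lebesgue_on Om) F \<phi>"
    "L2_tendsto (lebesgue_on Om) (\<lambda>n. grad (F n)) (weak_grad Om \<phi>)"
    "L2_tendsto (boundary_measure Om) F h"
    by (rule trace_approximation[OF assms])
  have gL: "grad (F n) \<in> L2 (lebesgue_on Om)" for n using F(3) by (simp add: L2_tendsto_def)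
  note wL = weak_grad_L2[OF radial_log_H1]
  have eq: "(LINT x|lebesgue_on Om. grad (F n) x \<bullet> weak_grad Om radial_log x)
      = sg * (LINT x|boundary_measure Om. F n x \<bullet> radial_log x)" for n
  proof -
    obtain U where U: "open U" "closure Om \<subseteq> U" "smooth_on U (F n)" using F(1) by blast
    have gr: "grad radial_log \<in> L2 (lebesgue_on Om)"
      using is_weak_grad_smooth(1)[OF Om_open Om_bounded open_nonzero closure_Om_nonzero smooth_on_radial_log]
      by (simp add: is_weak_grad_def)
    have "(LINT x|lebesgue_on Om. grad (F n) x \<bullet> weak_grad Om radial_log x)
        = (LINT x|lebesgue_on Om. grad radial_log x \<bullet> grad (F n) x)"
    proof (rule integral_cong_AE)
      show "(\<lambda>x. grad (F n) x \<bullet> weak_grad Om radial_log x) \<in> borel_measurable (lebesgue_on Om)"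
        by (intro borel_measurable_inner L2_memD(1) gL wL)
      show "(\<lambda>x. grad radial_log x \<bullet> grad (F n) x) \<in> borel_measurable (lebesgue_on Om)"
        by (intro borel_measurable_inner L2_memD(1) gL gr)
      show "AE x in lebesgue_on Om. grad (F n) x \<bullet> weak_grad Om radial_log x = grad radial_log x \<bullet> grad (F n) x"
        using radial_log_trace(2) by eventually_elim (simp add: inner_commute)
    qed
    also have "\<dots> = sg * (LINT x|boundary_measure Om. ln (norm x) * F n x)"
      using Green_ln_norm[OF U] by (simp only: radial_log_def[abs_def])
    finally show ?thesis by (simp add: radial_log_def mult.commute)
  qed
  have "(\<lambda>n. LINT x|lebesgue_on Om. grad (F n) x \<bullet> weak_grad Om radial_log x)
      \<longlonglongrightarrow> (LINT x|lebesgue_on Om. weak_grad Om \<phi> x \<bullet> weak_grad Om radial_log x)"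
    by (rule L2_tendsto_inner[OF F(3) wL])
  moreover have "(\<lambda>n. sg * (LINT x|boundary_measure Om. F n x \<bullet> radial_log x))
      \<longlonglongrightarrow> sg * (LINT x|boundary_measure Om. h x \<bullet> radial_log x)"
    by (intro tendsto_mult tendsto_const L2_tendsto_inner[OF F(4) radial_log_L2])
  ultimately have "(LINT x|lebesgue_on Om. weak_grad Om \<phi> x \<bullet> weak_grad Om radial_log x)
      = sg * (LINT x|boundary_measure Om. h x \<bullet> radial_log x)"
    unfolding eq by (rule LIMSEQ_unique)
  then show ?thesis by (simp add: inner_commute mult.commute)
qed

lemma steklov_eigenfunction_radial_log: "steklov_eigenfunction Om sg radial_log"
  unfolding steklov_eigenfunction_def
proof (intro conjI exI[of _ radial_log] ballI allI impI)
  show "\<not> (AE x in lebesgue_on Om. radial_log x = 0)"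
  proof
    assume "AE x in lebesgue_on Om. radial_log x = 0"
    then have ae: "AE x in lebesgue. x \<in> Om \<longrightarrow> radial_log x = 0"
      using Om_open by (simp add: AE_restrict_space_iff)
    \<comment> \<open>On the open outer part \<open>0 < s < 12\<close> the logarithm is positive,
      and a nonempty open set is not negligible.\<close>
    define V where "V = polar_region (\<lambda>_. 0) 12"
    have V: "open V" "V \<noteq> {}"
      unfolding V_def by (rule open_polar_region polar_region_nonempty; simp)+
    have sub: "x \<in> Om \<and> radial_log x \<noteq> 0" if "x \<in> V" for x
    proof -
      obtain s t where st: "x = pol s t" "0 < s" "s < 12" using \<open>x \<in> V\<close> by (auto simp: V_def polar_region_def)
      then have "zig t < s" using zig_bounds(2)[of t] by simp
      then show ?thesis using st by (auto simp: polar_region_def radial_log_def)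
    qed
    have "AE x in lebesgue. x \<notin> V" using ae by eventually_elim (use sub in blast)
    moreover have "V \<in> sets lebesgue" using borel_open[OF V(1)] by (intro sets_completionI_sets) simp
    ultimately have "V \<in> null_sets lebesgue" using AE_iff_null_sets[of V lebesgue] by blast
    then show False using open_not_negligible[OF V] by (simp add: negligible_iff_null_sets)
  qed
qed (use radial_log_H1 radial_log_trace(1) radial_log_weak_equation in auto)

text \<open>Supplies the test function that forces eigenfunctions with positive eigenvalue to have
  boundary mean 0.\<close>

lemma one_trace:
  "has_trace Om (\<lambda>_. 1) (\<lambda>_. 1)" "AE x in lebesgue_on Om. weak_grad Om (\<lambda>_. 1) x = 0"
proof -
  have s: "smooth_on UNIV (\<lambda>_::real^2. 1::real)" by (rule smooth_on_const) simp
  have L: "(\<lambda>_. 1::real) \<in> L2 (boundary_measure Om)"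
    by (rule continuous_on_frontier_L2) simp
  note t = has_trace_smooth[OF Om_open Om_bounded open_UNIV subset_UNIV s L]
  show "has_trace Om (\<lambda>_. 1) (\<lambda>_. 1)" by (rule t(1))
  have g0: "grad (\<lambda>_. 1) x = 0" for x :: "real^2" by (rule grad_eqI) simp
  show "AE x in lebesgue_on Om. weak_grad Om (\<lambda>_. 1) x = 0"
    using t(2) by eventually_elim (simp add: g0)
qed

lemma first_eigenvalue_Om: "first_positive_steklov_eigenvalue Om sg"
  unfolding first_positive_steklov_eigenvalue_def
proof (intro conjI allI impI)
  show "steklov_eigenvalue Om sg"
    using steklov_eigenfunction_radial_log by (auto simp: steklov_eigenvalue_def)
  show "0 < sg" by (rule sg_bounds)
  fix \<tau> assume "steklov_eigenvalue Om \<tau> \<and> 0 < \<tau>"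
  then obtain u where u: "steklov_eigenfunction Om \<tau> u" and \<tau>: "0 < \<tau>" by (auto simp: steklov_eigenvalue_def)
  then obtain g where H: "u \<in> H1 Om" and nz: "\<not> (AE x in lebesgue_on Om. u x = 0)" and tr: "has_trace Om u g"
    and ef: "\<And>\<phi> h. \<phi> \<in> H1 Om \<Longrightarrow> has_trace Om \<phi> h \<Longrightarrow>
       (LINT x|lebesgue_on Om. weak_grad Om u x \<bullet> weak_grad Om \<phi> x) = \<tau> * (LINT x|boundary_measure Om. g x * h x)"
    by (auto simp: steklov_eigenfunction_def)
  define G where "G = (LINT x|boundary_measure Om. (g x)\<^sup>2)"
  define E where "E = (LINT x|lebesgue_on Om. (norm (weak_grad Om u x))\<^sup>2)"
  have EG: "E = \<tau> * G"
    unfolding E_def G_def power2_norm_eq_inner power2_eq_square[of "g _"] by (rule ef[OF H tr])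
  have mean: "(LINT x|boundary_measure Om. g x) = 0"
  proof -
    have "(LINT x|lebesgue_on Om. weak_grad Om u x \<bullet> weak_grad Om (\<lambda>_. 1) x) = 0"
      by (rule integral_eq_zero_AE) (use one_trace(2) in \<open>eventually_elim, simp\<close>)
    then show ?thesis
      using ef[OF _ one_trace(1)] one_trace(1) \<tau> by (simp add: has_trace_def)
  qed
  have ineq: "sg * G \<le> E" using trace_energy_inequality(1)[OF tr] by (simp add: mean E_def G_def)
  have G0: "0 \<le> G" unfolding G_def by (rule Bochner_Integration.integral_nonneg) simp
  \<comment> \<open>A vanishing trace would make the energy \<open>\<tau> * G\<close> vanish as
    well, and then the Friedrichs inequality would make \<open>u\<close> zero almost
    everywhere.\<close>
  have "G \<noteq> 0"
  proof
    assume G: "G = 0"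
    have "(LINT x|lebesgue_on Om. (u x)\<^sup>2) \<le> 0"
      using trace_energy_inequality(2)[OF tr] EG G by (simp add: E_def G_def)
    moreover have "0 \<le> (LINT x|lebesgue_on Om. (u x)\<^sup>2)"
      by (rule Bochner_Integration.integral_nonneg) simp
    ultimately have z: "(LINT x|lebesgue_on Om. (u x)\<^sup>2) = 0" by simp
    have "u \<in> L2 (lebesgue_on Om)" using H by (simp add: H1_def)
    then have "integrable (lebesgue_on Om) (\<lambda>x. (u x)\<^sup>2)" using L2_memD(2)[of u] by simp
    from integral_nonneg_eq_0_iff_AE[OF this] z have "AE x in lebesgue_on Om. (u x)\<^sup>2 = 0" by simp
    then show False using nz by simp
  qed
  then have "0 < G" using G0 by simp
  then show "sg \<le> \<tau>" using ineq EG by simp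
qed

theorem theorem2:
  shows "\<exists>(\<Omega> :: (real^2) set) (\<sigma>\<^sub>1 :: real) (u\<^sub>1 :: real^2 \<Rightarrow> real) (\<gamma> :: real \<Rightarrow> real^2).
    bounded_domain \<Omega> \<and> doubly_connected \<Omega> \<and> lipschitz_boundary \<Omega> \<and>
    first_positive_steklov_eigenvalue \<Omega> \<sigma>\<^sub>1 \<and>
    steklov_eigenfunction \<Omega> \<sigma>\<^sub>1 u\<^sub>1 \<and> continuous_on \<Omega> u\<^sub>1 \<and>
    simple_closed_curve \<gamma> \<and> path_image \<gamma> \<subseteq> nodal_set \<Omega> u\<^sub>1 \<and>
    card (components (frontier \<Omega>)) = 2 \<and>
    homotopic_to_boundary_components \<Omega> \<gamma>"
proof -
  have zig0: "zig t \<le> 0" "zig t < 0" for t using zig_bounds(2)[of t] by simp_all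
  let ?\<gamma> = "polar_curve (\<lambda>_. 0)"
  have "bounded_domain Om" by (rule bounded_domain_polar_region[OF Om_facts])
  moreover have "doubly_connected Om" by (rule doubly_connected_polar_region)
  moreover have "lipschitz_boundary Om"
    by (rule lipschitz_boundary_polar_region[OF Om_facts _ zig_Lipschitz]) simp
  moreover have "continuous_on Om radial_log"
    by (rule continuous_on_subset[OF smooth_on_imp_continuous[OF smooth_on_radial_log]])
      (use closure_Om_nonzero closure_subset[of Om] in blast)
  moreover have "simple_closed_curve ?\<gamma>"
    by (rule simple_closed_polar_curve[OF Om_facts]) auto
  moreover have "path_image ?\<gamma> \<subseteq> nodal_set Om radial_log"
  proof
    fix x assume "x \<in> path_image ?\<gamma>"
    then obtain t where t: "x = pol 0 t" by (auto simp: path_image_def polar_curve_def)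
    have "x \<in> Om" unfolding t pol_mem_polar_region[OF Om_facts] using zig0 by simp
    then show "x \<in> nodal_set Om radial_log" by (simp add: nodal_set_def radial_log_def t)
  qed
  moreover have "card (components (frontier Om)) = 2"
    by (rule components_frontier_polar_region(2)[OF Om_facts])
  moreover have "homotopic_to_boundary_components Om ?\<gamma>"
    by (rule homotopic_to_boundary_components_polar_curve[OF Om_facts]) (use zig0 in auto)
  ultimately show ?thesis
    using first_eigenvalue_Om steklov_eigenfunction_radial_log
    by (intro exI[of _ Om] exI[of _ sg] exI[of _ radial_log] exI[of _ ?\<gamma>] conjI)
qed

end
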